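(* Let $(X,f)$ be a topological dynamical system with $h_{\mathrm{top}}(f)<+\infty$, and let $\varphi,\psi\in C(X,\mathbb{R})$ with $\psi>0$. Let $\mathcal{F}$ be a non-empty subset of $\mathcal{M}(X,f)$. Then ($\mathcal{F}$ is the set of equilibrium states of $P_\psi(\beta\varphi)$ for all $\beta\ge1$) if and only if both of the following hold: (1) $\mathcal{F}$ is the set of equilibrium states of $P_\psi(\varphi)$; (2) for all $\mu\in\mathcal{F}$, $$\frac{\int\varphi\,d\mu}{\int\psi\,d\mu}=\sup_{\nu\in\mathcal{M}(X,f)}\frac{\int\varphi\,d\nu}{\int\psi\,d\nu}.$$
   Context: A topological dynamical system (TDS) $(X,f)$ is a continuous map $f:X\to X$ on a compact metric space $(X,d)$; $h_{\mathrm{top}}(f)$ is its topological entropy. $C(X,\mathbb{R})$ is the space of continuous real functions on $X$; $S_n\varphi=\sum_{i=0}^{n-1}\varphi\circ f^i$; $\mathbb{N}$ denotes the positive integers; $\mathcal{M}(X,f)$ is the set of $f$-invariant Borel probability measures and $h_\mu(f)$ the measure-theoretic entropy. Let $d_n(x,y)=\max\{d(f^ix,f^iy):0\le i\le n-1\}$. For nonempty $Z\subset X$, a set $F_n\subset X$ is an $(n,\varepsilon)$-spanning set of $Z$ if for each $y\in Z$ there is $x\in F_n$ with $d_n(x,y)\le\varepsilon$. For $\psi>0$ and $T>0$ let $S_T=\{n\in\mathbb{N}:\exists x\in X,\ S_n\psi(x)\le T\text{ and }S_{n+1}\psi(x)>T\}$, and for $n\in S_T$ let $X_n=\{x\in X:S_n\psi(x)\le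 T\text{ and }S_{n+1}\psi(x)>T\}$. Put $$Q_{\psi,T}(f,\varphi,\varepsilon)=\inf\Big\{\sum_{n\in S_T}\sum_{x\in F_n}e^{S_n\varphi(x)}:F_n\text{ is an }(n,\varepsilon)\text{-spanning set of }X_n,\ n\in S_T\Big\}.$$ The $\psi$-induced topological pressure of $\varphi$ is $P_\psi(\varphi)=\lim_{\varepsilon\to0}\limsup_{T\to\infty}\frac1T\log Q_{\psi,T}(f,\varphi,\varepsilon)$. A measure $\mu\in\mathcal{M}(X,f)$ is an equilibrium state of $P_\psi(\varphi)$ if $P_\psi(\varphi)=\frac{h_\mu(f)+\int\varphi\,d\mu}{\int\psi\,d\mu}$. *)

theory Defs
  imports "HOL-Probability.Probability"
begin

text \<open>
  The phase space is a whole type of class \<open>metric_space\<close>, assumed compact where this is needed.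
  Pressures and entropies are extended reals.
\<close>

definition birkhoff_sum :: "('a \<Rightarrow> 'a) \<Rightarrow> ('a \<Rightarrow> real) \<Rightarrow> nat \<Rightarrow> 'a \<Rightarrow> real" where
  "birkhoff_sum f \<phi> n x = (\<Sum>i<n. \<phi> ((f ^^ i) x))"

text \<open>Only meaningful for \<open>n > 0\<close>, since the maximum is taken over \<open>0 \<le> i \<le> n - 1\<close>.\<close>

definition bowen_dist :: "('a::metric_space \<Rightarrow> 'a) \<Rightarrow> nat \<Rightarrow> 'a \<Rightarrow> 'a \<Rightarrow> real" where
  "bowen_dist f n x y = Max ((\<lambda>i. dist ((f ^^ i) x) ((f ^^ i) y)) ` {..<n})"

definition spanning_set ::
  "('a::metric_space \<Rightarrow> 'a) \<Rightarrow> nat \<Rightarrow> real \<Rightarrow> 'a set \<Rightarrow> 'a set \<Rightarrow> bool" where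
  "spanning_set f n \<epsilon> Z F \<longleftrightarrow> (\<forall>y\<in>Z. \<exists>x\<in>F. bowen_dist f n x y \<le> \<epsilon>)"


subsection \<open>Topological entropy (Bowen's definition)\<close>

definition spanning_number :: "('a::metric_space \<Rightarrow> 'a) \<Rightarrow> nat \<Rightarrow> real \<Rightarrow> nat" where
  "spanning_number f n \<epsilon> = Inf {card F | F. finite F \<and> spanning_set f n \<epsilon> UNIV F}"

definition topological_entropy :: "('a::metric_space \<Rightarrow> 'a) \<Rightarrow> ereal" where
  "topological_entropy f =
     Lim (at_right 0)
       (\<lambda>\<epsilon>. limsup (\<lambda>n. ereal (ln (real (spanning_number f n \<epsilon>)) / real n)))"


subsection \<open>Invariant measures and measure-theoretic entropy\<close>

definition invariant_measures :: "('a::topological_space \<Rightarrow> 'a) \<Rightarrow> 'a measure set" where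
  "invariant_measures f = {\<mu>. sets \<mu> = sets borel \<and> prob_space \<mu> \<and> distr \<mu> borel f = \<mu>}"

definition finite_measurable_partitions :: "'a measure \<Rightarrow> 'a set set set" where
  "finite_measurable_partitions \<mu> = {\<xi>. finite \<xi> \<and> \<xi> \<subseteq> sets \<mu> \<and> partition_on (space \<mu>) \<xi>}"

text \<open>Since \<open>ln 0 = 0\<close> in HOL, null atoms contribute \<open>0\<close>, which is the usual convention.\<close>

definition partition_entropy :: "'a measure \<Rightarrow> 'a set set \<Rightarrow> real" where
  "partition_entropy \<mu> \<xi> = - (\<Sum>A\<in>\<xi>. measure \<mu> A * ln (measure \<mu> A))"

text \<open>The join of the partitions \<open>f\<^sup>-\<^sup>i \<xi>\<close> for \<open>0 \<le> i < n\<close>; the atoms are indexed by their itineraries \<open>c\<close>.\<close>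

definition iterated_join :: "('a \<Rightarrow> 'a) \<Rightarrow> 'a set set \<Rightarrow> nat \<Rightarrow> 'a set set" where
  "iterated_join f \<xi> n = {(\<Inter>i<n. (f ^^ i) -` c i) | c. \<forall>i<n. c i \<in> \<xi>} - {{}}"

definition entropy_wrt_partition :: "('a \<Rightarrow> 'a) \<Rightarrow> 'a measure \<Rightarrow> 'a set set \<Rightarrow> ereal" where
  "entropy_wrt_partition f \<mu> \<xi> =
     lim (\<lambda>n. ereal (partition_entropy \<mu> (iterated_join f \<xi> n) / real n))"

definition measure_entropy :: "('a \<Rightarrow> 'a) \<Rightarrow> 'a measure \<Rightarrow> ereal" where
  "measure_entropy f \<mu> = (SUP \<xi>\<in>finite_measurable_partitions \<mu>. entropy_wrt_partition f \<mu> \<xi>)"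


subsection \<open>Induced topological pressure\<close>

text \<open>The logarithm as a map from \<open>[0,\<infinity>]\<close> to \<open>[-\<infinity>,\<infinity>]\<close>.\<close>

definition ln_ennreal :: "ennreal \<Rightarrow> ereal" where
  "ln_ennreal x = (if x = 0 then -\<infinity> else if x = \<infinity> then \<infinity> else ereal (ln (enn2real x)))"

definition level_set :: "('a \<Rightarrow> 'a) \<Rightarrow> ('a \<Rightarrow> real) \<Rightarrow> real \<Rightarrow> nat \<Rightarrow> 'a set" where
  "level_set f \<psi> T n = {x. birkhoff_sum f \<psi> n x \<le> T \<and> birkhoff_sum f \<psi> (n + 1) x > T}"

definition level_times :: "('a \<Rightarrow> 'a) \<Rightarrow> ('a \<Rightarrow> real) \<Rightarrow> real \<Rightarrow> nat set" where
  "level_times f \<psi> T =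
     {n. n > 0 \<and> (\<exists>x. birkhoff_sum f \<psi> n x \<le> T \<and> birkhoff_sum f \<psi> (n + 1) x > T)}"

text \<open>
  The spanning sets are arbitrary, possibly infinite, so the sums are formed in \<open>[0,\<infinity>]\<close>, where
  they always exist.
\<close>

definition induced_Q ::
  "('a::metric_space \<Rightarrow> 'a) \<Rightarrow> ('a \<Rightarrow> real) \<Rightarrow> ('a \<Rightarrow> real) \<Rightarrow> real \<Rightarrow> real \<Rightarrow> ennreal" where
  "induced_Q f \<psi> \<phi> T \<epsilon> =
     Inf {(\<Sum>\<^sub>\<infinity>n\<in>level_times f \<psi> T. \<Sum>\<^sub>\<infinity>x\<in>F n. ennreal (exp (birkhoff_sum f \<phi> n x))) | F.
            \<forall>n\<in>level_times f \<psi> T. spanning_set f n \<epsilon> (level_set f \<psi> T n) (F n)}"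

definition induced_pressure ::
  "('a::metric_space \<Rightarrow> 'a) \<Rightarrow> ('a \<Rightarrow> real) \<Rightarrow> ('a \<Rightarrow> real) \<Rightarrow> ereal" where
  "induced_pressure f \<psi> \<phi> =
     Lim (at_right 0)
       (\<lambda>\<epsilon>. Limsup at_top (\<lambda>T::real. ereal (1 / T) * ln_ennreal (induced_Q f \<psi> \<phi> T \<epsilon>)))"

definition equilibrium_states ::
  "('a::metric_space \<Rightarrow> 'a) \<Rightarrow> ('a \<Rightarrow> real) \<Rightarrow> ('a \<Rightarrow> real) \<Rightarrow> 'a measure set" where
  "equilibrium_states f \<psi> \<phi> =
     {\<mu> \<in> invariant_measures f.
        induced_pressure f \<psi> \<phi> =
          (measure_entropy f \<mu> + ereal (\<integral>x. \<phi> x \<partial>\<mu>)) / ereal (\<integral>x. \<psi> x \<partial>\<mu>)}"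

end

theory Submission
  imports Defs "HOL-Real_Asymp.Real_Asymp"
begin

text \<open>
  For an invariant measure \<open>\<mu>\<close> write \<open>\<eta>(\<mu>) = h(\<mu>) / \<integral>\<psi> d\<mu>\<close> and \<open>\<alpha>(\<mu>) = \<integral>\<phi> d\<mu> / \<integral>\<psi> d\<mu>\<close>, and
  let \<open>P(\<beta>)\<close> be the induced pressure of \<open>\<beta>\<phi>\<close>. Then \<open>\<mu>\<close> is an equilibrium state of \<open>P(\<beta>)\<close> iff
  \<open>P(\<beta>) = \<eta>(\<mu>) + \<beta> \<alpha>(\<mu>)\<close>. Two facts about \<open>P\<close> suffice; the full variational principle
  is not needed.

  \<^item> \<open>\<eta>(\<mu>) + \<beta> \<alpha>(\<mu>) \<le> P(\<beta>)\<close> for every invariant \<open>\<mu>\<close>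
    (\<open>free_energy_quotient_le_induced_pressure\<close>), and \<open>P(\<beta>) < \<infinity>\<close> because the topological
    entropy is finite (\<open>induced_pressure_less_top\<close>). Hence, if \<open>\<mu>\<close> is an equilibrium state for all
    \<open>\<beta> \<ge> 1\<close>, then \<open>\<beta> (\<alpha>(\<nu>) - \<alpha>(\<mu>)) \<le> \<eta>(\<mu>)\<close> for all \<open>\<beta> \<ge> 1\<close> and every invariant \<open>\<nu>\<close>, so
    \<open>\<mu>\<close> maximises \<open>\<alpha>\<close>.

  \<^item> If \<open>a\<close> is the maximum of \<open>\<alpha>\<close>, then \<open>P(\<beta>) \<le> P(1) + (\<beta> - 1) a\<close> for \<open>\<beta> \<ge> 1\<close>
    (\<open>induced_pressure_add_le\<close> and \<open>birkhoff_growth_le\<close>). If the equilibrium states of \<open>P(1)\<close>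
    maximise \<open>\<alpha>\<close>, the first fact turns this into an equality, and comparing the terms of
    \<open>P(\<beta>) = P(1) + (\<beta> - 1) a\<close> shows that \<open>P(\<beta>)\<close> and \<open>P(1)\<close> have the same equilibrium states.

  The first fact is reduced to spanning sets of the whole space: for \<open>s > P(\<phi>)\<close> the level sets of
  finitely many levels \<open>T\<close> cover the space, and the union of nearly optimal spanning sets for these
  levels has a weight for the potential \<open>\<phi> - s \<psi>\<close> whose exponential growth rate in time is arbitrarily
  small at small scales. The entropy is then bounded by
  \<open>entropy_plus_integral_le_spanning\<close>, a variant of Misiurewicz's argument: each atom of a partition is
  replaced by a closed subset, up to a set \<open>R\<close> of small measure, and every visit to \<open>R\<close> is charged
  a large constant \<open>L\<close> in the potential. The itineraries that are shadowed by one point then have a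
  total weight of small exponential growth rate, so no passage to powers of \<open>f\<close> and no conditional
  entropy is necessary.

  The second fact needs the uniform estimate \<open>S\<^sub>n \<phi> \<le> (a + e) S\<^sub>n \<psi>\<close> for large \<open>n\<close>. If it failed, the
  empirical measures along the offending orbits would accumulate at an invariant measure with
  \<open>\<alpha> > a\<close>. This limit is taken among finitely additive set functions, where it exists by
  Tychonoff's theorem, and is then made into a Borel measure by regularisation and Caratheodory's
  construction (\<open>invariant_measure_from_orbit_averages\<close>).
\<close>

section \<open>Entropy of finite partitions\<close>

lemma gibbs_inequality:
  fixes p q :: "'i \<Rightarrow> real"
  assumes "finite I" and p: "\<And>i. i \<in> I \<Longrightarrow> 0 \<le> p i" and "sum p I = 1"
    and q: "\<And>i. i \<in> I \<Longrightarrow> 0 \<le> q i" and "sum q I \<le> 1"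
    and pq: "\<And>i. i \<in> I \<Longrightarrow> 0 < p i \<Longrightarrow> 0 < q i"
  shows "- (\<Sum>i\<in>I. p i * ln (p i)) \<le> - (\<Sum>i\<in>I. p i * ln (q i))"
proof -
  have "p i * ln (q i) - p i * ln (p i) \<le> q i - p i" if "i \<in> I" for i
  proof (cases "p i = 0")
    case True
    then show ?thesis using q[OF that] by simp
  next
    case False
    then have pos: "0 < p i" "0 < q i" using p[OF that] pq[OF that] by auto
    have "p i * (ln (q i) - ln (p i)) = p i * ln (q i / p i)"
      using pos by (simp add: ln_div)
    also have "\<dots> \<le> p i * (q i / p i - 1)"
      using pos by (intro mult_left_mono ln_le_minus_one) auto
    also have "\<dots> = q i - p i" using pos by (simp add: field_simps)
    finally show ?thesis by (simp add: algebra_simps)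
  qed
  then have "(\<Sum>i\<in>I. p i * ln (q i) - p i * ln (p i)) \<le> (\<Sum>i\<in>I. q i - p i)"
    by (rule sum_mono)
  then show ?thesis using assms by (simp add: sum_subtractf)
qed

text \<open>
  Indexed families with repeated empty members have the entropy of the underlying partition,
  since empty members contribute \<open>0 * ln 0 = 0\<close>.
\<close>
lemma partition_entropy_image:
  assumes "finite I" and disj: "disjoint_family_on g I"
  shows "partition_entropy \<mu> (g ` I - {{}}) = - (\<Sum>i\<in>I. measure \<mu> (g i) * ln (measure \<mu> (g i)))"
proof -
  let ?J = "{i \<in> I. g i \<noteq> {}}"
  have inj: "inj_on g ?J"
    using disj by (fastforce simp: inj_on_def disjoint_family_on_def)
  have "g ` I - {{}} = g ` ?J" by auto
  then have "partition_entropy \<mu> (g ` I - {{}}) = - (\<Sum>i\<in>?J. measure \<mu> (g i) * ln (measure \<mu> (g i)))"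
    unfolding partition_entropy_def using sum.reindex[OF inj] by simp
  also have "(\<Sum>i\<in>?J. measure \<mu> (g i) * ln (measure \<mu> (g i))) =
      (\<Sum>i\<in>I. measure \<mu> (g i) * ln (measure \<mu> (g i)))"
    using assms(1) by (intro sum.mono_neutral_left) auto
  finally show ?thesis .
qed

lemma invariant_measuresD:
  assumes "\<mu> \<in> invariant_measures f"
  shows "sets \<mu> = sets borel" "prob_space \<mu>" "distr \<mu> borel f = \<mu>" "space \<mu> = UNIV"
  using assms sets_eq_imp_space_eq[of \<mu> borel] by (auto simp: invariant_measures_def)

lemma continuous_on_funpow:
  assumes "continuous_on UNIV (f :: 'a::topological_space \<Rightarrow> 'a)"
  shows "continuous_on UNIV (f ^^ n)"
proof (induction n)
  case (Suc n)
  show ?case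
    using continuous_on_compose[OF Suc continuous_on_subset[OF assms subset_UNIV]] by simp
qed (simp add: id_def)

lemma distr_funpow_invariant:
  fixes f :: "'a::topological_space \<Rightarrow> 'a"
  assumes "\<mu> \<in> invariant_measures f" and "continuous_on UNIV f"
  shows "distr \<mu> borel (f ^^ n) = \<mu>"
proof (induction n)
  case 0
  have "distr \<mu> borel id = distr \<mu> \<mu> id"
    using invariant_measuresD[OF assms(1)] by (intro distr_cong) auto
  then show ?case by (simp add: id_def)
next
  case (Suc n)
  have [measurable]: "f \<in> borel \<rightarrow>\<^sub>M borel" "f ^^ n \<in> borel \<rightarrow>\<^sub>M borel"
    using assms(2) continuous_on_funpow by (auto intro!: borel_measurable_continuous_onI)
  have [measurable_cong]: "sets \<mu> = sets borel" by (rule invariant_measuresD[OF assms(1)])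
  have "distr \<mu> borel (f ^^ Suc n) = distr (distr \<mu> borel (f ^^ n)) borel f"
    by (subst distr_distr) (auto simp: comp_def)
  also have "\<dots> = \<mu>" using Suc invariant_measuresD(3)[OF assms(1)] by simp
  finally show ?case .
qed

lemma measure_funpow_vimage:
  fixes f :: "'a::topological_space \<Rightarrow> 'a"
  assumes "\<mu> \<in> invariant_measures f" and "continuous_on UNIV f" and "A \<in> sets borel"
  shows "measure \<mu> ((f ^^ n) -` A) = measure \<mu> A"
proof -
  have "f ^^ n \<in> \<mu> \<rightarrow>\<^sub>M borel"
    using borel_measurable_continuous_onI[OF continuous_on_funpow[OF assms(2)]]
      invariant_measuresD[OF assms(1)] by (simp cong: measurable_cong_sets)
  then have "measure (distr \<mu> borel (f ^^ n)) A = measure \<mu> ((f ^^ n) -` A \<inter> space \<mu>)"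
    using assms(3) by (rule measure_distr)
  then show ?thesis using invariant_measuresD[OF assms(1)] distr_funpow_invariant[OF assms(1,2)] by simp
qed

lemma iterated_joinI:
  assumes "\<And>i. i < n \<Longrightarrow> c i \<in> \<xi>" and "(\<Inter>i<n. (f ^^ i) -` c i) \<noteq> {}"
  shows "(\<Inter>i<n. (f ^^ i) -` c i) \<in> iterated_join f \<xi> n"
  using assms unfolding iterated_join_def by (simp del: INT_iff) blast

lemma iterated_join_altdef:
  "iterated_join f \<xi> n = (\<lambda>c. \<Inter>i<n. (f ^^ i) -` c i) ` ({..<n} \<rightarrow>\<^sub>E \<xi>) - {{}}"
proof -
  have "(\<Inter>i<n. (f ^^ i) -` c i) \<in> (\<lambda>c. \<Inter>i<n. (f ^^ i) -` c i) ` ({..<n} \<rightarrow>\<^sub>E \<xi>)"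
    if "\<forall>i<n. c i \<in> \<xi>" for c
    using that by (intro image_eqI[of _ _ "restrict c {..<n}"]) auto
  then show ?thesis unfolding iterated_join_def by (auto simp: PiE_iff)
qed

lemma iterated_join_partition:
  assumes "finite \<xi>" and "partition_on UNIV \<xi>"
  shows "finite (iterated_join f \<xi> n)" "partition_on UNIV (iterated_join f \<xi> n)"
proof -
  show "finite (iterated_join f \<xi> n)"
    unfolding iterated_join_altdef using assms(1) by (intro finite_Diff finite_imageI finite_PiE) auto
  show "partition_on UNIV (iterated_join f \<xi> n)"
  proof (rule partition_onI)
    have "\<exists>A\<in>iterated_join f \<xi> n. x \<in> A" for x
    proof -
      have "\<forall>i. \<exists>A\<in>\<xi>. (f ^^ i) x \<in> A" using assms(2) by (auto simp: partition_on_def)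
      then obtain c where "\<forall>i. c i \<in> \<xi> \<and> (f ^^ i) x \<in> c i" by metis
      then show ?thesis
        by (intro bexI[of _ "\<Inter>i<n. (f ^^ i) -` c i"]) (auto simp: iterated_join_def)
    qed
    then show "\<Union> (iterated_join f \<xi> n) = UNIV" by blast
  next
    fix p q assume pq: "p \<in> iterated_join f \<xi> n" "q \<in> iterated_join f \<xi> n" "p \<noteq> q"
    obtain c where c: "p = (\<Inter>i<n. (f ^^ i) -` c i)" "\<forall>i<n. c i \<in> \<xi>"
      using pq(1) unfolding iterated_join_def by auto
    obtain d where d: "q = (\<Inter>i<n. (f ^^ i) -` d i)" "\<forall>i<n. d i \<in> \<xi>"
      using pq(2) unfolding iterated_join_def by auto
    obtain i where i: "i < n" "c i \<noteq> d i" using pq(3) c(1) d(1) by (metis (no_types, lifting) INF_cong lessThan_iff)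
    then have "c i \<inter> d i = {}" using c(2) d(2) assms(2)
      by (auto simp: partition_on_def disjoint_def)
    then show "disjnt p q" using i c(1) d(1) by (auto simp: disjnt_def)
  qed (auto simp: iterated_join_def)
qed

lemma iterated_join_sets:
  fixes f :: "'a::topological_space \<Rightarrow> 'a"
  assumes "\<xi> \<subseteq> sets borel" and "continuous_on UNIV f"
  shows "iterated_join f \<xi> n \<subseteq> sets borel"
proof -
  have "(f ^^ i) -` A \<in> sets borel" if "A \<in> sets borel" for i A
    using measurable_sets[OF borel_measurable_continuous_onI[OF continuous_on_funpow[OF assms(2), of i]] that]
    by simp
  then show ?thesis using assms(1)
    by (cases "n = 0") (auto simp: iterated_join_def intro!: sets.finite_INT)
qed

text \<open>
  The join of \<open>n + m\<close> preimages is the join of the first \<open>n\<close> with the \<open>n\<close>-th preimage of the join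
  of the first \<open>m\<close>; this is what makes the entropies subadditive.
\<close>
lemma iterated_join_add:
  "iterated_join f \<xi> (n + m) =
    (\<lambda>(A, B). A \<inter> (f ^^ n) -` B) ` (iterated_join f \<xi> n \<times> iterated_join f \<xi> m) - {{}}"
    (is "?L = ?R")
proof (intro equalityI subsetI)
  have split: "(\<Inter>i<n + m. (f ^^ i) -` c i) =
      (\<Inter>i<n. (f ^^ i) -` c i) \<inter> (f ^^ n) -` (\<Inter>i<m. (f ^^ i) -` c (n + i))" for c
  proof (intro equalityI subsetI)
    fix x assume x: "x \<in> (\<Inter>i<n + m. (f ^^ i) -` c i)"
    have "(f ^^ i) ((f ^^ n) x) \<in> c (n + i)" if "i < m" for i
    proof -
      have "(f ^^ (n + i)) x \<in> c (n + i)" using x that by auto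
      then show ?thesis using funpow_add[of i n f] by (simp add: add.commute)
    qed
    then show "x \<in> (\<Inter>i<n. (f ^^ i) -` c i) \<inter> (f ^^ n) -` (\<Inter>i<m. (f ^^ i) -` c (n + i))"
      using x by auto
  next
    fix x assume x: "x \<in> (\<Inter>i<n. (f ^^ i) -` c i) \<inter> (f ^^ n) -` (\<Inter>i<m. (f ^^ i) -` c (n + i))"
    have "(f ^^ i) x \<in> c i" if "i < n + m" for i
    proof (cases "i < n")
      case False
      then have "i - n < m" using that by simp
      then have "(f ^^ (i - n)) ((f ^^ n) x) \<in> c (n + (i - n))" using x by auto
      moreover have "(f ^^ (i - n)) ((f ^^ n) x) = (f ^^ i) x"
        using False funpow_add[of "i - n" n f] by (simp add: fun_eq_iff)
      ultimately show ?thesis using False by simp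
    qed (use x in auto)
    then show "x \<in> (\<Inter>i<n + m. (f ^^ i) -` c i)" by auto
  qed
  {
    fix C assume "C \<in> ?L"
    then obtain c where c: "C = (\<Inter>i<n + m. (f ^^ i) -` c i)" "\<forall>i<n + m. c i \<in> \<xi>" "C \<noteq> {}"
      unfolding iterated_join_def by blast
    let ?A = "\<Inter>i<n. (f ^^ i) -` c i" and ?B = "\<Inter>i<m. (f ^^ i) -` c (n + i)"
    have eq: "C = ?A \<inter> (f ^^ n) -` ?B" using c(1) split by simp
    then have ne: "?A \<noteq> {}" "?B \<noteq> {}" using c(3) by blast+
    have "?A \<in> iterated_join f \<xi> n" "?B \<in> iterated_join f \<xi> m"
      using ne c(2) by (auto intro!: iterated_joinI simp del: INT_iff INT_simps)
    then show "C \<in> ?R" using eq c(3) by (auto intro!: image_eqI[of _ _ "(?A, ?B)"])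
  }
  {
    fix C assume "C \<in> ?R"
    then obtain A B where AB: "C = A \<inter> (f ^^ n) -` B" "C \<noteq> {}"
      "A \<in> iterated_join f \<xi> n" "B \<in> iterated_join f \<xi> m" by auto
    obtain a where a: "A = (\<Inter>i<n. (f ^^ i) -` a i)" "\<forall>i<n. a i \<in> \<xi>"
      using AB(3) unfolding iterated_join_def by auto
    obtain b where b: "B = (\<Inter>i<m. (f ^^ i) -` b i)" "\<forall>i<m. b i \<in> \<xi>"
      using AB(4) unfolding iterated_join_def by auto
    let ?c = "\<lambda>i. if i < n then a i else b (i - n)"
    have "C = (\<Inter>i<n + m. (f ^^ i) -` ?c i)"
      unfolding split[of ?c] AB(1) a(1) b(1) by (simp cong: INF_cong_simp)
    moreover have "\<forall>i<n + m. ?c i \<in> \<xi>" using a(2) b(2) by simp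
    ultimately show "C \<in> ?L" using AB(2) iterated_joinI[of "n + m" ?c \<xi> f] by simp
  }
qed

lemma (in prob_space) sum_prob_partition:
  assumes "finite \<beta>" and "partition_on UNIV \<beta>" and "\<And>B. B \<in> \<beta> \<Longrightarrow> A \<inter> g -` B \<in> events"
  shows "(\<Sum>B\<in>\<beta>. prob (A \<inter> g -` B)) = prob A"
proof -
  have "(\<Sum>B\<in>\<beta>. prob (A \<inter> g -` B)) = prob (\<Union>B\<in>\<beta>. A \<inter> g -` B)"
  proof (intro finite_measure_finite_Union[symmetric] assms(1))
    show "disjoint_family_on (\<lambda>B. A \<inter> g -` B) \<beta>"
      using partition_onD2[OF assms(2)] unfolding disjoint_family_on_def disjoint_def by blast
  qed (use assms(3) in auto)
  also have "(\<Union>B\<in>\<beta>. A \<inter> g -` B) = A" using assms(2) by (auto simp: partition_on_def)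
  finally show ?thesis .
qed

lemma partition_entropy_subadditive:
  fixes f :: "'a::topological_space \<Rightarrow> 'a"
  assumes \<mu>: "\<mu> \<in> invariant_measures f" and f: "continuous_on UNIV f"
    and \<xi>: "\<xi> \<in> finite_measurable_partitions \<mu>"
  shows "partition_entropy \<mu> (iterated_join f \<xi> (n + m)) \<le>
    partition_entropy \<mu> (iterated_join f \<xi> n) + partition_entropy \<mu> (iterated_join f \<xi> m)"
proof -
  note \<mu>D = invariant_measuresD[OF \<mu>]
  interpret prob_space \<mu> by (rule \<mu>D)
  let ?\<alpha> = "iterated_join f \<xi> n" and ?\<beta> = "iterated_join f \<xi> m"
  have \<xi>': "finite \<xi>" "partition_on UNIV \<xi>" "\<xi> \<subseteq> sets borel"
    using \<xi> \<mu>D by (auto simp: finite_measurable_partitions_def)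
  note fin = iterated_join_partition(1)[OF \<xi>'(1,2), of f]
  note part = iterated_join_partition(2)[OF \<xi>'(1,2), of f]
  have meas: "A \<in> sets borel" if "A \<in> iterated_join f \<xi> k" for A and k :: nat
    using iterated_join_sets[OF \<xi>'(3) f] that by blast
  have vim: "(f ^^ n) -` B \<in> sets borel" if "B \<in> ?\<beta>" for B
    using measurable_sets[OF borel_measurable_continuous_onI[OF continuous_on_funpow[OF f, of n]]] meas[OF that]
    by force
  define g where "g = (\<lambda>(A, B). A \<inter> (f ^^ n) -` B)"
  define p where "p z = measure \<mu> (g z)" for z
  \<comment> \<open>The product distribution; comparing with it gives the subadditivity of entropy.\<close>
  define q where "q z = measure \<mu> (fst z) * measure \<mu> (snd z)" for z
  have rows: "(\<Sum>B\<in>?\<beta>. p (A, B)) = measure \<mu> A" if "A \<in> ?\<alpha>" for A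
    unfolding p_def g_def using sum_prob_partition[OF fin part, where A = A and g = "f ^^ n"] meas[OF that] vim \<mu>D by simp
  have cols: "(\<Sum>A\<in>?\<alpha>. p (A, B)) = measure \<mu> B" if B: "B \<in> ?\<beta>" for B
  proof -
    have "(\<Sum>A\<in>?\<alpha>. p (A, B)) = (\<Sum>A\<in>?\<alpha>. measure \<mu> ((f ^^ n) -` B \<inter> id -` A))"
      by (simp add: p_def g_def Int_commute)
    also have "\<dots> = measure \<mu> ((f ^^ n) -` B)"
      using sum_prob_partition[OF fin part, where A = "(f ^^ n) -` B" and g = id] vim[OF B] meas \<mu>D by simp
    finally show ?thesis using measure_funpow_vimage[OF \<mu> f meas[OF B]] by simp
  qed
  have total: "(\<Sum>A\<in>iterated_join f \<xi> k. measure \<mu> A) = 1" for k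
    using sum_prob_partition[OF fin part, where A = UNIV and g = id] meas \<mu>D prob_space by simp
  have "disjoint_family_on g (?\<alpha> \<times> ?\<beta>)"
  proof (unfold disjoint_family_on_def, intro ballI impI)
    fix z w assume zw: "z \<in> ?\<alpha> \<times> ?\<beta>" "w \<in> ?\<alpha> \<times> ?\<beta>" "z \<noteq> w"
    then have "fst z \<inter> fst w = {} \<or> snd z \<inter> snd w = {}"
      using disjointD[OF partition_onD2[OF part]] by (metis mem_Times_iff prod_eq_iff)
    then show "g z \<inter> g w = {}" by (auto simp: g_def case_prod_unfold)
  qed
  then have "partition_entropy \<mu> (iterated_join f \<xi> (n + m)) = - (\<Sum>z\<in>?\<alpha> \<times> ?\<beta>. p z * ln (p z))"
    unfolding iterated_join_add p_def using partition_entropy_image[of "?\<alpha> \<times> ?\<beta>" g] fin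
    by (simp add: g_def)
  also have "\<dots> \<le> - (\<Sum>z\<in>?\<alpha> \<times> ?\<beta>. p z * ln (q z))"
  proof (rule gibbs_inequality)
    show "sum p (?\<alpha> \<times> ?\<beta>) = 1"
      using rows total sum.cartesian_product[of "\<lambda>A B. p (A, B)" ?\<beta> ?\<alpha>] by (simp add: case_prod_eta)
    have "sum q (?\<alpha> \<times> ?\<beta>) = (\<Sum>A\<in>?\<alpha>. measure \<mu> A) * (\<Sum>B\<in>?\<beta>. measure \<mu> B)"
      unfolding q_def by (simp add: sum_product sum.cartesian_product case_prod_unfold)
    then show "sum q (?\<alpha> \<times> ?\<beta>) \<le> 1" using total by simp
    fix z assume z: "z \<in> ?\<alpha> \<times> ?\<beta>" and "0 < p z"
    have "p z \<le> measure \<mu> (fst z)" unfolding p_def g_def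
      using z meas \<mu>D by (auto intro!: finite_measure_mono)
    moreover have "p z \<le> measure \<mu> ((f ^^ n) -` snd z)" unfolding p_def g_def
      using z vim \<mu>D by (auto intro!: finite_measure_mono)
    moreover have "measure \<mu> ((f ^^ n) -` snd z) = measure \<mu> (snd z)"
      using z meas by (intro measure_funpow_vimage[OF \<mu> f]) auto
    ultimately show "0 < q z" using \<open>0 < p z\<close> unfolding q_def by simp
  qed (use fin in \<open>auto simp: p_def q_def\<close>)
  also have "(\<Sum>z\<in>?\<alpha> \<times> ?\<beta>. p z * ln (q z)) =
      (\<Sum>z\<in>?\<alpha> \<times> ?\<beta>. p z * ln (measure \<mu> (fst z)) + p z * ln (measure \<mu> (snd z)))"
  proof (intro sum.cong refl)
    fix z assume z: "z \<in> ?\<alpha> \<times> ?\<beta>"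
    show "p z * ln (q z) = p z * ln (measure \<mu> (fst z)) + p z * ln (measure \<mu> (snd z))"
    proof (cases "measure \<mu> (fst z) = 0 \<or> measure \<mu> (snd z) = 0")
      case True
      have "p z \<le> measure \<mu> (fst z)" unfolding p_def g_def
        using z meas \<mu>D by (auto intro!: finite_measure_mono)
      moreover have "p z \<le> measure \<mu> ((f ^^ n) -` snd z)" unfolding p_def g_def
        using z vim \<mu>D by (auto intro!: finite_measure_mono)
      moreover have "measure \<mu> ((f ^^ n) -` snd z) = measure \<mu> (snd z)"
        using z meas by (intro measure_funpow_vimage[OF \<mu> f]) auto
      moreover have "0 \<le> p z" by (simp add: p_def)
      ultimately have "p z = 0" using True by auto
      then show ?thesis by simp
    next
      case False
      then show ?thesis unfolding q_def by (simp add: ln_mult algebra_simps)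
    qed
  qed
  also have "\<dots> = (\<Sum>A\<in>?\<alpha>. \<Sum>B\<in>?\<beta>. p (A, B) * ln (measure \<mu> A)) + (\<Sum>A\<in>?\<alpha>. \<Sum>B\<in>?\<beta>. p (A, B) * ln (measure \<mu> B))"
    by (simp add: sum.distrib sum.cartesian_product case_prod_unfold)
  also have "(\<Sum>A\<in>?\<alpha>. \<Sum>B\<in>?\<beta>. p (A, B) * ln (measure \<mu> A)) = (\<Sum>A\<in>?\<alpha>. measure \<mu> A * ln (measure \<mu> A))"
    using rows by (simp add: sum_distrib_right[symmetric])
  also have "(\<Sum>A\<in>?\<alpha>. \<Sum>B\<in>?\<beta>. p (A, B) * ln (measure \<mu> B)) = (\<Sum>B\<in>?\<beta>. measure \<mu> B * ln (measure \<mu> B))"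
    by (subst sum.swap) (use cols in \<open>simp add: sum_distrib_right[symmetric]\<close>)
  finally show ?thesis by (simp add: partition_entropy_def)
qed

text \<open>Fekete's lemma, for nonnegative sequences.\<close>
lemma subadditive_converges:
  fixes a :: "nat \<Rightarrow> real"
  assumes nonneg: "\<And>n. 0 \<le> a n" and sub: "\<And>n m. a (n + m) \<le> a n + a m"
  shows "convergent (\<lambda>n. a n / real n)"
proof -
  define l where "l = (INF n\<in>{1..}. a n / real n)"
  have bdd: "bdd_below ((\<lambda>n. a n / real n) ` {1..})"
    by (rule bdd_belowI[of _ 0]) (auto simp: nonneg)
  have mult: "a (q * k) \<le> real q * a k + a 0" for q k
  proof (induction q)
    case (Suc q)
    have "a (Suc q * k) \<le> a k + a (q * k)" using sub[of k "q * k"] by simp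
    then show ?case using Suc by (simp add: algebra_simps)
  qed simp
  have "(\<lambda>n. a n / real n) \<longlonglongrightarrow> l"
  proof (rule LIMSEQ_I)
    fix r :: real assume "0 < r"
    obtain k where k: "k \<ge> 1" "a k / real k < l + r / 2"
      using cInf_lessD[of "(\<lambda>n. a n / real n) ` {1..}" "l + r / 2"] \<open>0 < r\<close> by (auto simp: l_def)
    define c where "c = a 0 + Max (a ` {..<k})"
    obtain N :: nat where N: "2 * c / r < real N" using reals_Archimedean2 by blast
    have "norm (a n / real n - l) < r" if "n \<ge> max N 1" for n
    proof -
      have n: "real n > 0" "2 * c / r < real n" using that N by auto
      have "a n = a (n div k * k + n mod k)" by simp
      also have "\<dots> \<le> a (n div k * k) + a (n mod k)" by (rule sub)
      also have "\<dots> \<le> real (n div k) * a k + c"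
      proof -
        have "a (n mod k) \<le> Max (a ` {..<k})" using k(1) by (intro Max_ge) auto
        then show ?thesis using mult[of "n div k" k] by (simp add: c_def)
      qed
      also have "real (n div k) * a k \<le> real n / real k * a k"
        by (intro mult_right_mono nonneg) (rule of_nat_div_le_of_nat)
      finally have "a n / real n \<le> a k / real k + c / real n"
        using n(1) k(1) by (simp add: field_simps)
      moreover have "c / real n < r / 2" using n \<open>0 < r\<close> by (simp add: field_simps)
      moreover have "l \<le> a n / real n" unfolding l_def using that by (intro cINF_lower bdd) auto
      ultimately show ?thesis using k(2) unfolding real_norm_def by linarith
    qed
    then show "\<exists>N. \<forall>n\<ge>N. norm (a n / real n - l) < r" by blast
  qed
  then show ?thesis by (rule convergentI)
qed

text \<open>
  The limit in the definition of the entropy of a partition exists and is real.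
\<close>
lemma entropy_wrt_partition_tendsto:
  fixes f :: "'a::topological_space \<Rightarrow> 'a"
  assumes \<mu>: "\<mu> \<in> invariant_measures f" and f: "continuous_on UNIV f"
    and \<xi>: "\<xi> \<in> finite_measurable_partitions \<mu>"
  obtains h where "(\<lambda>n. partition_entropy \<mu> (iterated_join f \<xi> n) / real n) \<longlonglongrightarrow> h"
    and "entropy_wrt_partition f \<mu> \<xi> = ereal h"
proof -
  interpret prob_space \<mu> by (rule invariant_measuresD[OF \<mu>])
  have "0 \<le> partition_entropy \<mu> \<zeta>" for \<zeta>
  proof -
    have "prob A * ln (prob A) \<le> 0" for A
      by (cases "prob A = 0") (auto intro!: mult_nonneg_nonpos simp: zero_less_measure_iff)
    then show ?thesis unfolding partition_entropy_def by (simp add: sum_nonpos)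
  qed
  then have "convergent (\<lambda>n. partition_entropy \<mu> (iterated_join f \<xi> n) / real n)"
    by (rule subadditive_converges) (rule partition_entropy_subadditive[OF assms])
  then obtain h where h: "(\<lambda>n. partition_entropy \<mu> (iterated_join f \<xi> n) / real n) \<longlonglongrightarrow> h"
    by (auto simp: convergent_def)
  then have "entropy_wrt_partition f \<mu> \<xi> = ereal h"
    unfolding entropy_wrt_partition_def by (intro limI) simp
  with h that show ?thesis by blast
qed

lemma measure_entropy_nonneg:
  fixes f :: "'a::topological_space \<Rightarrow> 'a"
  assumes "\<mu> \<in> invariant_measures f"
  shows "0 \<le> measure_entropy f \<mu>"
proof -
  note \<mu>D = invariant_measuresD[OF assms]
  interpret prob_space \<mu> by (rule \<mu>D)
  have "{UNIV} \<in> finite_measurable_partitions \<mu>"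
    using \<mu>D by (auto simp: finite_measurable_partitions_def partition_on_def)
  moreover have "iterated_join f {UNIV} n = {UNIV}" for n
    by (auto simp: iterated_join_altdef image_def PiE_iff intro!: bexI[of _ "restrict (\<lambda>_. UNIV) {..<n}"])
  moreover have "partition_entropy \<mu> {UNIV} = 0"
    using prob_space \<mu>D by (simp add: partition_entropy_def)
  ultimately have "entropy_wrt_partition f \<mu> {UNIV} = 0"
    by (simp add: entropy_wrt_partition_def limI zero_ereal_def[symmetric])
  then show ?thesis unfolding measure_entropy_def
    using \<open>{UNIV} \<in> _\<close> by (metis SUP_upper)
qed

section \<open>Birkhoff sums and Bowen balls\<close>

lemma bowen_dist_le_iff:
  assumes "0 < n"
  shows "bowen_dist f n x y \<le> \<epsilon> \<longleftrightarrow> (\<forall>i<n. dist ((f ^^ i) x) ((f ^^ i) y) \<le> \<epsilon>)"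
  unfolding bowen_dist_def using assms by (subst Max_le_iff) auto

lemma compact_uniform_modulus:
  fixes g :: "'a::metric_space \<Rightarrow> 'b::metric_space"
  assumes "compact (UNIV :: 'a set)" and "continuous_on UNIV g" and "0 < e"
  obtains \<delta> where "0 < \<delta>" and "\<And>x y. dist x y \<le> \<delta> \<Longrightarrow> dist (g x) (g y) \<le> e"
proof -
  have "uniformly_continuous_on UNIV g"
    using assms by (intro compact_uniformly_continuous)
  then obtain d where "0 < d" and d: "\<And>x y. dist x y < d \<Longrightarrow> dist (g x) (g y) < e"
    using \<open>0 < e\<close> by (auto simp: uniformly_continuous_on_def)
  show ?thesis
    by (rule that[of "d / 2"]) (use \<open>0 < d\<close> d in \<open>auto intro!: less_imp_le\<close>)
qed

lemma compact_bounded_real: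
  fixes g :: "'a::metric_space \<Rightarrow> real"
  assumes "compact (UNIV :: 'a set)" and "continuous_on UNIV g"
  obtains B where "0 < B" and "\<And>x. \<bar>g x\<bar> \<le> B"
proof -
  have "bounded (range g)"
    using assms by (intro compact_imp_bounded compact_continuous_image)
  then show ?thesis using that by (auto simp: bounded_pos)
qed

lemma birkhoff_sum_close:
  assumes "\<And>x y. dist x y \<le> \<delta> \<Longrightarrow> dist (g x) (g y) \<le> e" and "0 < n" and "bowen_dist f n x y \<le> \<delta>"
  shows "\<bar>birkhoff_sum f g n x - birkhoff_sum f g n y\<bar> \<le> real n * e"
proof -
  have "\<bar>birkhoff_sum f g n x - birkhoff_sum f g n y\<bar> \<le>
      (\<Sum>i<n. \<bar>g ((f ^^ i) x) - g ((f ^^ i) y)\<bar>)"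
    unfolding birkhoff_sum_def sum_subtractf[symmetric] by (rule sum_abs)
  also have "\<dots> \<le> (\<Sum>i<n. e)"
    using assms by (intro sum_mono) (simp add: bowen_dist_le_iff dist_real_def)
  finally show ?thesis by simp
qed

lemma birkhoff_sum_abs_le:
  assumes "\<And>x. \<bar>g x\<bar> \<le> B"
  shows "\<bar>birkhoff_sum f g n x\<bar> \<le> real n * B"
proof -
  have "\<bar>birkhoff_sum f g n x\<bar> \<le> (\<Sum>i<n. \<bar>g ((f ^^ i) x)\<bar>)"
    unfolding birkhoff_sum_def by (rule sum_abs)
  also have "\<dots> \<le> (\<Sum>i<n. B)" by (intro sum_mono assms)
  finally show ?thesis by simp
qed

lemma birkhoff_sum_diff:
  "birkhoff_sum f (\<lambda>x. g x - c * h x) n x = birkhoff_sum f g n x - c * birkhoff_sum f h n x"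
  by (simp add: birkhoff_sum_def sum_subtractf sum_distrib_left)

lemma birkhoff_sum_Suc: "birkhoff_sum f g (Suc n) x = birkhoff_sum f g n x + g ((f ^^ n) x)"
  by (simp add: birkhoff_sum_def)

lemma integral_birkhoff_sum:
  fixes f :: "'a::topological_space \<Rightarrow> 'a" and g :: "'a \<Rightarrow> real"
  assumes \<mu>: "\<mu> \<in> invariant_measures f" and f: "continuous_on UNIV f"
    and g: "g \<in> borel_measurable borel" "\<And>x. \<bar>g x\<bar> \<le> B"
  shows "integrable \<mu> (birkhoff_sum f g n)"
    and "(\<integral>x. birkhoff_sum f g n x \<partial>\<mu>) = real n * (\<integral>x. g x \<partial>\<mu>)"
proof -
  note \<mu>D = invariant_measuresD[OF \<mu>]
  interpret prob_space \<mu> by (rule \<mu>D)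
  have fi: "(f ^^ i) \<in> \<mu> \<rightarrow>\<^sub>M borel" for i
    using borel_measurable_continuous_onI[OF continuous_on_funpow[OF f]] \<mu>D
    by (simp cong: measurable_cong_sets)
  have int: "integrable \<mu> (\<lambda>x. g ((f ^^ i) x))" for i
    using g by (intro integrable_const_bound[of _ B] measurable_compose[OF fi]) auto
  have "(\<integral>x. g ((f ^^ i) x) \<partial>\<mu>) = (\<integral>x. g x \<partial>\<mu>)" for i
    using integral_distr[OF fi g(1), of i] distr_funpow_invariant[OF \<mu> f, of i] by simp
  then show "(\<integral>x. birkhoff_sum f g n x \<partial>\<mu>) = real n * (\<integral>x. g x \<partial>\<mu>)"
    unfolding birkhoff_sum_def using int by simp
  show "integrable \<mu> (birkhoff_sum f g n)"
    unfolding birkhoff_sum_def using int by (intro Bochner_Integration.integrable_sum)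
qed

section \<open>Regularity of Borel measures on metric spaces\<close>

lemma open_closure_exhaustion:
  fixes U :: "'a::metric_space set"
  assumes "open U"
  obtains W :: "nat \<Rightarrow> 'a set" where "\<And>n. open (W n)" "\<And>n. closure (W n) \<subseteq> U" "incseq W" "(\<Union>n. W n) = U"
proof (cases "U = UNIV")
  case True
  then show ?thesis using that[of "\<lambda>_. UNIV"] by (simp add: incseq_def)
next
  case False
  define W where "W n = {x. inverse (real (Suc n)) < infdist x (- U)}" for n
  show ?thesis
  proof (rule that)
    show "open (W n)" for n
      unfolding W_def by (intro open_Collect_less continuous_intros)
    show "closure (W n) \<subseteq> U" for n
    proof -
      have "closed {x. inverse (real (Suc n)) \<le> infdist x (- U)}"
        by (intro closed_Collect_le continuous_intros)
      then have "closure (W n) \<subseteq> {x. inverse (real (Suc n)) \<le> infdist x (- U)}"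
        unfolding W_def by (intro closure_minimal) auto
      also have "\<dots> \<subseteq> U"
      proof
        fix x assume "x \<in> {x. inverse (real (Suc n)) \<le> infdist x (- U)}"
        then have "0 < infdist x (- U)"
          using order_less_le_trans[of 0 "inverse (real (Suc n))"] by auto
        then show "x \<in> U" by (metis ComplI infdist_zero order_less_irrefl)
      qed
      finally show ?thesis .
    qed
    show "incseq W"
    proof (rule incseq_SucI)
      fix n
      have "inverse (real (Suc (Suc n))) \<le> inverse (real (Suc n))" by (simp add: field_simps)
      then show "W n \<subseteq> W (Suc n)" unfolding W_def using order_le_less_trans by blast
    qed
    have "\<exists>n. x \<in> W n" if "x \<in> U" for x
    proof -
      have "infdist x (- U) \<noteq> 0"
        using that assms False in_closed_iff_infdist_zero[of "- U" x] by auto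
      then have "0 < infdist x (- U)" using infdist_nonneg[of x "- U"] by linarith
      then show ?thesis using reals_Archimedean by (force simp: W_def)
    qed
    moreover have "W n \<subseteq> U" for n
      using \<open>closure (W n) \<subseteq> U\<close> closure_subset by blast
    ultimately show "(\<Union>n. W n) = U" by blast
  qed
qed

text \<open>
  Every Borel set lies between a closed and an open set with a difference of small measure;
  neither completeness nor separability of the space is needed.
\<close>
lemma closed_open_regular:
  fixes \<mu> :: "'a::metric_space measure"
  assumes "finite_measure \<mu>" and sets: "sets \<mu> = sets borel" and "A \<in> sets borel" and "0 < e"
  shows "\<exists>K U. closed K \<and> open U \<and> K \<subseteq> A \<and> A \<subseteq> U \<and> measure \<mu> (U - K) < e"
proof -
  interpret finite_measure \<mu> by fact
  have open_sets [simp]: "open S \<Longrightarrow> S \<in> sets \<mu>" and closed_sets [simp]: "closed S \<Longrightarrow> S \<in> sets \<mu>" for S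
    unfolding sets by simp_all
  have "A \<in> sigma_sets UNIV {S. open S}"
    using \<open>A \<in> sets borel\<close> by (simp add: borel_def)
  then show ?thesis using \<open>0 < e\<close>
  proof (induction arbitrary: e rule: sigma_sets.induct)
    case (Basic U)
    then have U: "open U" by simp
    obtain W where W: "\<And>n. open (W n)" "\<And>n. closure (W n) \<subseteq> U" "incseq W" "(\<Union>n. W n) = U"
      using open_closure_exhaustion[OF U] by blast
    have "x \<in> W n \<Longrightarrow> x \<in> closure (W n)" for x n using closure_subset by blast
    then have "(\<Inter>n. U - closure (W n)) = {}" using W(4) by blast
    moreover have "decseq (\<lambda>n. U - closure (W n))"
      using W(3) unfolding monotone_on_def by (intro ballI impI Diff_mono order_refl closure_mono) auto
    moreover have "range (\<lambda>n. U - closure (W n)) \<subseteq> sets \<mu>" using U by (auto intro!: sets.Diff)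
    ultimately have "(\<lambda>n. measure \<mu> (U - closure (W n))) \<longlonglongrightarrow> 0"
      using finite_Lim_measure_decseq[of "\<lambda>n. U - closure (W n)"] by (simp del: INT_simps)
    then have "\<forall>\<^sub>F n in sequentially. measure \<mu> (U - closure (W n)) < e"
      using \<open>0 < e\<close> by (rule order_tendstoD(2))
    then obtain n where "measure \<mu> (U - closure (W n)) < e"
      using eventually_happens'[OF sequentially_bot] by blast
    then show ?case using W(2)[of n] U
      by (intro exI[of _ "closure (W n)"] exI[of _ U] conjI order_refl closed_closure)
  next
    case Empty
    then show ?case by (intro exI[of _ "{}"]) auto
  next
    case (Compl A)
    obtain K U where KU: "closed K" "open U" "K \<subseteq> A" "A \<subseteq> U" "measure \<mu> (U - K) < e"
      using Compl.IH[OF Compl.prems] by auto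
    have "- K - - U = U - K" by auto
    then show ?case using KU by (intro exI[of _ "- U"] exI[of _ "- K"] conjI) auto
  next
    case (Union A)
    define d where "d i = (e / 2) * (1 / 2) ^ Suc i" for i
    have d_sums: "d sums (e / 2)"
      unfolding d_def using power_half_series sums_mult[of "\<lambda>i. (1 / 2) ^ Suc i" 1 "e / 2"] by simp
    have "\<forall>i. \<exists>K U. closed K \<and> open U \<and> K \<subseteq> A i \<and> A i \<subseteq> U \<and> measure \<mu> (U - K) < d i"
    proof
      fix i
      have "0 < d i" using \<open>0 < e\<close> by (simp add: d_def)
      then show "\<exists>K U. closed K \<and> open U \<and> K \<subseteq> A i \<and> A i \<subseteq> U \<and> measure \<mu> (U - K) < d i"
        by (rule Union.IH)
    qed
    then obtain K U where KU: "\<And>i. closed (K i)" "\<And>i. open (U i)" "\<And>i. K i \<subseteq> A i"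
      "\<And>i. A i \<subseteq> U i" "\<And>i. measure \<mu> (U i - K i) < d i" by metis
    have UK: "U i - K i \<in> sets \<mu>" for i using KU by (intro sets.Diff) auto
    have summ: "summable (\<lambda>i. measure \<mu> (U i - K i))"
      by (rule summable_comparison_test'[of d]) (use d_sums KU(5) less_imp_le in \<open>auto simp: sums_iff\<close>)
    have "measure \<mu> ((\<Union>i. U i) - (\<Union>i. K i)) \<le> measure \<mu> (\<Union>i. U i - K i)"
      by (intro finite_measure_mono sets.countable_UN) (auto simp: UK)
    also have "\<dots> \<le> (\<Sum>i. measure \<mu> (U i - K i))"
      by (intro finite_measure_subadditive_countably summ) (auto simp: UK)
    also have "\<dots> \<le> (\<Sum>i. d i)"
      using summ d_sums KU(5) by (intro suminf_le) (auto simp: sums_iff less_imp_le)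
    also have "\<dots> = e / 2" using d_sums by (simp add: sums_iff)
    finally have small: "measure \<mu> ((\<Union>i. U i) - (\<Union>i. K i)) \<le> e / 2" .
    define V where "V n = (\<Union>i. U i) - (\<Union>i\<le>n. K i)" for n
    have V_sets: "V n \<in> sets \<mu>" for n
      unfolding V_def by (intro sets.Diff) (auto simp: KU)
    have "(\<lambda>n. measure \<mu> (V n)) \<longlonglongrightarrow> measure \<mu> (\<Inter>n. V n)"
      using V_sets by (intro finite_Lim_measure_decseq) (auto simp: V_def decseq_def)
    moreover have "(\<Inter>n. V n) = (\<Union>i. U i) - (\<Union>i. K i)" unfolding V_def by auto
    ultimately have lim: "(\<lambda>n. measure \<mu> (V n)) \<longlonglongrightarrow> measure \<mu> ((\<Union>i. U i) - (\<Union>i. K i))" by simp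
    have "measure \<mu> ((\<Union>i. U i) - (\<Union>i. K i)) < e" using small \<open>0 < e\<close> by linarith
    with lim have "\<forall>\<^sub>F n in sequentially. measure \<mu> (V n) < e"
      by (rule order_tendstoD(2))
    then obtain n where "measure \<mu> (V n) < e"
      using eventually_happens'[OF sequentially_bot] by blast
    moreover have "closed (\<Union>i\<le>n. K i)" "open (\<Union>i. U i)" using KU(1,2) by (auto intro!: closed_UN)
    moreover have "(\<Union>i\<le>n. K i) \<subseteq> (\<Union>i. A i)" using KU(3) by (intro UN_mono) auto
    moreover have "(\<Union>i. A i) \<subseteq> (\<Union>i. U i)" using KU(4) by (intro UN_mono) auto
    ultimately show ?case unfolding V_def by blast
  qed
qed

section \<open>Entropy is bounded by weighted spanning sets\<close>

text \<open>
  The finite variational inequality \<open>H(p) + \<Sum> p u \<le> ln \<Sum> exp u\<close>, with the weight \<open>u\<close> of an atom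
  taken at a point of the atom where \<open>v\<close> is within \<open>1\<close> of its supremum.
\<close>
lemma partition_entropy_plus_integral_le:
  fixes v :: "'a \<Rightarrow> real"
  assumes "prob_space \<mu>" and sp: "space \<mu> = UNIV"
    and P: "finite P" "P \<subseteq> sets \<mu>" "partition_on UNIV P"
    and v: "v \<in> borel_measurable \<mu>" "\<And>x. \<bar>v x\<bar> \<le> B"
  obtains z where "\<And>C. C \<in> P \<Longrightarrow> z C \<in> C"
    and "partition_entropy \<mu> P + (\<integral>x. v x \<partial>\<mu>) \<le> 1 + ln (\<Sum>C\<in>P. exp (v (z C)))"
proof -
  interpret prob_space \<mu> by fact
  have "\<exists>z\<in>C. \<forall>x\<in>C. v x \<le> v z + 1" if C: "C \<in> P" for C
  proof -
    have "C \<noteq> {}" using P(3) C by (auto simp: partition_on_def)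
    moreover have bdd: "bdd_above (v ` C)" using v(2) by (intro bdd_aboveI[of _ B]) (auto simp: abs_le_iff)
    ultimately obtain z where "z \<in> C" "(SUP x\<in>C. v x) - 1 < v z"
      using less_cSUP_iff[of C v "(SUP x\<in>C. v x) - 1"] by auto
    moreover have "v x \<le> (SUP x\<in>C. v x)" if "x \<in> C" for x using that bdd by (rule cSUP_upper)
    ultimately show ?thesis by (intro bexI[of _ z]) force+
  qed
  then obtain z where z: "\<And>C. C \<in> P \<Longrightarrow> z C \<in> C" "\<And>C x. C \<in> P \<Longrightarrow> x \<in> C \<Longrightarrow> v x \<le> v (z C) + 1"
    by metis
  define Z where "Z = (\<Sum>C\<in>P. exp (v (z C)))"
  have "P \<noteq> {}" using P(3) by (auto simp: partition_on_def)
  then have "0 < Z" unfolding Z_def using P(1) by (intro sum_pos) auto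
  have total: "(\<Sum>C\<in>P. prob C) = 1"
    using sum_prob_partition[OF P(1,3), where A = UNIV and g = id] P(2) prob_space sp by auto
  have "partition_entropy \<mu> P \<le> - (\<Sum>C\<in>P. prob C * ln (exp (v (z C)) / Z))"
    unfolding partition_entropy_def
    using \<open>0 < Z\<close> P(1) total by (intro gibbs_inequality) (auto simp: Z_def sum_divide_distrib[symmetric])
  also have "\<dots> = ln Z - (\<Sum>C\<in>P. prob C * v (z C))"
    using \<open>0 < Z\<close> total
    by (simp add: ln_div right_diff_distrib sum_subtractf sum_distrib_right[symmetric])
  finally have ent: "partition_entropy \<mu> P \<le> ln Z - (\<Sum>C\<in>P. prob C * v (z C))" .
  have int_ind: "integrable \<mu> (\<lambda>x. indicator C x * (v (z C) + 1))" if "C \<in> P" for C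
    using P(2) that by (intro integrable_mult_left integrable_real_indicator) (auto simp: emeasure_eq_measure)
  have "(\<integral>x. v x \<partial>\<mu>) \<le> (\<integral>x. (\<Sum>C\<in>P. indicator C x * (v (z C) + 1)) \<partial>\<mu>)"
  proof (rule integral_mono)
    show "integrable \<mu> v" using v by (intro integrable_const_bound[of _ B]) auto
    show "integrable \<mu> (\<lambda>x. \<Sum>C\<in>P. indicator C x * (v (z C) + 1))"
      using int_ind by (rule Bochner_Integration.integrable_sum)
    fix x
    obtain C where C: "C \<in> P" "x \<in> C" using P(3) by (auto simp: partition_on_def)
    then have uniq: "D = C" if "D \<in> P" "x \<in> D" for D
      using that C disjointD[OF partition_onD2[OF P(3)], of D C] by blast
    have "(\<Sum>D\<in>P. indicator D x * (v (z D) + 1)) = (\<Sum>D\<in>{C}. indicator D x * (v (z D) + 1))"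
      using C P(1) by (intro sum.mono_neutral_right ballI) (auto simp: indicator_def dest: uniq)
    then show "v x \<le> (\<Sum>C\<in>P. indicator C x * (v (z C) + 1))" using z(2)[OF C] C by simp
  qed
  also have "\<dots> = (\<Sum>C\<in>P. prob C * (v (z C) + 1))"
    using int_ind P(2) sp by (subst Bochner_Integration.integral_sum) (auto intro!: sum.cong)
  also have "\<dots> = (\<Sum>C\<in>P. prob C * v (z C)) + 1"
    using total by (simp add: distrib_left sum.distrib)
  finally show ?thesis using that[of z] z(1) ent by (auto simp: Z_def)
qed

lemma finite_disjoint_closed_separated:
  fixes K :: "'i \<Rightarrow> 'a::metric_space set"
  assumes "compact (UNIV :: 'a set)" and "finite I" and "\<And>i. i \<in> I \<Longrightarrow> closed (K i)"
    and "disjoint_family_on K I"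
  obtains d where "0 < d" and "\<And>i j x y. i \<in> I \<Longrightarrow> j \<in> I \<Longrightarrow> i \<noteq> j \<Longrightarrow> x \<in> K i \<Longrightarrow> y \<in> K j \<Longrightarrow> d \<le> dist x y"
proof -
  have "\<exists>d>0. i \<noteq> j \<longrightarrow> (\<forall>x\<in>K i. \<forall>y\<in>K j. d \<le> dist x y)" if "i \<in> I" "j \<in> I" for i j
  proof (cases "i = j")
    case False
    have "compact (K i)"
      using compact_Int_closed[OF assms(1) assms(3)[OF that(1)]] by simp
    show ?thesis
    proof (cases "K i = {} \<or> K j = {}")
      case True
      then show ?thesis by (auto intro: exI[of _ 1])
    next
      case ne: False
      have "continuous_on (K i) (\<lambda>x. infdist x (K j))" by (intro continuous_intros)
      then obtain x0 where x0: "x0 \<in> K i" "\<And>x. x \<in> K i \<Longrightarrow> infdist x0 (K j) \<le> infdist x (K j)"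
        using continuous_attains_inf[OF \<open>compact (K i)\<close>] ne by blast
      have "x0 \<notin> K j" using x0(1) assms(4) that False by (auto simp: disjoint_family_on_def)
      then have "infdist x0 (K j) \<noteq> 0" using in_closed_iff_infdist_zero[OF assms(3)[OF that(2)]] ne by auto
      then have "0 < infdist x0 (K j)" using infdist_nonneg[of x0 "K j"] by linarith
      moreover have "infdist x0 (K j) \<le> dist x y" if "x \<in> K i" "y \<in> K j" for x y
        using x0(2)[OF that(1)] infdist_le[OF that(2), of x] by linarith
      ultimately show ?thesis by blast
    qed
  qed (auto intro: exI[of _ 1])
  then have "\<forall>p\<in>I \<times> I. \<exists>d>0. fst p \<noteq> snd p \<longrightarrow> (\<forall>x\<in>K (fst p). \<forall>y\<in>K (snd p). d \<le> dist x y)"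
    by auto
  then obtain d where d: "\<And>p. p \<in> I \<times> I \<Longrightarrow> 0 < d p"
    "\<And>p. p \<in> I \<times> I \<Longrightarrow> fst p \<noteq> snd p \<Longrightarrow> (\<forall>x\<in>K (fst p). \<forall>y\<in>K (snd p). d p \<le> dist x y)"
    by metis
  have fin: "finite (insert 1 (d ` (I \<times> I)))" using assms(2) by auto
  show ?thesis
  proof (rule that[of "Min (insert 1 (d ` (I \<times> I)))"])
    show "0 < Min (insert 1 (d ` (I \<times> I)))" using fin d(1) by (subst Min_gr_iff) auto
    fix i j x y assume "i \<in> I" "j \<in> I" "i \<noteq> j" "x \<in> K i" "y \<in> K j"
    then have "Min (insert 1 (d ` (I \<times> I))) \<le> d (i, j)" "d (i, j) \<le> dist x y"
      using fin d(2)[of "(i, j)"] by (auto intro!: Min_le)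
    then show "Min (insert 1 (d ` (I \<times> I))) \<le> dist x y" by simp
  qed
qed

text \<open>
  The measure-theoretic half of the variational principle in the style of Misiurewicz. The spanning sets
  may be infinite, so their weight is bounded through finite subsets; \<open>\<eta>\<close> bounds its exponential
  growth rate at a sequence of scales \<open>\<delta>\<close> tending to \<open>0\<close>.
\<close>
lemma entropy_plus_integral_le_spanning:
  fixes f :: "'a::metric_space \<Rightarrow> 'a" and g :: "'a \<Rightarrow> real"
  assumes cpt: "compact (UNIV :: 'a set)" and f: "continuous_on UNIV f" and g: "continuous_on UNIV g"
    and \<mu>: "\<mu> \<in> invariant_measures f" and \<xi>: "\<xi> \<in> finite_measurable_partitions \<mu>"
    and span: "\<And>\<delta>0. 0 < \<delta>0 \<Longrightarrow> \<exists>\<delta>>0. \<delta> \<le> \<delta>0 \<and> (\<forall>\<^sub>F n in sequentially. \<exists>E. spanning_set f n \<delta> UNIV E \<and>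
      (\<forall>D. finite D \<longrightarrow> D \<subseteq> E \<longrightarrow> (\<Sum>y\<in>D. exp (birkhoff_sum f g n y)) \<le> exp (real n * \<eta>)))"
  shows "entropy_wrt_partition f \<mu> \<xi> + ereal (\<integral>x. g x \<partial>\<mu>) \<le> ereal \<eta>"
proof -
  note \<mu>D = invariant_measuresD[OF \<mu>]
  interpret prob_space \<mu> by (rule \<mu>D)
  have \<xi>': "finite \<xi>" "partition_on UNIV \<xi>" "\<xi> \<subseteq> sets borel"
    using \<xi> \<mu>D by (auto simp: finite_measurable_partitions_def)
  obtain h where h: "(\<lambda>n. partition_entropy \<mu> (iterated_join f \<xi> n) / real n) \<longlonglongrightarrow> h"
    and h_eq: "entropy_wrt_partition f \<mu> \<xi> = ereal h"
    using entropy_wrt_partition_tendsto[OF \<mu> f \<xi>] by blast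
  define I where "I = (\<integral>x. g x \<partial>\<mu>)"
  obtain B where B: "0 < B" "\<And>x. \<bar>g x\<bar> \<le> B" using compact_bounded_real[OF cpt g] by blast
  have g_meas: "g \<in> borel_measurable borel" using g by (rule borel_measurable_continuous_onI)
  have \<xi>_ne: "\<xi> \<noteq> {}" using \<xi>'(2) by (auto simp: partition_on_def)
  then have k: "0 < card \<xi>" using \<xi>'(1) by (simp add: card_gt_0_iff)
  have "h + I \<le> \<eta> + 3 * e" if e: "0 < e" for e
  proof -
    \<comment> \<open>\<open>L\<close> is the price of a visit to \<open>R\<close>, chosen so that \<open>card \<xi> * exp (- L) \<le> e\<close>.\<close>
    define L where "L = ln (real (card \<xi>) / e + 1)"
    have L: "0 \<le> L" unfolding L_def using e by simp
    have "exp (- L) = 1 / (real (card \<xi>) / e + 1)"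
      unfolding L_def using e k by (simp add: exp_minus add_pos_pos inverse_eq_divide)
    then have "e * exp (- L) + real (card \<xi>) * exp (- L) = e" using e k by (simp add: field_simps)
    moreover have "0 \<le> e * exp (- L)" using e by simp
    ultimately have kL: "real (card \<xi>) * exp (- L) \<le> e" by linarith
    \<comment> \<open>Closed sets inside the atoms of \<open>\<xi>\<close> leave out a set \<open>R\<close> with \<open>L * prob R \<le> e\<close>.\<close>
    have "\<exists>K. closed K \<and> K \<subseteq> A \<and> prob (A - K) < e / (L + 1) / card \<xi>" if A: "A \<in> \<xi>" for A
    proof -
      have pos: "0 < e / (L + 1) / card \<xi>" using e L k by simp
      have "A \<in> sets borel" using \<xi>'(3) A by blast
      from closed_open_regular[OF finite_measure_axioms \<mu>D(1) this pos]
      obtain K U where KU: "closed K" "open U" "K \<subseteq> A" "A \<subseteq> U" "prob (U - K) < e / (L + 1) / card \<xi>" by auto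
      moreover have "prob (A - K) \<le> prob (U - K)"
        using KU \<mu>D(1) by (intro finite_measure_mono) auto
      ultimately show ?thesis by (intro exI[of _ K]) auto
    qed
    then obtain K where K: "\<And>A. A \<in> \<xi> \<Longrightarrow> closed (K A)" "\<And>A. A \<in> \<xi> \<Longrightarrow> K A \<subseteq> A"
      "\<And>A. A \<in> \<xi> \<Longrightarrow> prob (A - K A) < e / (L + 1) / card \<xi>" by metis
    define R where "R = - (\<Union>A\<in>\<xi>. K A)"
    have R_sets: "R \<in> sets borel"
      unfolding R_def using K(1) \<xi>'(1) by (intro borel_comp borel_closed closed_UN ballI)
    have "R \<subseteq> (\<Union>A\<in>\<xi>. A - K A)"
    proof
      fix x assume "x \<in> R"
      moreover obtain A where "A \<in> \<xi>" "x \<in> A" using partition_onD1[OF \<xi>'(2)] by blast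
      ultimately show "x \<in> (\<Union>A\<in>\<xi>. A - K A)" unfolding R_def by blast
    qed
    then have "prob R \<le> prob (\<Union>A\<in>\<xi>. A - K A)"
      using \<xi>' K(1) \<mu>D(1) by (intro finite_measure_mono sets.finite_UN sets.Diff) auto
    also have "\<dots> \<le> (\<Sum>A\<in>\<xi>. prob (A - K A))"
      using \<xi>' K(1) \<mu>D(1) by (intro finite_measure_subadditive_finite) (auto intro!: sets.Diff)
    also have "\<dots> \<le> (\<Sum>A\<in>\<xi>. e / (L + 1) / card \<xi>)" using K(3) by (intro sum_mono less_imp_le)
    also have "\<dots> = e / (L + 1)" using k by simp
    finally have "L * prob R \<le> L * (e / (L + 1))" using L by (intro mult_left_mono)
    also have "\<dots> \<le> e" using L e by (simp add: field_simps)
    finally have LR: "L * prob R \<le> e" .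
    have "disjoint_family_on K \<xi>"
      unfolding disjoint_family_on_def using K(2) disjointD[OF partition_onD2[OF \<xi>'(2)]] by blast
    then obtain d where d: "0 < d"
      "\<And>A A' x y. A \<in> \<xi> \<Longrightarrow> A' \<in> \<xi> \<Longrightarrow> A \<noteq> A' \<Longrightarrow> x \<in> K A \<Longrightarrow> y \<in> K A' \<Longrightarrow> d \<le> dist x y"
      using finite_disjoint_closed_separated[OF cpt \<xi>'(1), of K] K(1) by metis
    obtain \<delta>1 where \<delta>1: "0 < \<delta>1" "\<And>x y. dist x y \<le> \<delta>1 \<Longrightarrow> dist (g x) (g y) \<le> e"
      using compact_uniform_modulus[OF cpt g e] by blast
    obtain \<delta> where \<delta>: "0 < \<delta>" "\<delta> \<le> min (d / 3) \<delta>1"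
      and evE: "\<forall>\<^sub>F n in sequentially. \<exists>E. spanning_set f n \<delta> UNIV E \<and>
      (\<forall>D. finite D \<longrightarrow> D \<subseteq> E \<longrightarrow> (\<Sum>y\<in>D. exp (birkhoff_sum f g n y)) \<le> exp (real n * \<eta>))"
      using span[of "min (d / 3) \<delta>1"] d(1) \<delta>1(1) by auto
    have "\<forall>\<^sub>F n in sequentially. partition_entropy \<mu> (iterated_join f \<xi> n) / real n \<le> \<eta> + 3 * e - I + 1 / real n"
      using evE eventually_gt_at_top[of 0]
    proof eventually_elim
      case (elim n)
      then obtain E where E: "spanning_set f n \<delta> UNIV E"
        "\<And>D. finite D \<Longrightarrow> D \<subseteq> E \<Longrightarrow> (\<Sum>y\<in>D. exp (birkhoff_sum f g n y)) \<le> exp (real n * \<eta>)"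
        by auto
      have n: "0 < n" by fact
      let ?P = "iterated_join f \<xi> n"
      note P = iterated_join_partition[OF \<xi>'(1,2), of f n]
      define r :: "'a \<Rightarrow> real" where "r = indicator R"
      \<comment> \<open>The potential in which every visit to \<open>R\<close> costs \<open>L\<close>.\<close>
      define v where "v x = birkhoff_sum f g n x - L * birkhoff_sum f r n x" for x
      have r: "r \<in> borel_measurable borel" "\<And>x. \<bar>r x\<bar> \<le> 1"
        using R_sets by (auto simp: r_def indicator_def)
      note int_g = integral_birkhoff_sum[OF \<mu> f g_meas B(2), of n]
      note int_r = integral_birkhoff_sum[OF \<mu> f r, of n]
      have v_int: "(\<integral>x. v x \<partial>\<mu>) = real n * I - L * (real n * prob R)"
        unfolding v_def I_def using int_g int_r R_sets \<mu>D by (simp add: r_def)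
      have "v \<in> borel_measurable \<mu>"
        unfolding v_def using int_g(1) int_r(1) by (intro borel_measurable_diff borel_measurable_times) auto
      moreover have "\<bar>v x\<bar> \<le> real n * B + L * (real n * 1)" for x
      proof -
        have "\<bar>L * birkhoff_sum f r n x\<bar> \<le> L * (real n * 1)"
          using birkhoff_sum_abs_le[of r 1 f n x] r(2) L by (simp add: abs_mult mult_left_mono)
        then show ?thesis using birkhoff_sum_abs_le[of g B f n x, OF B(2)] unfolding v_def by linarith
      qed
      ultimately obtain z where z: "\<And>C. C \<in> ?P \<Longrightarrow> z C \<in> C"
        and ent: "partition_entropy \<mu> ?P + (\<integral>x. v x \<partial>\<mu>) \<le> 1 + ln (\<Sum>C\<in>?P. exp (v (z C)))"
        using partition_entropy_plus_integral_le[OF prob_space_axioms \<mu>D(4) P(1) _ P(2), of v]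
          iterated_join_sets[OF \<xi>'(3) f, of n] \<mu>D(1) by metis
      have "\<forall>C\<in>?P. \<exists>y. y \<in> E \<and> bowen_dist f n y (z C) \<le> \<delta>"
        using E(1) unfolding spanning_set_def by blast
      then obtain y where y: "\<And>C. C \<in> ?P \<Longrightarrow> y C \<in> E" "\<And>C. C \<in> ?P \<Longrightarrow> bowen_dist f n (y C) (z C) \<le> \<delta>"
        by metis
      have "\<forall>C\<in>?P. \<exists>c. c \<in> {..<n} \<rightarrow>\<^sub>E \<xi> \<and> C = (\<Inter>i<n. (f ^^ i) -` c i)"
        unfolding iterated_join_altdef by blast
      then obtain c where c: "\<And>C. C \<in> ?P \<Longrightarrow> c C \<in> {..<n} \<rightarrow>\<^sub>E \<xi>"
        "\<And>C. C \<in> ?P \<Longrightarrow> C = (\<Inter>i<n. (f ^^ i) -` c C i)" by metis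
      define w where "w u i A = (if \<exists>x\<in>K A. dist ((f ^^ i) u) x \<le> \<delta> then 1 else exp (- L))" for u i A
      \<comment> \<open>At a time when \<open>z C\<close> is outside \<open>R\<close>, the point \<open>y C\<close> that shadows it determines the symbol of \<open>C\<close>.\<close>
      have weight: "exp (- L * birkhoff_sum f r n (z C)) \<le> (\<Prod>i<n. w (y C) i (c C i))" if C: "C \<in> ?P" for C
      proof -
        have "exp (- L * birkhoff_sum f r n (z C)) = (\<Prod>i<n. exp (- L * r ((f ^^ i) (z C))))"
          unfolding birkhoff_sum_def sum_distrib_left by (simp add: exp_sum)
        also have "\<dots> \<le> (\<Prod>i<n. w (y C) i (c C i))"
        proof (intro prod_mono conjI)
          fix i assume i: "i \<in> {..<n}"
          have ci: "c C i \<in> \<xi>" using c(1)[OF C] i by (auto simp: PiE_iff)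
          have zi: "(f ^^ i) (z C) \<in> c C i" using z[OF C] c(2)[OF C] i by blast
          show "exp (- L * r ((f ^^ i) (z C))) \<le> w (y C) i (c C i)"
          proof (cases "(f ^^ i) (z C) \<in> R")
            case True
            then show ?thesis using L by (simp add: w_def r_def)
          next
            case False
            then obtain A where A: "A \<in> \<xi>" "(f ^^ i) (z C) \<in> K A" unfolding R_def by auto
            then have "A = c C i"
              using K(2)[OF A(1)] zi disjointD[OF partition_onD2[OF \<xi>'(2)] A(1) ci] by blast
            moreover have "dist ((f ^^ i) (y C)) ((f ^^ i) (z C)) \<le> \<delta>"
              using y(2)[OF C] i n by (simp add: bowen_dist_le_iff)
            ultimately have "w (y C) i (c C i) = 1" using A(2) unfolding w_def by auto
            then show ?thesis using False by (simp add: r_def)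
          qed
        qed simp
        finally show ?thesis .
      qed
      \<comment> \<open>Since \<open>2 * \<delta> < d\<close>, at most one of the closed sets meets the \<open>\<delta>\<close>-ball, so one weight at most is \<open>1\<close>.\<close>
      have row: "(\<Sum>A\<in>\<xi>. w u i A) \<le> exp e" for u i
      proof -
        have "\<exists>A0\<in>\<xi>. \<forall>A\<in>\<xi>. (\<exists>x\<in>K A. dist ((f ^^ i) u) x \<le> \<delta>) \<longrightarrow> A = A0"
        proof (cases "\<exists>A\<in>\<xi>. \<exists>x\<in>K A. dist ((f ^^ i) u) x \<le> \<delta>")
          case True
          then obtain A0 x0 where A0: "A0 \<in> \<xi>" "x0 \<in> K A0" "dist ((f ^^ i) u) x0 \<le> \<delta>" by blast
          have "A = A0" if "A \<in> \<xi>" "x \<in> K A" "dist ((f ^^ i) u) x \<le> \<delta>" for A x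
          proof (rule ccontr)
            assume "A \<noteq> A0"
            then have "d \<le> dist x x0" using d(2)[of A A0 x x0] that A0 by blast
            also have "\<dots> \<le> dist ((f ^^ i) u) x + dist ((f ^^ i) u) x0" by (rule dist_triangle3)
            finally show False using that A0 \<delta> d(1) by linarith
          qed
          then show ?thesis using A0(1) by blast
        qed (use \<xi>_ne in blast)
        then obtain A0 where A0: "A0 \<in> \<xi>" "\<And>A. A \<in> \<xi> \<Longrightarrow> (\<exists>x\<in>K A. dist ((f ^^ i) u) x \<le> \<delta>) \<Longrightarrow> A = A0"
          by blast
        have "(\<Sum>A\<in>\<xi>. w u i A) \<le> (\<Sum>A\<in>\<xi>. (if A = A0 then 1 else 0) + exp (- L))"
        proof (rule sum_mono)
          fix A assume "A \<in> \<xi>"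
          then show "w u i A \<le> (if A = A0 then 1 else 0) + exp (- L)"
            using A0(2)[of A] unfolding w_def by (cases "A = A0") auto
        qed
        also have "\<dots> = 1 + real (card \<xi>) * exp (- L)" using A0(1) \<xi>'(1) by (simp add: sum.distrib)
        also have "\<dots> \<le> 1 + e" using kL by simp
        also have "\<dots> \<le> exp e" by (rule exp_ge_add_one_self)
        finally show ?thesis .
      qed
      have w_nonneg: "0 \<le> w u i A" for u i A by (simp add: w_def)
      have words: "(\<Sum>a\<in>{..<n} \<rightarrow>\<^sub>E \<xi>. \<Prod>i<n. w u i (a i)) \<le> exp (real n * e)" for u
      proof -
        have "(\<Sum>a\<in>{..<n} \<rightarrow>\<^sub>E \<xi>. \<Prod>i<n. w u i (a i)) = (\<Prod>i<n. \<Sum>A\<in>\<xi>. w u i A)"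
          using \<xi>'(1) by (subst prod_sum_PiE) auto
        also have "\<dots> \<le> (\<Prod>i<n. exp e)"
          using row w_nonneg by (intro prod_mono) (auto intro!: sum_nonneg)
        finally show ?thesis by (simp add: exp_of_nat_mult)
      qed
      define D where "D = y ` ?P"
      have D: "finite D" "D \<subseteq> E" using P(1) y(1) by (auto simp: D_def)
      define F where "F p = exp (birkhoff_sum f g n (fst p) + real n * e) * (\<Prod>i<n. w (fst p) i (snd p i))" for p
      have F_nonneg: "0 \<le> F p" for p unfolding F_def by (intro mult_nonneg_nonneg prod_nonneg ballI w_nonneg) simp
      have inj: "inj_on (\<lambda>C. (y C, c C)) ?P"
      proof (rule inj_onI)
        fix C C' assume C: "C \<in> ?P" "C' \<in> ?P" and "(y C, c C) = (y C', c C')"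
        then have "c C = c C'" by simp
        then show "C = C'" using c(2)[OF C(1)] c(2)[OF C(2)] by simp
      qed
      have "(\<Sum>C\<in>?P. exp (v (z C))) \<le> (\<Sum>C\<in>?P. F (y C, c C))"
      proof (rule sum_mono)
        fix C assume C: "C \<in> ?P"
        have "bowen_dist f n (y C) (z C) \<le> \<delta>1" using y(2)[OF C] \<delta>(2) by linarith
        then have "birkhoff_sum f g n (z C) \<le> birkhoff_sum f g n (y C) + real n * e"
          using birkhoff_sum_close[OF \<delta>1(2) n] by (fastforce simp: abs_le_iff)
        then have "exp (birkhoff_sum f g n (z C)) * exp (- L * birkhoff_sum f r n (z C)) \<le> F (y C, c C)"
          unfolding F_def using weight[OF C] by (intro mult_mono) auto
        then show "exp (v (z C)) \<le> F (y C, c C)" unfolding v_def by (simp add: exp_add[symmetric])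
      qed
      also have "\<dots> = (\<Sum>p\<in>(\<lambda>C. (y C, c C)) ` ?P. F p)" using inj by (simp add: sum.reindex)
      also have "\<dots> \<le> (\<Sum>p\<in>D \<times> ({..<n} \<rightarrow>\<^sub>E \<xi>). F p)"
        using D(1) c(1) \<xi>'(1) F_nonneg by (intro sum_mono2) (auto simp: D_def intro!: finite_PiE)
      also have "\<dots> = (\<Sum>u\<in>D. exp (birkhoff_sum f g n u + real n * e) * (\<Sum>a\<in>{..<n} \<rightarrow>\<^sub>E \<xi>. \<Prod>i<n. w u i (a i)))"
        by (simp add: F_def sum_distrib_left sum.cartesian_product case_prod_unfold)
      also have "\<dots> \<le> (\<Sum>u\<in>D. exp (birkhoff_sum f g n u + real n * e) * exp (real n * e))"
        using words by (intro sum_mono mult_left_mono) auto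
      also have "\<dots> = (\<Sum>u\<in>D. exp (birkhoff_sum f g n u)) * exp (2 * real n * e)"
        by (simp add: sum_distrib_right exp_add[symmetric] algebra_simps)
      also have "\<dots> \<le> exp (real n * \<eta>) * exp (2 * real n * e)" by (intro mult_right_mono E(2) D) simp
      also have "\<dots> = exp (real n * (\<eta> + 2 * e))" by (simp add: exp_add[symmetric] algebra_simps)
      finally have "(\<Sum>C\<in>?P. exp (v (z C))) \<le> exp (real n * (\<eta> + 2 * e))" .
      moreover have "0 < (\<Sum>C\<in>?P. exp (v (z C)))"
        using P by (intro sum_pos) (auto simp: partition_on_def)
      ultimately have "ln (\<Sum>C\<in>?P. exp (v (z C))) \<le> real n * (\<eta> + 2 * e)"
        by (metis ln_exp ln_le_cancel_iff exp_gt_zero)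
      moreover have "L * (real n * prob R) \<le> real n * e"
        using mult_left_mono[OF LR, of "real n"] by (simp add: mult.commute mult.left_commute)
      ultimately have "partition_entropy \<mu> ?P \<le> real n * (\<eta> + 3 * e - I) + 1"
        using ent v_int by (simp add: algebra_simps)
      then show ?case using n by (simp add: field_simps)
    qed
    moreover have "(\<lambda>n. \<eta> + 3 * e - I + 1 / real n) \<longlonglongrightarrow> \<eta> + 3 * e - I + 0"
      by (intro tendsto_intros lim_1_over_n)
    ultimately have "h \<le> \<eta> + 3 * e - I + 0"
      using h by (intro tendsto_le[OF sequentially_bot]) auto
    then show ?thesis by simp
  qed
  then have "h + I \<le> \<eta> + e" if "0 < e" for e :: real
    using that by (metis divide_pos_pos mult.commute nonzero_mult_div_cancel_left times_divide_eq_right zero_less_numeral zero_neq_numeral)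
  then have "h + I \<le> \<eta>" by (rule field_le_epsilon)
  then show ?thesis unfolding h_eq I_def by simp
qed

section \<open>Construction of invariant measures\<close>

text \<open>
  Tychonoff's theorem for set functions with values in \<open>[0, 1]\<close>; the cluster point is described by
  approximation on finite families of sets.
\<close>
lemma set_function_cluster_point:
  fixes p :: "nat \<Rightarrow> 'a set \<Rightarrow> real"
  assumes "\<And>n A. p n A \<in> {0..1}"
  obtains m where "\<And>\<A> e N. finite \<A> \<Longrightarrow> 0 < e \<Longrightarrow> \<exists>n\<ge>N. \<forall>A\<in>\<A>. \<bar>m A - p n A\<bar> < e"
proof -
  have "compactin (product_topology (\<lambda>_. euclidean) UNIV) (PiE UNIV (\<lambda>_::'a set. {0..1::real}))"
    by (simp add: compactin_PiE)
  then have "compact (PiE UNIV (\<lambda>_::'a set. {0..1::real}))"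
    by (simp add: euclidean_product_topology)
  moreover have "filtermap p sequentially \<noteq> bot" by (simp add: filtermap_bot_iff)
  moreover have "eventually (\<lambda>q. q \<in> PiE UNIV (\<lambda>_::'a set. {0..1::real})) (filtermap p sequentially)"
    using assms by (simp add: eventually_filtermap PiE_iff)
  ultimately obtain m where m: "inf (nhds m) (filtermap p sequentially) \<noteq> bot"
    unfolding compact_filter by blast
  show ?thesis
  proof (rule that)
    fix \<A> :: "'a set set" and e :: real and N :: nat
    assume "finite \<A>" "0 < e"
    define W where "W = (\<Inter>A\<in>\<A>. {q. \<bar>m A - q A\<bar> < e})"
    have "open {q::'a set \<Rightarrow> real. \<bar>m A - q A\<bar> < e}" for A
      by (intro open_Collect_less continuous_intros continuous_on_product_coordinates)
    then have "open W" unfolding W_def using \<open>finite \<A>\<close> by auto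
    moreover have "m \<in> W" using \<open>0 < e\<close> by (simp add: W_def)
    ultimately have nh: "eventually (\<lambda>q. q \<in> W) (nhds m)" by (auto simp: eventually_nhds)
    show "\<exists>n\<ge>N. \<forall>A\<in>\<A>. \<bar>m A - p n A\<bar> < e"
    proof (rule ccontr)
      assume no: "\<not> ?thesis"
      have "p n \<notin> W" if "N \<le> n" for n using no that by (auto simp: W_def)
      then have "eventually (\<lambda>n. p n \<notin> W) sequentially"
        by (auto simp: eventually_sequentially)
      then have "eventually (\<lambda>q. q \<notin> W) (filtermap p sequentially)"
        by (simp add: eventually_filtermap)
      then have "eventually (\<lambda>q. False) (inf (nhds m) (filtermap p sequentially))"
        unfolding eventually_inf using nh
        by (intro exI[of _ "\<lambda>q. q \<in> W"] exI[of _ "\<lambda>q. q \<notin> W"]) simp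
      then show False using m by (simp add: eventually_False)
    qed
  qed
qed

text \<open>
  A finitely additive \<open>m\<close> is turned into a measure in two steps: on open sets it is replaced by its
  supremum over open sets whose closure is contained in the given one, and the result is extended to
  all sets by outer approximation. Inner approximation through closures brings in compactness, which gives
  countable subadditivity.
\<close>
definition inner_content :: "('a::topological_space set \<Rightarrow> real) \<Rightarrow> 'a set \<Rightarrow> ennreal" where
  "inner_content m U = (SUP V\<in>{V. open V \<and> closure V \<subseteq> U}. ennreal (m V))"

text \<open>The outer approximation of arbitrary sets by open sets, measured by the inner content.\<close>

definition regular_outer_measure :: "('a::topological_space set \<Rightarrow> real) \<Rightarrow> 'a set \<Rightarrow> ennreal" where
  "regular_outer_measure m A = (INF U\<in>{U. open U \<and> A \<subseteq> U}. inner_content m U)"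

lemma inner_content_upper: "open V \<Longrightarrow> closure V \<subseteq> U \<Longrightarrow> ennreal (m V) \<le> inner_content m U"
  unfolding inner_content_def by (rule SUP_upper) simp

lemma inner_content_mono: "U \<subseteq> U' \<Longrightarrow> inner_content m U \<le> inner_content m U'"
  unfolding inner_content_def by (rule SUP_subset_mono) auto

lemma regular_outer_measure_open: "open U \<Longrightarrow> regular_outer_measure m U = inner_content m U"
  unfolding regular_outer_measure_def
  by (intro antisym INF_lower INF_greatest) (auto intro: inner_content_mono)

lemma regular_outer_measure_lower: "open U \<Longrightarrow> A \<subseteq> U \<Longrightarrow> regular_outer_measure m A \<le> inner_content m U"
  unfolding regular_outer_measure_def by (rule INF_lower) simp

lemma regular_outer_measure_mono: "A \<subseteq> B \<Longrightarrow> regular_outer_measure m A \<le> regular_outer_measure m B"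
  unfolding regular_outer_measure_def by (rule INF_superset_mono) auto

text \<open>Finitely additive probabilities that are defined on all subsets of a compact metric space.\<close>

locale finitely_additive_prob =
  fixes m :: "'a::metric_space set \<Rightarrow> real"
  assumes compact_space: "compact (UNIV :: 'a set)"
    and nonneg: "0 \<le> m A" and total: "m UNIV = 1"
    and additive: "A \<inter> B = {} \<Longrightarrow> m (A \<union> B) = m A + m B"
begin

lemma empty [simp]: "m {} = 0"
  using additive[of "{}" "{}"] by simp

lemma monotone: "A \<subseteq> B \<Longrightarrow> m A \<le> m B"
  using additive[of A "B - A"] nonneg[of "B - A"] by (simp add: Un_absorb1)

lemma complement: "m (- A) = 1 - m A"
  using additive[of A "- A"] total by (simp add: Compl_partition)

lemma subadditive: "m (A \<union> B) \<le> m A + m B"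
  using additive[of A "B - A"] monotone[of "B - A" B] by simp

lemma subadditive_finite: "finite I \<Longrightarrow> m (\<Union>i\<in>I. A i) \<le> (\<Sum>i\<in>I. m (A i))"
proof (induction I rule: finite_induct)
  case (insert i I)
  then show ?case using subadditive[of "A i" "\<Union>i\<in>I. A i"] by simp
qed simp

lemma inner_content_le: "inner_content m U \<le> ennreal (m U)"
  unfolding inner_content_def
proof (rule SUP_least)
  fix V assume "V \<in> {V. open V \<and> closure V \<subseteq> U}"
  then have "V \<subseteq> U" using closure_subset[of V] by auto
  then show "ennreal (m V) \<le> ennreal (m U)" by (intro ennreal_leI monotone)
qed

lemma inner_content_subadditive:
  fixes U :: "nat \<Rightarrow> 'a set"
  assumes "\<And>i. open (U i)"
  shows "inner_content m (\<Union>i. U i) \<le> (\<Sum>i. inner_content m (U i))"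
  unfolding inner_content_def[of m "\<Union>i. U i"]
proof (rule SUP_least)
  fix V assume "V \<in> {V. open V \<and> closure V \<subseteq> (\<Union>i. U i)}"
  then have V: "open V" "closure V \<subseteq> (\<Union>i. U i)" by auto
  have "\<forall>i. \<exists>W. (\<forall>n. open (W n) \<and> closure (W n) \<subseteq> U i) \<and> incseq W \<and> (\<Union>n. W n) = U i"
  proof
    fix i
    obtain W where "\<And>n. open (W n)" "\<And>n. closure (W n) \<subseteq> U i" "incseq W" "(\<Union>n. W n) = U i"
      using open_closure_exhaustion[OF assms[of i]] by blast
    then show "\<exists>W. (\<forall>n. open (W n) \<and> closure (W n) \<subseteq> U i) \<and> incseq W \<and> (\<Union>n. W n) = U i"
      by (intro exI[of _ W]) simp
  qed
  then obtain W where W: "\<And>i n. open (W i n)" "\<And>i n. closure (W i n) \<subseteq> U i"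
    "\<And>i. incseq (W i)" "\<And>i. (\<Union>n. W i n) = U i" by metis
  have "compact (closure V)" using compact_Int_closed[OF compact_space closed_closure, of V] by simp
  moreover have "closure V \<subseteq> (\<Union>n. \<Union>i\<le>n. W i n)"
  proof
    fix x assume "x \<in> closure V"
    then obtain i where "x \<in> U i" using V(2) by blast
    then have "x \<in> (\<Union>n. W i n)" by (simp only: W(4))
    then obtain k where "x \<in> W i k" by blast
    then have "x \<in> W i (max i k)" using incseqD[OF W(3), of k "max i k" i] by auto
    then have "x \<in> (\<Union>j\<le>max i k. W j (max i k))" by (intro UN_I[of i]) auto
    then show "x \<in> (\<Union>n. \<Union>i\<le>n. W i n)" by (rule UN_I[OF UNIV_I])
  qed
  moreover have "open (\<Union>i\<le>n. W i n)" for n using W(1) by (intro open_UN ballI)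
  ultimately obtain F where F: "finite F" "closure V \<subseteq> (\<Union>n\<in>F. \<Union>i\<le>n. W i n)"
    by (elim compactE_image[of "closure V" UNIV "\<lambda>n. \<Union>i\<le>n. W i n"]) auto
  define n where "n = Max (insert 0 F)"
  have "V \<subseteq> (\<Union>i\<le>n. W i n)"
  proof
    fix x assume "x \<in> V"
    then have "x \<in> (\<Union>n\<in>F. \<Union>i\<le>n. W i n)" using F(2) closure_subset[of V] by (meson subsetD)
    then obtain k i where k: "k \<in> F" "i \<le> k" "x \<in> W i k" by blast
    moreover have "k \<le> n" unfolding n_def using F(1) k(1) by simp
    ultimately show "x \<in> (\<Union>i\<le>n. W i n)" using incseqD[OF W(3), of k n i] by (intro UN_I[of i]) auto
  qed
  then have "m V \<le> (\<Sum>i\<le>n. m (W i n))"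
    using order_trans[OF monotone subadditive_finite[OF finite_atMost]] by blast
  then have "ennreal (m V) \<le> (\<Sum>i\<le>n. ennreal (m (W i n)))"
    using nonneg by (subst sum_ennreal) (auto intro: ennreal_leI)
  also have "\<dots> \<le> (\<Sum>i\<le>n. inner_content m (U i))"
    using W by (intro sum_mono inner_content_upper)
  also have "\<dots> \<le> (\<Sum>i. inner_content m (U i))" by (intro sum_le_suminf) auto
  finally show "ennreal (m V) \<le> (\<Sum>i. inner_content m (U i))" .
qed

lemma regular_outer_measure_space:
  "outer_measure_space (Pow UNIV) (regular_outer_measure m)"
  unfolding outer_measure_space_def
proof (intro conjI)
  show "positive (Pow UNIV) (regular_outer_measure m)"
    using inner_content_le[of "{}"] by (simp add: positive_def regular_outer_measure_open)
  show "increasing (Pow UNIV) (regular_outer_measure m)"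
    by (auto simp: increasing_def intro: regular_outer_measure_mono)
  show "countably_subadditive (Pow UNIV) (regular_outer_measure m)"
  proof (unfold countably_subadditive_def, intro allI impI)
    fix A :: "nat \<Rightarrow> 'a set"
    show "regular_outer_measure m (\<Union>i. A i) \<le> (\<Sum>i. regular_outer_measure m (A i))"
    proof (rule ennreal_le_epsilon)
      fix e :: real assume e: "0 < e" and fin: "(\<Sum>i. regular_outer_measure m (A i)) < top"
      have "\<forall>i. \<exists>U. open U \<and> A i \<subseteq> U \<and> inner_content m U \<le> regular_outer_measure m (A i) + e * (1/2) ^ Suc i"
      proof
        fix i
        have "regular_outer_measure m (A i) < regular_outer_measure m (A i) + e * (1/2) ^ Suc i"
          using fin e by (auto simp add: less_top dest!: ennreal_suminf_lessD)
        then obtain U where "open U" "A i \<subseteq> U" "inner_content m U < regular_outer_measure m (A i) + e * (1/2) ^ Suc i"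
          by (subst (asm) (1) regular_outer_measure_def) (auto simp: INF_less_iff)
        then show "\<exists>U. open U \<and> A i \<subseteq> U \<and> inner_content m U \<le> regular_outer_measure m (A i) + e * (1/2) ^ Suc i"
          by (blast intro: less_imp_le)
      qed
      then obtain U where U: "\<And>i. open (U i)" "\<And>i. A i \<subseteq> U i"
        "\<And>i. inner_content m (U i) \<le> regular_outer_measure m (A i) + e * (1/2) ^ Suc i" by metis
      have "regular_outer_measure m (\<Union>i. A i) \<le> inner_content m (\<Union>i. U i)"
        using U by (intro regular_outer_measure_lower) auto
      also have "\<dots> \<le> (\<Sum>i. inner_content m (U i))" by (intro inner_content_subadditive U)
      also have "\<dots> \<le> (\<Sum>i. regular_outer_measure m (A i) + e * (1/2) ^ Suc i)"
        by (intro suminf_le U) auto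
      also have "\<dots> = (\<Sum>i. regular_outer_measure m (A i)) + (\<Sum>i. ennreal e * ennreal ((1/2) ^ Suc i))"
        using e by (subst suminf_add[symmetric])
          (auto simp del: ennreal_suminf_cmult simp add: ennreal_mult[symmetric])
      also have "\<dots> = (\<Sum>i. regular_outer_measure m (A i)) + e"
        unfolding ennreal_suminf_cmult
        by (subst suminf_ennreal_eq[OF zero_le_power power_half_series]) auto
      finally show "regular_outer_measure m (\<Union>i. A i) \<le> (\<Sum>i. regular_outer_measure m (A i)) + e" .
    qed
  qed
qed

lemma open_caratheodory_measurable:
  assumes U: "open U"
  shows "regular_outer_measure m (U \<inter> A) + regular_outer_measure m (- U \<inter> A) \<le> regular_outer_measure m A"
  unfolding regular_outer_measure_def[of m A]
proof (rule INF_greatest)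
  fix W assume "W \<in> {W. open W \<and> A \<subseteq> W}"
  then have W: "open W" "A \<subseteq> W" by auto
  have "regular_outer_measure m (U \<inter> A) + regular_outer_measure m (- U \<inter> A) \<le>
      inner_content m (U \<inter> W) + regular_outer_measure m (- U \<inter> A)"
    using U W by (intro add_right_mono regular_outer_measure_lower) auto
  also have "\<dots> = (SUP V\<in>{V. open V \<and> closure V \<subseteq> U \<inter> W}. ennreal (m V) + regular_outer_measure m (- U \<inter> A))"
    unfolding inner_content_def by (intro ennreal_SUP_add_left[symmetric]) (auto intro: exI[of _ "{}"])
  also have "\<dots> \<le> inner_content m W"
  proof (rule SUP_least)
    fix V assume "V \<in> {V. open V \<and> closure V \<subseteq> U \<inter> W}"
    then have V: "open V" "closure V \<subseteq> U \<inter> W" by auto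
    have "ennreal (m V) + regular_outer_measure m (- U \<inter> A) \<le> ennreal (m V) + inner_content m (W - closure V)"
      using V W by (intro add_left_mono regular_outer_measure_lower) auto
    also have "\<dots> = (SUP V'\<in>{V'. open V' \<and> closure V' \<subseteq> W - closure V}. ennreal (m V) + ennreal (m V'))"
      unfolding inner_content_def by (intro ennreal_SUP_add_right) (auto intro: exI[of _ "{}"])
    also have "\<dots> \<le> inner_content m W"
    proof (rule SUP_least)
      fix V' assume "V' \<in> {V'. open V' \<and> closure V' \<subseteq> W - closure V}"
      then have V': "open V'" "closure V' \<subseteq> W - closure V" by auto
      have "V \<inter> V' = {}" using V'(2) closure_subset[of V] closure_subset[of V'] by blast
      then have "ennreal (m V) + ennreal (m V') = ennreal (m (V \<union> V'))"
        using additive nonneg by (simp add: ennreal_plus[symmetric] del: ennreal_plus)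
      also have "\<dots> \<le> inner_content m W"
        using V V' by (intro inner_content_upper) auto
      finally show "ennreal (m V) + ennreal (m V') \<le> inner_content m W" .
    qed
    finally show "ennreal (m V) + regular_outer_measure m (- U \<inter> A) \<le> inner_content m W" .
  qed
  finally show "regular_outer_measure m (U \<inter> A) + regular_outer_measure m (- U \<inter> A) \<le> inner_content m W" .
qed

text \<open>The regularisation of \<open>m\<close> is a Borel probability measure.\<close>

lemma regular_measure_exists:
  obtains \<mu> where "sets \<mu> = sets borel" and "prob_space \<mu>"
    and "\<And>U. open U \<Longrightarrow> emeasure \<mu> U = inner_content m U"
proof -
  let ?o = "regular_outer_measure m"
  let ?L = "lambda_system UNIV (Pow UNIV) ?o"
  interpret P: sigma_algebra "UNIV :: 'a set" "Pow UNIV" by (rule sigma_algebra_Pow)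
  have ms: "measure_space UNIV ?L ?o"
    by (rule P.caratheodory_lemma[OF regular_outer_measure_space])
  then interpret L: sigma_algebra "UNIV :: 'a set" ?L by (simp add: measure_space_def)
  have sub: "subadditive (Pow UNIV) ?o"
    using regular_outer_measure_space
    by (intro P.countably_subadditive_subadditive) (auto simp: outer_measure_space_def)
  have "U \<in> ?L" if "open U" for U
  proof -
    have "?o (U \<inter> A) + ?o (- U \<inter> A) = ?o A" for A
    proof (rule antisym)
      have "?o ((U \<inter> A) \<union> (- U \<inter> A)) \<le> ?o (U \<inter> A) + ?o (- U \<inter> A)"
        using sub by (intro subadditiveD) auto
      moreover have "(U \<inter> A) \<union> (- U \<inter> A) = A" by auto
      ultimately show "?o A \<le> ?o (U \<inter> A) + ?o (- U \<inter> A)" by simp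
    qed (rule open_caratheodory_measurable[OF that])
    then show ?thesis by (simp add: lambda_system_def Compl_eq_Diff_UNIV)
  qed
  then have borel_L: "sets borel \<subseteq> ?L"
  proof -
    have "sigma_sets UNIV {S::'a set. open S} \<subseteq> ?L"
      using \<open>\<And>U. open U \<Longrightarrow> U \<in> ?L\<close> by (intro L.sigma_sets_subset) blast
    then show ?thesis unfolding borel_def by simp
  qed
  define \<mu> where "\<mu> = measure_of UNIV (sets (borel :: 'a measure)) ?o"
  have sets: "sets \<mu> = sets borel"
    unfolding \<mu>_def using sets.sets_measure_of_eq[of borel ?o] by simp
  have em: "emeasure \<mu> A = ?o A" if "A \<in> sets borel" for A
  proof (rule emeasure_measure_of[OF \<mu>_def])
    have ca: "positive ?L ?o" "countably_additive ?L ?o" using ms by (simp_all add: measure_space_def)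
    show "positive (sets \<mu>) ?o" using ca(1) by (simp add: positive_def)
    show "countably_additive (sets \<mu>) ?o"
      unfolding countably_additive_def
    proof (intro allI impI)
      fix A :: "nat \<Rightarrow> 'a set"
      assume A: "range A \<subseteq> sets \<mu>" "disjoint_family A" "(\<Union>i. A i) \<in> sets \<mu>"
      then have "range A \<subseteq> ?L" "(\<Union>i. A i) \<in> ?L" using borel_L sets by blast+
      then show "(\<Sum>i. ?o (A i)) = ?o (\<Union>i. A i)"
        using ca(2) A(2) unfolding countably_additive_def by blast
    qed
  qed (use that sets in auto)
  have sp: "space \<mu> = UNIV" using sets_eq_imp_space_eq[OF sets] by simp
  have "inner_content m UNIV = 1"
  proof (rule antisym)
    show "inner_content m UNIV \<le> 1" using inner_content_le[of UNIV] total by simp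
    show "1 \<le> inner_content m UNIV" using inner_content_upper[of UNIV UNIV m] total by simp
  qed
  then have "prob_space \<mu>" using em[of UNIV] sp by (intro prob_spaceI) (simp add: regular_outer_measure_open)
  then show ?thesis using that[of \<mu>] sets em by (simp add: regular_outer_measure_open)
qed

end

text \<open>
  For invariance it suffices to compare \<open>\<mu>\<close> and its image on open sets, in one direction: regularity
  extends the inequality to Borel sets, and complements reverse it.
\<close>
lemma invariant_measuresI_open:
  fixes f :: "'a::metric_space \<Rightarrow> 'a"
  assumes f: "continuous_on UNIV f" and sets: "sets \<mu> = sets borel" and "prob_space \<mu>"
    and le: "\<And>U. open U \<Longrightarrow> emeasure \<mu> U \<le> emeasure \<mu> (f -` U)"
  shows "\<mu> \<in> invariant_measures f"
proof -
  interpret prob_space \<mu> by fact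
  have sp: "space \<mu> = UNIV" using sets_eq_imp_space_eq[OF sets] by simp
  have f_meas: "f \<in> \<mu> \<rightarrow>\<^sub>M borel"
    using borel_measurable_continuous_onI[OF f] sets by (simp cong: measurable_cong_sets)
  let ?\<nu> = "distr \<mu> borel f"
  interpret N: prob_space ?\<nu> using f_meas by (rule prob_space_distr)
  have open_le: "prob U \<le> measure ?\<nu> U" if "open U" for U
    using le[OF that] that sp f_meas by (simp add: measure_distr emeasure_eq_measure)
  have le_all: "prob A \<le> measure ?\<nu> A" if A: "A \<in> sets borel" for A
  proof (rule field_le_epsilon)
    fix e :: real assume "0 < e"
    obtain K U where KU: "closed K" "open U" "K \<subseteq> A" "A \<subseteq> U" "measure ?\<nu> (U - K) < e"
      using closed_open_regular[OF N.finite_measure_axioms _ A \<open>0 < e\<close>] by auto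
    have "prob A \<le> prob U" using KU sets by (intro finite_measure_mono) auto
    also have "\<dots> \<le> measure ?\<nu> U" by (rule open_le[OF KU(2)])
    also have "\<dots> \<le> measure ?\<nu> (A \<union> (U - K))" using KU A by (intro N.finite_measure_mono) auto
    also have "\<dots> \<le> measure ?\<nu> A + measure ?\<nu> (U - K)" using KU A by (intro measure_Un_le) auto
    finally show "prob A \<le> measure ?\<nu> A + e" using KU(5) by simp
  qed
  have "?\<nu> = \<mu>"
  proof (rule measure_eqI)
    fix A assume "A \<in> sets ?\<nu>"
    then have A: "A \<in> sets borel" by simp
    have "prob (- A) \<le> measure ?\<nu> (- A)" using A by (intro le_all borel_comp)
    then have "measure ?\<nu> A \<le> prob A"
      using prob_compl[of A] N.prob_compl[of A] A sets sp by (simp add: Compl_eq_Diff_UNIV)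
    then have "measure ?\<nu> A = prob A" using le_all[OF A] by linarith
    then show "emeasure ?\<nu> A = emeasure \<mu> A" by (simp add: emeasure_eq_measure N.emeasure_eq_measure)
  qed (simp add: sets)
  then show ?thesis using sets \<open>prob_space \<mu>\<close> by (simp add: invariant_measures_def)
qed

text \<open>
  The staircase with \<open>N\<close> steps approximates the identity on \<open>[0, 1]\<close> from below up to \<open>1 / N\<close>; it expresses
  averages of a function through the frequencies of its superlevel sets.
\<close>
lemma staircase_bounds:
  fixes t :: real
  assumes "0 \<le> t" "t \<le> 1" "0 < N"
  shows "(\<Sum>j=1..N. of_bool (real j / real N \<le> t)) / real N \<le> t"
    and "t \<le> (\<Sum>j=1..N. of_bool (real j / real N \<le> t)) / real N + 1 / real N"
proof -
  define k where "k = nat \<lfloor>t * real N\<rfloor>"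
  have k: "real k \<le> t * real N" "t * real N < real k + 1"
    unfolding k_def using assms by (auto simp: of_nat_nat)
  have "t * real N \<le> real N" using assms by (simp add: mult_left_le_one_le)
  then have kN: "k \<le> N" using k by linarith
  have "(real j / real N \<le> t) = (j \<le> k)" for j
  proof -
    have "(real j / real N \<le> t) = (real j \<le> t * real N)" using assms(3) by (simp add: field_simps)
    then show ?thesis using k by linarith
  qed
  then have "(\<Sum>j=1..N. of_bool (real j / real N \<le> t)) = (\<Sum>j=1..N. of_bool (j \<le> k) :: real)" by simp
  also have "\<dots> = real (card ({1..N} \<inter> {j. j \<le> k}))" by (subst sum_of_bool_eq) auto
  also have "{1..N} \<inter> {j. j \<le> k} = {1..k}" using kN by auto
  finally have eq: "(\<Sum>j=1..N. of_bool (real j / real N \<le> t)) = real k" by simp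
  show "(\<Sum>j=1..N. of_bool (real j / real N \<le> t)) / real N \<le> t"
    unfolding eq using k assms by (simp add: field_simps)
  show "t \<le> (\<Sum>j=1..N. of_bool (real j / real N \<le> t)) / real N + 1 / real N"
    unfolding eq using k assms by (simp add: field_simps)
qed

text \<open>
  The construction of Krylov and Bogolyubov. A cluster point \<open>m\<close> of the visiting frequencies is finitely
  additive and invariant, and its regularisation gives closed sets at least the mass \<open>m\<close>, hence does
  not decrease averages of continuous functions, whose superlevel sets are closed.
\<close>
lemma invariant_measure_from_orbit_averages:
  fixes f :: "'a::metric_space \<Rightarrow> 'a" and h :: "'a \<Rightarrow> real"
  assumes cpt: "compact (UNIV :: 'a set)" and f: "continuous_on UNIV f"
    and h: "continuous_on UNIV h" "\<And>x. 0 \<le> h x" "\<And>x. h x \<le> 1"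
    and orbits: "\<And>N. \<exists>n\<ge>N. \<exists>x. real n * c \<le> birkhoff_sum f h n x"
  obtains \<mu> where "\<mu> \<in> invariant_measures f" and "c \<le> (\<integral>x. h x \<partial>\<mu>)"
proof -
  have "\<forall>N. \<exists>n x. Suc N \<le> n \<and> real n * c \<le> birkhoff_sum f h n x" using orbits by blast
  then obtain n x where nx: "\<And>N. Suc N \<le> n N" "\<And>N. real (n N) * c \<le> birkhoff_sum f h (n N) (x N)"
    by metis
  have n_pos: "0 < real (n N)" for N using nx(1)[of N] by linarith
  \<comment> \<open>The frequency of visits to \<open>A\<close> along the \<open>N\<close>-th orbit segment.\<close>
  define p where "p N A = birkhoff_sum f (indicator A) (n N) (x N) / real (n N)" for N A
  have p01: "p N A \<in> {0..1}" for N A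
  proof -
    have "birkhoff_sum f (indicator A) (n N) (x N) \<le> real (n N) * 1"
      using birkhoff_sum_abs_le[of "indicator A" 1 f "n N" "x N"] by (simp add: indicator_def abs_le_iff)
    moreover have "(0::real) \<le> birkhoff_sum f (indicator A) (n N) (x N)"
      unfolding birkhoff_sum_def by (intro sum_nonneg) auto
    ultimately show ?thesis unfolding p_def using n_pos[of N] by simp
  qed
  obtain m where m: "\<And>\<A> e N. finite \<A> \<Longrightarrow> 0 < e \<Longrightarrow> \<exists>n\<ge>N. \<forall>A\<in>\<A>. \<bar>m A - p n A\<bar> < e"
    using set_function_cluster_point[of p] p01 by blast
  interpret finitely_additive_prob m
  proof
    show "compact (UNIV :: 'a set)" by (rule cpt)
    show "0 \<le> m A" for A
    proof (rule ccontr)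
      assume "\<not> 0 \<le> m A"
      then obtain k where "\<bar>m A - p k A\<bar> < - m A" using m[of "{A}" "- m A" 0] by auto
      then show False using p01[of k A] by auto
    qed
    have "\<bar>m UNIV - 1\<bar> \<le> 0 + e" if "0 < e" for e
    proof -
      have "p k UNIV = 1" for k unfolding p_def birkhoff_sum_def using n_pos[of k] by simp
      then show ?thesis using m[of "{UNIV}" e 0] that by auto
    qed
    then have "\<bar>m UNIV - 1\<bar> \<le> 0" by (rule field_le_epsilon)
    then show "m UNIV = 1" by simp
    fix A B :: "'a set" assume AB: "A \<inter> B = {}"
    have "\<bar>m (A \<union> B) - (m A + m B)\<bar> \<le> 0 + e" if "0 < e" for e
    proof -
      have p_add: "p k (A \<union> B) = p k A + p k B" for k
      proof -
        have "indicator (A \<union> B) y = (indicator A y + indicator B y :: real)" for y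
          using AB by (auto simp: indicator_def)
        then show ?thesis unfolding p_def birkhoff_sum_def by (simp add: sum.distrib add_divide_distrib)
      qed
      have "\<exists>k\<ge>0. \<forall>C\<in>{A \<union> B, A, B}. \<bar>m C - p k C\<bar> < e / 3"
        using that by (intro m) auto
      then obtain k where "\<bar>m (A \<union> B) - p k (A \<union> B)\<bar> < e / 3" "\<bar>m A - p k A\<bar> < e / 3" "\<bar>m B - p k B\<bar> < e / 3"
        by blast
      then show ?thesis using p_add[of k] unfolding abs_less_iff abs_le_iff by linarith
    qed
    then have "\<bar>m (A \<union> B) - (m A + m B)\<bar> \<le> 0" by (rule field_le_epsilon)
    then show "m (A \<union> B) = m A + m B" by simp
  qed
  have m_inv: "m (f -` A) = m A" for A
  proof -
    have "\<bar>m (f -` A) - m A\<bar> \<le> 0 + e" if "0 < e" for e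
    proof -
      obtain N :: nat where N: "3 / e < real N" using reals_Archimedean2 by blast
      have "\<exists>k\<ge>N. \<forall>C\<in>{f -` A, A}. \<bar>m C - p k C\<bar> < e / 3"
        using that by (intro m) auto
      then obtain k where k: "k \<ge> N" "\<forall>C\<in>{f -` A, A}. \<bar>m C - p k C\<bar> < e / 3" by blast
      \<comment> \<open>The frequencies of \<open>A\<close> and of its preimage differ only in the two end points of the segment.\<close>
      have "(\<Sum>i<n. indicator (f -` A) ((f ^^ i) x)) - (\<Sum>i<n. indicator A ((f ^^ i) x)) =
          (indicator A ((f ^^ n) x) - indicator A x :: real)" for n x
        by (induction n) (auto simp: indicator_def)
      then have "p k (f -` A) - p k A = (indicator A ((f ^^ n k) (x k)) - indicator A (x k)) / real (n k)"
        unfolding p_def birkhoff_sum_def by (simp add: diff_divide_distrib[symmetric])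
      then have "\<bar>p k (f -` A) - p k A\<bar> \<le> 1 / real (n k)"
        by (auto simp: indicator_def)
      also have "\<dots> \<le> 1 / real N"
      proof (rule divide_left_mono)
        have "0 < 3 / e" using that by simp
        then have "0 < real N" using N by linarith
        then show "0 < real (n k) * real N" using n_pos[of k] by simp
      qed (use k(1) nx(1)[of k] in auto)
      also have "\<dots> \<le> e / 3"
        using N that n_pos by (cases "N = 0") (auto simp: field_simps)
      finally have "\<bar>p k (f -` A) - p k A\<bar> \<le> e / 3" .
      moreover have "\<bar>m (f -` A) - p k (f -` A)\<bar> < e / 3" "\<bar>m A - p k A\<bar> < e / 3" using k(2) by blast+
      ultimately show ?thesis unfolding abs_less_iff abs_le_iff by linarith
    qed
    then have "\<bar>m (f -` A) - m A\<bar> \<le> 0" by (rule field_le_epsilon)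
    then show ?thesis by simp
  qed
  obtain \<mu> where \<mu>: "sets \<mu> = sets borel" "prob_space \<mu>" "\<And>U. open U \<Longrightarrow> emeasure \<mu> U = inner_content m U"
    using regular_measure_exists by blast
  interpret M: prob_space \<mu> by (rule \<mu>)
  have sp: "space \<mu> = UNIV" using sets_eq_imp_space_eq[OF \<mu>(1)] by simp
  have "emeasure \<mu> U \<le> emeasure \<mu> (f -` U)" if U: "open U" for U
  proof -
    have open_vimage': "open (f -` V)" if "open V" for V using f that by (simp add: continuous_on_open_vimage)
    have "inner_content m U \<le> inner_content m (f -` U)"
      unfolding inner_content_def[of m U]
    proof (rule SUP_least)
      fix V assume "V \<in> {V. open V \<and> closure V \<subseteq> U}"
      then have V: "open V" "closure V \<subseteq> U" by auto
      have "closed (f -` closure V)" using f by (simp add: continuous_on_closed_vimage)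
      then have "closure (f -` V) \<subseteq> f -` closure V" using closure_subset by (intro closure_minimal) auto
      then have "closure (f -` V) \<subseteq> f -` U" using V(2) by blast
      then show "ennreal (m V) \<le> inner_content m (f -` U)"
        using inner_content_upper[of "f -` V" "f -` U" m] open_vimage'[OF V(1)] m_inv[of V] by simp
    qed
    then show ?thesis using \<mu>(3) U open_vimage'[OF U] by simp
  qed
  then have inv: "\<mu> \<in> invariant_measures f" by (intro invariant_measuresI_open f \<mu>)
  have closed_ge: "m K \<le> measure \<mu> K" if "closed K" for K
  proof -
    have "ennreal (measure \<mu> (- K)) = inner_content m (- K)"
      using \<mu>(3)[OF open_Compl[OF that]] by (simp add: M.emeasure_eq_measure)
    then have "ennreal (measure \<mu> (- K)) \<le> ennreal (m (- K))"
      using inner_content_le[of "- K"] by simp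
    then have "measure \<mu> (- K) \<le> m (- K)" using nonneg by simp
    then show ?thesis using complement[of K] M.prob_compl[of K] that \<mu>(1) sp
      by (simp add: Compl_eq_Diff_UNIV)
  qed
  have h_meas: "h \<in> borel_measurable borel" using h(1) by (rule borel_measurable_continuous_onI)
  define K where "K N j = {y. real j / real N \<le> h y}" for N j :: nat
  have K_closed: "closed (K N j)" for N j
    unfolding K_def using h(1) by (intro closed_Collect_le continuous_intros)
  have "c \<le> (\<integral>x. h x \<partial>\<mu>) + e" if e: "0 < e" for e
  proof -
    obtain N :: nat where N0: "2 / e < real N" using reals_Archimedean2 by blast
    have "0 < 2 / e" using e by simp
    then have "0 < real N" using N0 by linarith
    then have N: "0 < N" "2 / real N < e"
      using N0 e by (simp_all add: field_simps)
    have "c \<le> (\<Sum>j=1..N. m (K N j)) / real N + 1 / real N + 1 / real N"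
    proof -
      have "\<exists>k\<ge>0. \<forall>C\<in>K N ` {1..N}. \<bar>m C - p k C\<bar> < 1 / real N"
        using N by (intro m) auto
      then obtain k where k: "\<forall>C\<in>K N ` {1..N}. \<bar>m C - p k C\<bar> < 1 / real N" by blast
      have "real (n k) * c \<le> birkhoff_sum f h (n k) (x k)" by (rule nx)
      also have "\<dots> \<le> (\<Sum>i<n k. (\<Sum>j=1..N. indicator (K N j) ((f ^^ i) (x k))) / real N + 1 / real N)"
        unfolding birkhoff_sum_def
      proof (rule sum_mono)
        fix i
        show "h ((f ^^ i) (x k)) \<le> (\<Sum>j=1..N. indicator (K N j) ((f ^^ i) (x k))) / real N + 1 / real N"
          using staircase_bounds(2)[OF h(2,3) N(1), of "(f ^^ i) (x k)"]
          by (simp add: K_def indicator_def of_bool_def)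
      qed
      also have "\<dots> = real (n k) * ((\<Sum>j=1..N. p k (K N j)) / real N + 1 / real N)"
        unfolding p_def birkhoff_sum_def sum.distrib sum_divide_distrib[symmetric]
        using n_pos[of k] by (subst sum.swap) (simp add: field_simps)
      finally have "c \<le> (\<Sum>j=1..N. p k (K N j)) / real N + 1 / real N" using n_pos[of k] by simp
      also have "(\<Sum>j=1..N. p k (K N j)) \<le> (\<Sum>j=1..N. m (K N j) + 1 / real N)"
      proof (rule sum_mono)
        fix j assume "j \<in> {1..N}"
        then have "\<bar>m (K N j) - p k (K N j)\<bar> < 1 / real N" using k by blast
        then show "p k (K N j) \<le> m (K N j) + 1 / real N" by linarith
      qed
      then have "(\<Sum>j=1..N. p k (K N j)) / real N \<le> (\<Sum>j=1..N. m (K N j) + 1 / real N) / real N"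
        by (rule divide_right_mono) simp
      also have "\<dots> = (\<Sum>j=1..N. m (K N j)) / real N + 1 / real N"
        using N by (simp add: sum.distrib add_divide_distrib)
      finally show ?thesis using \<open>c \<le> (\<Sum>j=1..N. p k (K N j)) / real N + 1 / real N\<close> by linarith
    qed
    also have "(\<Sum>j=1..N. m (K N j)) / real N \<le> (\<Sum>j=1..N. measure \<mu> (K N j)) / real N"
      using closed_ge K_closed by (intro divide_right_mono sum_mono) auto
    also have "\<dots> = (\<integral>y. (\<Sum>j=1..N. indicator (K N j) y) / real N \<partial>\<mu>)"
      using K_closed \<mu>(1) by (simp add: M.emeasure_eq_measure)
    also have "\<dots> \<le> (\<integral>y. h y \<partial>\<mu>)"
    proof (rule integral_mono)
      show "integrable \<mu> (\<lambda>y. (\<Sum>j=1..N. indicator (K N j) y) / real N)"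
        using K_closed \<mu>(1) by (intro integrable_divide Bochner_Integration.integrable_sum integrable_real_indicator)
          (auto simp: M.emeasure_eq_measure)
      show "integrable \<mu> h"
        using h h_meas \<mu>(1) by (intro M.integrable_const_bound[of _ 1]) (auto cong: measurable_cong_sets)
      fix y show "(\<Sum>j=1..N. indicator (K N j) y) / real N \<le> h y"
        using staircase_bounds(1)[OF h(2,3) N(1), of y] by (simp add: K_def indicator_def of_bool_def)
    qed
    finally show ?thesis using N(2) by (simp add: field_simps)
  qed
  then have "c \<le> (\<integral>x. h x \<partial>\<mu>)" by (rule field_le_epsilon)
  then show ?thesis using that inv by blast
qed

section \<open>The induced pressure as a supremum over scales\<close>

text \<open>
  The limits \<open>\<epsilon> \<rightarrow> 0\<close> in the definitions of entropy and pressure exist by monotonicity.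
\<close>
lemma Lim_at_right_antimono:
  fixes p :: "real \<Rightarrow> ereal"
  assumes "\<And>a b. 0 < a \<Longrightarrow> a \<le> b \<Longrightarrow> p b \<le> p a"
  shows "Lim (at_right 0) p = (SUP \<epsilon>\<in>{0<..}. p \<epsilon>)"
proof (rule tendsto_Lim[OF trivial_limit_at_right_real], rule order_tendstoI)
  fix a assume "a < (SUP \<epsilon>\<in>{0<..}. p \<epsilon>)"
  then obtain \<epsilon> where \<epsilon>: "0 < \<epsilon>" "a < p \<epsilon>" by (auto simp: less_SUP_iff)
  have "a < p x" if "0 < x" "x < \<epsilon>" for x
    using assms[OF that(1), of \<epsilon>] that \<epsilon>(2) by auto
  then show "\<forall>\<^sub>F x in at_right 0. a < p x"
    unfolding eventually_at_right_field using \<epsilon>(1) by blast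
next
  fix a assume a: "(SUP \<epsilon>\<in>{0<..}. p \<epsilon>) < a"
  have "p x < a" if "0 < x" for x
  proof -
    have "p x \<le> (SUP \<epsilon>\<in>{0<..}. p \<epsilon>)" using that by (intro SUP_upper) simp
    then show ?thesis using a by simp
  qed
  then show "\<forall>\<^sub>F x in at_right 0. p x < a"
    unfolding eventually_at_right_field by (intro exI[of _ 1]) simp
qed

lemma spanning_set_mono: "spanning_set f n \<epsilon> Z F \<Longrightarrow> \<epsilon> \<le> \<epsilon>' \<Longrightarrow> spanning_set f n \<epsilon>' Z F"
  unfolding spanning_set_def by (meson order_trans)

lemma ln_ennreal_mono: "x \<le> y \<Longrightarrow> ln_ennreal x \<le> ln_ennreal y"
  by (cases x; cases y)
    (auto simp: ln_ennreal_def top_unique intro: ln_mono split: if_splits)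

lemma scaled_ln_ennreal_less_iff:
  assumes "0 < T"
  shows "ereal (1 / T) * ln_ennreal x < ereal s \<longleftrightarrow> x < ennreal (exp (s * T))"
proof (cases x)
  case (real r)
  show ?thesis
  proof (cases "r = 0")
    case True
    then show ?thesis using real assms by (simp add: ln_ennreal_def)
  next
    case False
    then have r: "0 < r" using real by simp
    have "ln r < s * T \<longleftrightarrow> r < exp (s * T)" using r by (metis exp_less_cancel_iff exp_ln)
    then show ?thesis using real r assms by (simp add: ln_ennreal_def ennreal_less_iff field_simps)
  qed
next
  case top
  then show ?thesis using assms by (simp add: ln_ennreal_def)
qed

lemma infsum_ennreal_le_cmult:
  fixes g h :: "'b \<Rightarrow> ennreal"
  assumes "\<And>x. x \<in> A \<Longrightarrow> g x \<le> K * h x" and "A \<subseteq> B"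
  shows "(\<Sum>\<^sub>\<infinity>x\<in>A. g x) \<le> K * (\<Sum>\<^sub>\<infinity>x\<in>B. h x)"
proof -
  have "sum g F \<le> K * (\<Sum>\<^sub>\<infinity>x\<in>B. h x)" if F: "finite F" "F \<subseteq> A" for F
  proof -
    have "sum g F \<le> (\<Sum>x\<in>F. K * h x)" using assms(1) F by (intro sum_mono) auto
    also have "\<dots> = K * sum h F" by (simp add: sum_distrib_left)
    also have "sum h F \<le> (\<Sum>\<^sub>\<infinity>x\<in>B. h x)"
      using F assms(2) by (subst nonneg_infsum_complete) (auto intro!: SUP_upper)
    finally show ?thesis by (simp add: mult_left_mono)
  qed
  then show ?thesis by (subst nonneg_infsum_complete) (auto intro!: SUP_least)
qed

lemma sum_le_infsum_ennreal:
  fixes h :: "'b \<Rightarrow> ennreal"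
  assumes "finite F" "F \<subseteq> A"
  shows "sum h F \<le> (\<Sum>\<^sub>\<infinity>x\<in>A. h x)"
  using assms by (subst nonneg_infsum_complete) (auto intro!: SUP_upper)

text \<open>The exponential growth rate in \<open>T\<close> at a fixed scale \<open>\<epsilon>\<close>, before the limit \<open>\<epsilon> \<rightarrow> 0\<close>.\<close>

definition induced_pressure_at ::
  "('a::metric_space \<Rightarrow> 'a) \<Rightarrow> ('a \<Rightarrow> real) \<Rightarrow> ('a \<Rightarrow> real) \<Rightarrow> real \<Rightarrow> ereal" where
  "induced_pressure_at f \<psi> \<phi> \<epsilon> =
     Limsup at_top (\<lambda>T::real. ereal (1 / T) * ln_ennreal (induced_Q f \<psi> \<phi> T \<epsilon>))"

lemma induced_Q_antimono:
  assumes "\<epsilon> \<le> \<epsilon>'"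
  shows "induced_Q f \<psi> \<phi> T \<epsilon>' \<le> induced_Q f \<psi> \<phi> T \<epsilon>"
  unfolding induced_Q_def using spanning_set_mono[OF _ assms]
  by (intro Inf_superset_mono) fast

lemma induced_pressure_at_antimono:
  assumes "\<epsilon> \<le> \<epsilon>'"
  shows "induced_pressure_at f \<psi> \<phi> \<epsilon>' \<le> induced_pressure_at f \<psi> \<phi> \<epsilon>"
  unfolding induced_pressure_at_def
proof (rule Limsup_mono)
  show "\<forall>\<^sub>F T in at_top. ereal (1 / T) * ln_ennreal (induced_Q f \<psi> \<phi> T \<epsilon>') \<le>
      ereal (1 / T) * ln_ennreal (induced_Q f \<psi> \<phi> T \<epsilon>)"
    using eventually_gt_at_top[of 0]
  proof eventually_elim
    case (elim T)
    then show ?case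
      by (intro ereal_mult_left_mono ln_ennreal_mono induced_Q_antimono assms) simp
  qed
qed

lemma induced_pressure_eq_SUP:
  "induced_pressure f \<psi> \<phi> = (SUP \<epsilon>\<in>{0<..}. induced_pressure_at f \<psi> \<phi> \<epsilon>)"
  unfolding induced_pressure_def induced_pressure_at_def[symmetric]
  by (rule Lim_at_right_antimono) (rule induced_pressure_at_antimono)

lemma induced_pressure_at_le: "0 < \<epsilon> \<Longrightarrow> induced_pressure_at f \<psi> \<phi> \<epsilon> \<le> induced_pressure f \<psi> \<phi>"
  unfolding induced_pressure_eq_SUP by (rule SUP_upper) simp

lemma induced_pressure_at_lessD:
  assumes "induced_pressure_at f \<psi> \<phi> \<epsilon> < ereal s"
  shows "\<forall>\<^sub>F T in at_top. induced_Q f \<psi> \<phi> T \<epsilon> < ennreal (exp (s * T))"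
proof -
  have "\<forall>\<^sub>F T in at_top. ereal (1 / T) * ln_ennreal (induced_Q f \<psi> \<phi> T \<epsilon>) < ereal s"
    using assms unfolding induced_pressure_at_def by (rule Limsup_lessD)
  then show ?thesis using eventually_gt_at_top[of 0]
    by eventually_elim (simp add: scaled_ln_ennreal_less_iff)
qed

lemma induced_pressure_at_leI:
  assumes "\<forall>\<^sub>F T in at_top. induced_Q f \<psi> \<phi> T \<epsilon> < ennreal (exp (s * T))"
  shows "induced_pressure_at f \<psi> \<phi> \<epsilon> \<le> ereal s"
  unfolding induced_pressure_at_def
proof (rule Limsup_bounded)
  show "\<forall>\<^sub>F T in at_top. ereal (1 / T) * ln_ennreal (induced_Q f \<psi> \<phi> T \<epsilon>) \<le> ereal s"
    using assms eventually_gt_at_top[of 0]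
    by eventually_elim (simp add: scaled_ln_ennreal_less_iff less_imp_le)
qed

lemma induced_Q_lessD:
  assumes "induced_Q f \<psi> \<phi> T \<epsilon> < c"
  shows "\<exists>F. (\<forall>n\<in>level_times f \<psi> T. spanning_set f n \<epsilon> (level_set f \<psi> T n) (F n)) \<and>
    (\<Sum>\<^sub>\<infinity>n\<in>level_times f \<psi> T. \<Sum>\<^sub>\<infinity>x\<in>F n. ennreal (exp (birkhoff_sum f \<phi> n x))) < c"
proof -
  obtain q where q: "q \<in> {(\<Sum>\<^sub>\<infinity>n\<in>level_times f \<psi> T. \<Sum>\<^sub>\<infinity>x\<in>F n. ennreal (exp (birkhoff_sum f \<phi> n x))) | F.
      \<forall>n\<in>level_times f \<psi> T. spanning_set f n \<epsilon> (level_set f \<psi> T n) (F n)}" "q < c"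
    using assms unfolding induced_Q_def Inf_less_iff by blast
  then obtain F where "\<forall>n\<in>level_times f \<psi> T. spanning_set f n \<epsilon> (level_set f \<psi> T n) (F n)"
    "q = (\<Sum>\<^sub>\<infinity>n\<in>level_times f \<psi> T. \<Sum>\<^sub>\<infinity>x\<in>F n. ennreal (exp (birkhoff_sum f \<phi> n x)))" by blast
  then show ?thesis using q(2) by (intro exI[of _ F]) simp
qed

lemma induced_Q_lower:
  assumes "\<And>n. n \<in> level_times f \<psi> T \<Longrightarrow> spanning_set f n \<epsilon> (level_set f \<psi> T n) (F n)"
  shows "induced_Q f \<psi> \<phi> T \<epsilon> \<le> (\<Sum>\<^sub>\<infinity>n\<in>level_times f \<psi> T. \<Sum>\<^sub>\<infinity>x\<in>F n. ennreal (exp (birkhoff_sum f \<phi> n x)))"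
  unfolding induced_Q_def using assms by (intro Inf_lower) auto

section \<open>Spanning sets and topological entropy\<close>

lemma exists_finite_spanning_set:
  fixes f :: "'a::metric_space \<Rightarrow> 'a"
  assumes cpt: "compact (UNIV :: 'a set)" and f: "continuous_on UNIV f" and "0 < n" and "0 < \<epsilon>"
  obtains F where "finite F" and "spanning_set f n \<epsilon> UNIV F"
proof -
  define U where "U x = (\<Inter>i<n. (f ^^ i) -` ball ((f ^^ i) x) \<epsilon>)" for x
  have op: "open (U x)" for x
    unfolding U_def by (intro open_INT ballI open_vimage[OF open_ball continuous_on_funpow[OF f]]) simp
  have "x \<in> U x" for x using \<open>0 < \<epsilon>\<close> by (simp add: U_def)
  then have cover: "UNIV \<subseteq> (\<Union>x\<in>UNIV. U x)" by blast
  obtain F where F: "F \<subseteq> UNIV" "finite F" "UNIV \<subseteq> (\<Union>x\<in>F. U x)"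
    by (rule compactE_image[OF cpt op cover])
  have "\<exists>x\<in>F. bowen_dist f n x y \<le> \<epsilon>" for y
  proof -
    obtain x where "x \<in> F" "y \<in> U x" using F(3) by blast
    then show ?thesis using \<open>0 < n\<close> by (intro bexI[of _ x]) (auto simp: bowen_dist_le_iff U_def intro: less_imp_le)
  qed
  then show ?thesis using that[OF F(2)] by (simp add: spanning_set_def)
qed

lemma spanning_number_attained:
  fixes f :: "'a::metric_space \<Rightarrow> 'a"
  assumes "compact (UNIV :: 'a set)" and "continuous_on UNIV f" and "0 < n" and "0 < \<epsilon>"
  obtains F where "finite F" and "spanning_set f n \<epsilon> UNIV F" and "card F = spanning_number f n \<epsilon>"
proof -
  obtain F where "finite F" "spanning_set f n \<epsilon> UNIV F"
    by (rule exists_finite_spanning_set[OF assms])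
  then have "{card F | F. finite F \<and> spanning_set f n \<epsilon> UNIV F} \<noteq> {}" by blast
  then have "spanning_number f n \<epsilon> \<in> {card F | F. finite F \<and> spanning_set f n \<epsilon> UNIV F}"
    unfolding spanning_number_def by (rule Inf_nat_def1)
  then show ?thesis using that by auto
qed

lemma spanning_number_antimono:
  fixes f :: "'a::metric_space \<Rightarrow> 'a"
  assumes "compact (UNIV :: 'a set)" and "continuous_on UNIV f" and "0 < n" and "0 < \<epsilon>" and "\<epsilon> \<le> \<epsilon>'"
  shows "spanning_number f n \<epsilon>' \<le> spanning_number f n \<epsilon>"
proof -
  obtain F where "finite F" "spanning_set f n \<epsilon> UNIV F" "card F = spanning_number f n \<epsilon>"
    by (rule spanning_number_attained[OF assms(1-4)])
  then have "spanning_number f n \<epsilon> \<in> {card F | F. finite F \<and> spanning_set f n \<epsilon>' UNIV F}"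
    using spanning_set_mono[OF _ assms(5), of f n UNIV F] by (intro CollectI exI[of _ F]) simp
  then show ?thesis unfolding spanning_number_def[of f n \<epsilon>'] by (rule wellorder_Inf_le1)
qed

lemma spanning_number_exponential_bound:
  fixes f :: "'a::metric_space \<Rightarrow> 'a"
  assumes cpt: "compact (UNIV :: 'a set)" and f: "continuous_on UNIV f" and "0 < \<epsilon>"
    and h: "topological_entropy f < ereal h"
  shows "\<forall>\<^sub>F n in sequentially. real (spanning_number f n \<epsilon>) \<le> exp (real n * h)"
proof -
  define q where "q \<epsilon> = limsup (\<lambda>n. ereal (ln (real (spanning_number f n \<epsilon>)) / real n))" for \<epsilon>
  have ln_mono: "ln (real j) \<le> ln (real k)" if "j \<le> k" for j k :: nat
    using that by (cases "j = 0"; cases "k = 0") auto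
  have "q b \<le> q a" if ab: "0 < a" "a \<le> b" for a b
    unfolding q_def
  proof (rule Limsup_mono)
    show "\<forall>\<^sub>F n in sequentially. ereal (ln (real (spanning_number f n b)) / real n)
        \<le> ereal (ln (real (spanning_number f n a)) / real n)"
      using eventually_gt_at_top[of 0]
    proof eventually_elim
      case (elim n)
      then show ?case
        using ln_mono[OF spanning_number_antimono[OF cpt f elim ab]] by (simp add: divide_right_mono)
    qed
  qed
  then have "topological_entropy f = (SUP \<epsilon>\<in>{0<..}. q \<epsilon>)"
    unfolding topological_entropy_def q_def[symmetric] by (rule Lim_at_right_antimono)
  moreover have "q \<epsilon> \<le> (SUP \<epsilon>\<in>{0<..}. q \<epsilon>)" using \<open>0 < \<epsilon>\<close> by (intro SUP_upper) simp
  ultimately have "q \<epsilon> < ereal h" using h by simp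
  then have "\<forall>\<^sub>F n in sequentially. ereal (ln (real (spanning_number f n \<epsilon>)) / real n) < ereal h"
    unfolding q_def by (rule Limsup_lessD)
  then show ?thesis using eventually_gt_at_top[of 0]
  proof eventually_elim
    case (elim n)
    then have "ln (real (spanning_number f n \<epsilon>)) < real n * h" by (simp add: field_simps)
    then show ?case
    proof (cases "spanning_number f n \<epsilon> = 0")
      case False
      have "exp (ln (real (spanning_number f n \<epsilon>))) \<le> exp (real n * h)"
        unfolding exp_le_cancel_iff by (rule less_imp_le) fact
      then show ?thesis using False by simp
    qed simp
  qed
qed

section \<open>Bounds for the induced pressure\<close>

lemma sum_UN_le:
  fixes g :: "'b \<Rightarrow> real"
  assumes "finite I" and "\<And>i. i \<in> I \<Longrightarrow> finite (A i)" and "\<And>x. 0 \<le> g x"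
  shows "sum g (\<Union>i\<in>I. A i) \<le> (\<Sum>i\<in>I. sum g (A i))"
  using assms(1,2)
proof (induction I rule: finite_induct)
  case (insert i I)
  have "sum g (A i \<union> (\<Union>i\<in>I. A i)) \<le> sum g (A i) + sum g (\<Union>i\<in>I. A i)"
  proof -
    have "finite (\<Union>i\<in>I. A i)" using insert.prems insert.hyps(1) by auto
    then have "sum g (A i \<union> (\<Union>i\<in>I. A i)) + sum g (A i \<inter> (\<Union>i\<in>I. A i)) =
        sum g (A i) + sum g (\<Union>i\<in>I. A i)"
      using insert.prems by (intro sum.union_inter) auto
    moreover have "0 \<le> sum g (A i \<inter> (\<Union>i\<in>I. A i))" using assms(3) by (rule sum_nonneg)
    ultimately show ?thesis by linarith
  qed
  moreover have "sum g (\<Union>i\<in>I. A i) \<le> (\<Sum>i\<in>I. sum g (A i))" using insert by simp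
  ultimately show ?case using insert.hyps by simp
qed simp

text \<open>
  A system on a compact metric space with a continuous \<open>\<psi>\<close> that is bounded between the positive constants
  \<open>m\<close> and \<open>M\<close>.
\<close>

locale roof_system =
  fixes f :: "'a::metric_space \<Rightarrow> 'a" and \<psi> :: "'a \<Rightarrow> real" and m M :: real
  assumes cpt: "compact (UNIV :: 'a set)" and f_cont: "continuous_on UNIV f"
    and \<psi>_cont: "continuous_on UNIV \<psi>" and m_pos: "0 < m"
    and \<psi>_lower: "m \<le> \<psi> x" and \<psi>_upper: "\<psi> x \<le> M"
begin

lemma M_pos: "0 < M"
  using m_pos \<psi>_lower[of undefined] \<psi>_upper[of undefined] by linarith

lemma birkhoff_roof_lower: "real n * m \<le> birkhoff_sum f \<psi> n x"
  using sum_mono[of "{..<n}" "\<lambda>_. m" "\<lambda>i. \<psi> ((f ^^ i) x)"] \<psi>_lower by (simp add: birkhoff_sum_def)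

lemma birkhoff_roof_upper: "birkhoff_sum f \<psi> n x \<le> real n * M"
  using sum_mono[of "{..<n}" "\<lambda>i. \<psi> ((f ^^ i) x)" "\<lambda>_. M"] \<psi>_upper by (simp add: birkhoff_sum_def)

lemma level_setD:
  assumes "x \<in> level_set f \<psi> T n"
  shows "birkhoff_sum f \<psi> n x \<le> T" and "T - M < birkhoff_sum f \<psi> n x"
  using assms \<psi>_upper[of "(f ^^ n) x"] by (auto simp: level_set_def birkhoff_sum_Suc)

lemma level_timesD:
  assumes "n \<in> level_times f \<psi> T"
  shows "0 < n" and "real n \<le> T / m" and "T / M - 1 < real n"
proof -
  obtain x where x: "birkhoff_sum f \<psi> n x \<le> T" "T < birkhoff_sum f \<psi> (Suc n) x" and "0 < n"
    using assms by (auto simp: level_times_def)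
  show "0 < n" by fact
  have "real n * m \<le> T" using birkhoff_roof_lower[of n x] x by linarith
  then show "real n \<le> T / m" using m_pos by (simp add: field_simps)
  have "T < real (Suc n) * M" using birkhoff_roof_upper[of "Suc n" x] x by linarith
  then show "T / M - 1 < real n" using M_pos by (simp add: field_simps)
qed

lemma level_timesI: "0 < n \<Longrightarrow> x \<in> level_set f \<psi> T n \<Longrightarrow> n \<in> level_times f \<psi> T"
  by (auto simp: level_set_def level_times_def)

lemma finite_level_times: "finite (level_times f \<psi> T)" "real (card (level_times f \<psi> T)) \<le> max 0 (T / m)"
proof -
  have sub: "level_times f \<psi> T \<subseteq> {1..nat \<lfloor>T / m\<rfloor>}"
  proof
    fix n assume "n \<in> level_times f \<psi> T"
    note n = level_timesD(1,2)[OF this]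
    then have "int n \<le> \<lfloor>T / m\<rfloor>" by (simp add: le_floor_iff)
    then show "n \<in> {1..nat \<lfloor>T / m\<rfloor>}" using n(1) by simp
  qed
  then show "finite (level_times f \<psi> T)" by (rule finite_subset) simp
  have "real (card (level_times f \<psi> T)) \<le> real (nat \<lfloor>T / m\<rfloor>)"
    using card_mono[OF _ sub] by simp
  also have "\<dots> \<le> max 0 (T / m)"
    by (cases "0 \<le> T / m") (simp_all add: nat_eq_iff)
  finally show "real (card (level_times f \<psi> T)) \<le> max 0 (T / m)" .
qed

lemma eventually_level_times:
  assumes "\<forall>\<^sub>F n in sequentially. P n"
  shows "\<forall>\<^sub>F T in at_top. \<forall>n\<in>level_times f \<psi> T. P n"
proof -
  obtain N where N: "\<And>n. N \<le> n \<Longrightarrow> P n" using assms by (auto simp: eventually_sequentially)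
  show ?thesis using eventually_ge_at_top[of "(real N + 1) * M"]
  proof eventually_elim
    case (elim T)
    then have "real N \<le> T / M - 1" using M_pos by (simp add: field_simps)
    show ?case
    proof
      fix n assume "n \<in> level_times f \<psi> T"
      then have "real N < real n" using level_timesD(3)[of n T] \<open>real N \<le> T / M - 1\<close> by linarith
      then show "P n" by (intro N) simp
    qed
  qed
qed

text \<open>
  Times in the level \<open>T\<close> are at most \<open>T / m\<close>, so minimal spanning sets of the whole space already have
  total weight growing at most exponentially in \<open>T\<close>.
\<close>

lemma induced_pressure_less_top:
  fixes \<phi> :: "'a \<Rightarrow> real"
  assumes "topological_entropy f < \<infinity>" and \<phi>: "continuous_on UNIV \<phi>"
  shows "induced_pressure f \<psi> \<phi> < \<infinity>"
proof -
  obtain h where h: "0 \<le> h" "topological_entropy f < ereal h"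
  proof -
    obtain h0 where "topological_entropy f < ereal h0"
      using less_PInf_Ex_of_nat[of "topological_entropy f"] assms(1) by auto
    then show ?thesis using that[of "max 0 h0"] order_less_le_trans[of _ "ereal h0" "ereal (max 0 h0)"] by simp
  qed
  obtain B where B: "0 < B" "\<And>x. \<bar>\<phi> x\<bar> \<le> B" using compact_bounded_real[OF cpt \<phi>] by blast
  define s where "s = (h + B + 1) / m"
  have "induced_pressure_at f \<psi> \<phi> \<epsilon> \<le> ereal s" if \<epsilon>: "0 < \<epsilon>" for \<epsilon>
  proof (rule induced_pressure_at_leI)
    have "\<forall>\<^sub>F T in at_top. \<forall>n\<in>level_times f \<psi> T. real (spanning_number f n \<epsilon>) \<le> exp (real n * h)"
      by (intro eventually_level_times spanning_number_exponential_bound[OF cpt f_cont \<epsilon> h(2)])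
    then show "\<forall>\<^sub>F T in at_top. induced_Q f \<psi> \<phi> T \<epsilon> < ennreal (exp (s * T))"
      using eventually_gt_at_top[of 0]
    proof eventually_elim
      case (elim T)
      let ?S = "level_times f \<psi> T"
      have "\<exists>F. finite F \<and> spanning_set f n \<epsilon> UNIV F \<and> real (card F) \<le> exp (real n * h)" if n: "n \<in> ?S" for n
      proof -
        obtain F where "finite F" "spanning_set f n \<epsilon> UNIV F" "card F = spanning_number f n \<epsilon>"
          by (rule spanning_number_attained[OF cpt f_cont level_timesD(1)[OF n] \<epsilon>])
        then show ?thesis using elim(1) n by (intro exI[of _ F]) simp
      qed
      then obtain F where F: "\<And>n. n \<in> ?S \<Longrightarrow> finite (F n)" "\<And>n. n \<in> ?S \<Longrightarrow> spanning_set f n \<epsilon> UNIV (F n)"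
        "\<And>n. n \<in> ?S \<Longrightarrow> real (card (F n)) \<le> exp (real n * h)" by metis
      have inner: "(\<Sum>x\<in>F n. exp (birkhoff_sum f \<phi> n x)) \<le> exp (T / m * (h + B))" if n: "n \<in> ?S" for n
      proof -
        have "(\<Sum>x\<in>F n. exp (birkhoff_sum f \<phi> n x)) \<le> (\<Sum>x\<in>F n. exp (real n * B))"
          using birkhoff_sum_abs_le[of \<phi> B f n, OF B(2)] by (intro sum_mono) (simp add: abs_le_iff)
        also have "\<dots> \<le> exp (real n * h) * exp (real n * B)" using F(3)[OF n] by simp
        also have "\<dots> = exp (real n * (h + B))" by (simp add: exp_add[symmetric] algebra_simps)
        also have "\<dots> \<le> exp (T / m * (h + B))"
          unfolding exp_le_cancel_iff using level_timesD(2)[OF n] h(1) B(1) by (intro mult_right_mono) auto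
        finally show ?thesis .
      qed
      have "induced_Q f \<psi> \<phi> T \<epsilon> \<le> (\<Sum>\<^sub>\<infinity>n\<in>?S. \<Sum>\<^sub>\<infinity>x\<in>F n. ennreal (exp (birkhoff_sum f \<phi> n x)))"
        using F(2) by (intro induced_Q_lower) (auto simp: spanning_set_def)
      also have "\<dots> = (\<Sum>n\<in>?S. ennreal (\<Sum>x\<in>F n. exp (birkhoff_sum f \<phi> n x)))"
        using finite_level_times F(1) by (simp add: infsum_finite)
      also have "\<dots> = ennreal (\<Sum>n\<in>?S. \<Sum>x\<in>F n. exp (birkhoff_sum f \<phi> n x))"
        by (rule sum_ennreal) (auto intro: sum_nonneg)
      also have "\<dots> < ennreal (exp (s * T))"
      proof (rule ennreal_lessI)
        have "(\<Sum>n\<in>?S. \<Sum>x\<in>F n. exp (birkhoff_sum f \<phi> n x)) \<le> (\<Sum>n\<in>?S. exp (T / m * (h + B)))"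
          by (intro sum_mono inner)
        also have "\<dots> = real (card ?S) * exp (T / m * (h + B))" by simp
        also have "\<dots> < exp (T / m) * exp (T / m * (h + B))"
        proof (rule mult_strict_right_mono)
          have "real (card ?S) \<le> T / m" using finite_level_times(2)[of T] elim(2) m_pos by simp
          then show "real (card ?S) < exp (T / m)" using exp_ge_add_one_self[of "T / m"] by linarith
        qed simp
        also have "\<dots> = exp (s * T)" unfolding s_def by (simp add: exp_add[symmetric] add_divide_distrib algebra_simps)
        finally show "(\<Sum>n\<in>?S. \<Sum>x\<in>F n. exp (birkhoff_sum f \<phi> n x)) < exp (s * T)" .
      qed simp
      finally show ?case .
    qed
  qed
  then have "induced_pressure f \<psi> \<phi> \<le> ereal s"
    unfolding induced_pressure_eq_SUP by (intro SUP_least) simp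
  then show ?thesis by (rule le_less_trans) simp
qed


lemma integrable_continuous:
  fixes g :: "'a \<Rightarrow> real"
  assumes \<mu>: "\<mu> \<in> invariant_measures f" and g: "continuous_on UNIV g"
  shows "integrable \<mu> g"
proof -
  interpret prob_space \<mu> by (rule invariant_measuresD[OF \<mu>])
  obtain B where B: "0 < B" "\<And>x. \<bar>g x\<bar> \<le> B" using compact_bounded_real[OF cpt g] by blast
  have "g \<in> borel_measurable \<mu>"
    using borel_measurable_continuous_onI[OF g] invariant_measuresD(1)[OF \<mu>] by (simp cong: measurable_cong_sets)
  then show ?thesis using B(2) by (intro integrable_const_bound[of _ B]) auto
qed

lemma integral_roof_pos:
  assumes \<mu>: "\<mu> \<in> invariant_measures f"
  shows "0 < (\<integral>x. \<psi> x \<partial>\<mu>)"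
proof -
  interpret prob_space \<mu> by (rule invariant_measuresD[OF \<mu>])
  have "(\<integral>x. m \<partial>\<mu>) \<le> (\<integral>x. \<psi> x \<partial>\<mu>)"
    using \<psi>_lower by (intro integral_mono integrable_continuous[OF \<mu> \<psi>_cont]) auto
  then show ?thesis using m_pos by (simp add: prob_space)
qed

text \<open>
  Spanning sets of a level set need not be contained in it; points that shadow the level set
  still have Birkhoff sums of \<open>\<psi>\<close> close to the level.
\<close>

lemma birkhoff_roof_near_level:
  assumes mod: "\<And>x y. dist x y \<le> \<epsilon> \<Longrightarrow> dist (\<psi> x) (\<psi> y) \<le> \<omega>"
    and "n \<in> level_times f \<psi> T" and "y \<in> level_set f \<psi> T n" and "bowen_dist f n x y \<le> \<epsilon>"
  shows "\<bar>birkhoff_sum f \<psi> n x - T\<bar> \<le> real n * \<omega> + M"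
  using birkhoff_sum_close[where g = \<psi> and e = \<omega>, OF mod level_timesD(1)[OF assms(2)] assms(4)]
    level_setD[OF assms(3)] M_pos unfolding abs_le_iff by linarith

text \<open>
  If the Birkhoff sums of \<open>\<theta>\<close> grow asymptotically at most like \<open>a\<close> times those of \<open>\<psi>\<close>, adding \<open>\<theta>\<close> to
  the potential raises the pressure by at most \<open>a\<close>, because the sums of \<open>\<psi>\<close> on the level \<open>T\<close> are close
  to \<open>T\<close>. The hypothesis on \<open>s\<close> stands for an arbitrary strict real upper bound of the pressure of \<open>\<phi>\<close>.
\<close>
lemma induced_pressure_add_le:
  fixes \<phi> \<theta> :: "'a \<Rightarrow> real"
  assumes growth: "\<And>e. 0 < e \<Longrightarrow> \<forall>\<^sub>F n in sequentially. \<forall>x. birkhoff_sum f \<theta> n x \<le> (a + e) * birkhoff_sum f \<psi> n x"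
    and s: "induced_pressure f \<psi> \<phi> < ereal s"
  shows "induced_pressure f \<psi> (\<lambda>x. \<phi> x + \<theta> x) \<le> ereal (s + a)"
proof -
  have "induced_pressure_at f \<psi> (\<lambda>x. \<phi> x + \<theta> x) \<epsilon> \<le> ereal (s + a + e)" if \<epsilon>: "0 < \<epsilon>" and e: "0 < e" for \<epsilon> e
  proof -
    define b where "b = a + e / 3"
    define \<omega> where "\<omega> = e * m / 3 / (\<bar>b\<bar> + 1)"
    have \<omega>: "0 < \<omega>" unfolding \<omega>_def using e m_pos by simp
    have b\<omega>: "\<bar>b\<bar> * \<omega> \<le> e * m / 3"
    proof -
      have "\<omega> * (\<bar>b\<bar> + 1) = e * m / 3"
        using \<omega>_def abs_add_one_gt_zero[of b] by (subst (asm) nonzero_eq_divide_eq) auto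
      moreover have "\<bar>b\<bar> * \<omega> \<le> \<omega> * (\<bar>b\<bar> + 1)" using \<omega> by (simp add: algebra_simps)
      ultimately show ?thesis by simp
    qed
    obtain \<delta>1 where \<delta>1: "0 < \<delta>1" "\<And>x y. dist x y \<le> \<delta>1 \<Longrightarrow> dist (\<psi> x) (\<psi> y) \<le> \<omega>"
      using compact_uniform_modulus[OF cpt \<psi>_cont \<omega>] by blast
    define \<delta> where "\<delta> = min \<epsilon> \<delta>1"
    have \<delta>: "0 < \<delta>" "\<delta> \<le> \<epsilon>" "\<And>x y. dist x y \<le> \<delta> \<Longrightarrow> dist (\<psi> x) (\<psi> y) \<le> \<omega>"
      unfolding \<delta>_def using \<epsilon> \<delta>1 by auto
    have "induced_pressure_at f \<psi> \<phi> \<delta> < ereal s"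
      using induced_pressure_at_le[OF \<delta>(1)] s by (rule le_less_trans)
    note evQ = induced_pressure_at_lessD[OF this]
    have "\<forall>\<^sub>F n in sequentially. \<forall>x. birkhoff_sum f \<theta> n x \<le> b * birkhoff_sum f \<psi> n x"
      unfolding b_def using e by (intro growth) simp
    note ev_growth = eventually_level_times[OF this]
    have "\<forall>\<^sub>F T in at_top. induced_Q f \<psi> (\<lambda>x. \<phi> x + \<theta> x) T \<delta> < ennreal (exp ((s + a + e) * T))"
      using evQ ev_growth eventually_ge_at_top[of "3 * \<bar>b\<bar> * M / e"] eventually_gt_at_top[of 0]
    proof eventually_elim
      case (elim T)
      let ?S = "level_times f \<psi> T"
      obtain F where F: "\<forall>n\<in>?S. spanning_set f n \<delta> (level_set f \<psi> T n) (F n)"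
        and F_sum: "(\<Sum>\<^sub>\<infinity>n\<in>?S. \<Sum>\<^sub>\<infinity>x\<in>F n. ennreal (exp (birkhoff_sum f \<phi> n x))) < ennreal (exp (s * T))"
        using induced_Q_lessD[OF elim(1)] by (elim exE conjE)
      \<comment> \<open>Only points that shadow the level set are kept; on them the sums of \<open>\<psi>\<close> are controlled.\<close>
      define G where "G n = {x \<in> F n. \<exists>y\<in>level_set f \<psi> T n. bowen_dist f n x y \<le> \<delta>}" for n
      define K where "K = exp (b * T + \<bar>b\<bar> * (T / m * \<omega> + M))"
      have G: "spanning_set f n \<delta> (level_set f \<psi> T n) (G n)" if "n \<in> ?S" for n
        unfolding spanning_set_def
      proof
        fix y assume y: "y \<in> level_set f \<psi> T n"
        have "\<forall>y\<in>level_set f \<psi> T n. \<exists>x\<in>F n. bowen_dist f n x y \<le> \<delta>"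
          using bspec[OF F that] by (simp only: spanning_set_def)
        from bspec[OF this y] obtain x where x: "x \<in> F n" "bowen_dist f n x y \<le> \<delta>" by (elim bexE)
        then have "x \<in> G n" unfolding G_def using y by auto
        then show "\<exists>x\<in>G n. bowen_dist f n x y \<le> \<delta>" using x(2) by (rule bexI[rotated])
      qed
      have term_le: "ennreal (exp (birkhoff_sum f (\<lambda>x. \<phi> x + \<theta> x) n x)) \<le> ennreal K * ennreal (exp (birkhoff_sum f \<phi> n x))"
        if n: "n \<in> ?S" and x: "x \<in> G n" for n x
      proof -
        obtain y where y: "y \<in> level_set f \<psi> T n" "bowen_dist f n x y \<le> \<delta>" using x by (auto simp: G_def)
        have "birkhoff_sum f \<theta> n x \<le> b * birkhoff_sum f \<psi> n x" using elim(2) n by blast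
        also have "\<dots> = b * T + b * (birkhoff_sum f \<psi> n x - T)" by (simp add: algebra_simps)
        also have "\<dots> \<le> b * T + \<bar>b\<bar> * \<bar>birkhoff_sum f \<psi> n x - T\<bar>"
          using abs_ge_self[of "b * (birkhoff_sum f \<psi> n x - T)"] by (simp add: abs_mult)
        also have "\<dots> \<le> b * T + \<bar>b\<bar> * (real n * \<omega> + M)"
          using birkhoff_roof_near_level[OF \<delta>(3) n y] by (intro add_left_mono mult_left_mono) auto
        also have "\<dots> \<le> b * T + \<bar>b\<bar> * (T / m * \<omega> + M)"
          using level_timesD(2)[OF n] \<omega> by (intro add_left_mono mult_left_mono add_right_mono mult_right_mono) auto
        finally have "exp (birkhoff_sum f \<theta> n x) \<le> K" unfolding K_def by simp
        then have "exp (birkhoff_sum f \<theta> n x) * exp (birkhoff_sum f \<phi> n x) \<le> K * exp (birkhoff_sum f \<phi> n x)"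
          by (rule mult_right_mono) simp
        moreover have "exp (birkhoff_sum f (\<lambda>x. \<phi> x + \<theta> x) n x) = exp (birkhoff_sum f \<theta> n x) * exp (birkhoff_sum f \<phi> n x)"
          unfolding exp_add[symmetric] by (simp add: birkhoff_sum_def sum.distrib add.commute)
        ultimately show ?thesis by (simp add: K_def ennreal_mult[symmetric] ennreal_leI)
      qed
      have "induced_Q f \<psi> (\<lambda>x. \<phi> x + \<theta> x) T \<delta> \<le>
          (\<Sum>\<^sub>\<infinity>n\<in>?S. \<Sum>\<^sub>\<infinity>x\<in>G n. ennreal (exp (birkhoff_sum f (\<lambda>x. \<phi> x + \<theta> x) n x)))"
        by (intro induced_Q_lower G)
      also have "\<dots> \<le> ennreal K * (\<Sum>\<^sub>\<infinity>n\<in>?S. \<Sum>\<^sub>\<infinity>x\<in>F n. ennreal (exp (birkhoff_sum f \<phi> n x)))"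
        by (intro infsum_ennreal_le_cmult term_le subset_refl) (simp_all add: G_def)
      also have "\<dots> < ennreal K * ennreal (exp (s * T))"
        using F_sum by (intro ennreal_mult_strict_left_mono) (auto simp: K_def)
      also have "\<dots> = ennreal (exp (b * T + \<bar>b\<bar> * (T / m * \<omega> + M) + s * T))"
        unfolding K_def by (simp add: ennreal_mult[symmetric] exp_add)
      also have "\<dots> \<le> ennreal (exp ((s + a + e) * T))"
      proof (intro ennreal_leI, unfold exp_le_cancel_iff)
        have "\<bar>b\<bar> * (T / m * \<omega>) = (\<bar>b\<bar> * \<omega>) * (T / m)" by simp
        also have "\<dots> \<le> (e * m / 3) * (T / m)" using b\<omega> elim(4) m_pos by (intro mult_right_mono) auto
        also have "\<dots> = e * T / 3" using m_pos by simp
        finally have "\<bar>b\<bar> * (T / m * \<omega>) \<le> e * T / 3" .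
        moreover have "\<bar>b\<bar> * M \<le> e * T / 3" using elim(3) e by (simp add: field_simps)
        moreover have "b * T = a * T + e * T / 3" by (simp add: b_def algebra_simps)
        ultimately show "b * T + \<bar>b\<bar> * (T / m * \<omega> + M) + s * T \<le> (s + a + e) * T"
          unfolding distrib_left distrib_right by linarith
      qed
      finally show ?case .
    qed
    then have "induced_pressure_at f \<psi> (\<lambda>x. \<phi> x + \<theta> x) \<delta> \<le> ereal (s + a + e)"
      by (rule induced_pressure_at_leI)
    then show ?thesis using induced_pressure_at_antimono[OF \<delta>(2)] by (rule order_trans[rotated])
  qed
  then have le: "induced_pressure f \<psi> (\<lambda>x. \<phi> x + \<theta> x) \<le> ereal (s + a) + ereal e" if "0 < e" for e
    unfolding induced_pressure_eq_SUP using that by (intro SUP_least) simp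
  show ?thesis
    by (rule ereal_le_epsilon2) (rule le)
qed

text \<open>
  A bound on the ratio of the integrals over all invariant measures is a uniform bound on the ratio of
  Birkhoff sums at large times.
\<close>
lemma birkhoff_growth_le:
  fixes \<phi> :: "'a \<Rightarrow> real"
  assumes \<phi>: "continuous_on UNIV \<phi>"
    and ratio: "\<And>\<nu>. \<nu> \<in> invariant_measures f \<Longrightarrow> (\<integral>x. \<phi> x \<partial>\<nu>) \<le> a * (\<integral>x. \<psi> x \<partial>\<nu>)"
    and e: "0 < e"
  shows "\<forall>\<^sub>F n in sequentially. \<forall>x. birkhoff_sum f \<phi> n x \<le> (a + e) * birkhoff_sum f \<psi> n x"
proof (rule ccontr)
  define g where "g x = \<phi> x - (a + e) * \<psi> x" for x
  have g_cont: "continuous_on UNIV g" unfolding g_def using \<phi> \<psi>_cont by (intro continuous_intros)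
  obtain B where B: "0 < B" "\<And>x. \<bar>g x\<bar> \<le> B" using compact_bounded_real[OF cpt g_cont] by blast
  \<comment> \<open>Rescaled to \<open>[0, 1]\<close>, a nonnegative average of \<open>g\<close> is an average of \<open>h\<close> of at least \<open>1 / 2\<close>.\<close>
  define h where "h x = (g x + B) / (2 * B)" for x
  have h: "continuous_on UNIV h" "0 \<le> h x" "h x \<le> 1" for x
  proof -
    show "continuous_on UNIV h" unfolding h_def using B(1) by (intro continuous_intros g_cont) auto
    show "0 \<le> h x" "h x \<le> 1" using B(1) B(2)[of x] by (simp_all add: h_def abs_le_iff field_simps)
  qed
  assume "\<not> (\<forall>\<^sub>F n in sequentially. \<forall>x. birkhoff_sum f \<phi> n x \<le> (a + e) * birkhoff_sum f \<psi> n x)"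
  then have bad: "\<exists>n\<ge>N. \<exists>x. \<not> birkhoff_sum f \<phi> n x \<le> (a + e) * birkhoff_sum f \<psi> n x" for N
    unfolding eventually_sequentially by blast
  have "\<exists>n\<ge>N. \<exists>x. real n * (1 / 2) \<le> birkhoff_sum f h n x" for N
  proof -
    obtain n x where n: "N \<le> n" and nx: "\<not> birkhoff_sum f \<phi> n x \<le> (a + e) * birkhoff_sum f \<psi> n x"
      using bad[of N] by blast
    have "0 \<le> birkhoff_sum f g n x" using nx unfolding g_def birkhoff_sum_diff by linarith
    then have "0 \<le> birkhoff_sum f g n x / (2 * B)" using B(1) by simp
    moreover have "birkhoff_sum f h n x = (birkhoff_sum f g n x + real n * B) / (2 * B)"
      unfolding birkhoff_sum_def h_def sum_divide_distrib[symmetric] by (simp add: sum.distrib)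
    then have "birkhoff_sum f h n x = birkhoff_sum f g n x / (2 * B) + real n / 2"
      using B(1) by (simp add: add_divide_distrib)
    ultimately have "real n * (1 / 2) \<le> birkhoff_sum f h n x" by linarith
    then show ?thesis using n by blast
  qed
  then obtain \<mu> where \<mu>: "\<mu> \<in> invariant_measures f" "1 / 2 \<le> (\<integral>x. h x \<partial>\<mu>)"
    by (rule invariant_measure_from_orbit_averages[OF cpt f_cont h])
  note int = integrable_continuous[OF \<mu>(1)]
  interpret prob_space \<mu> by (rule invariant_measuresD[OF \<mu>(1)])
  have "(\<integral>x. h x \<partial>\<mu>) = ((\<integral>x. g x \<partial>\<mu>) + B) / (2 * B)"
    unfolding h_def using int[OF g_cont] by (simp add: prob_space)
  then have "1 / 2 * (2 * B) \<le> (\<integral>x. g x \<partial>\<mu>) + B" using \<mu>(2) B(1) pos_le_divide_eq[of "2 * B"] by simp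
  then have "0 \<le> (\<integral>x. g x \<partial>\<mu>)" by simp
  also have "(\<integral>x. g x \<partial>\<mu>) = (\<integral>x. \<phi> x \<partial>\<mu>) - (a + e) * (\<integral>x. \<psi> x \<partial>\<mu>)"
    unfolding g_def using int[OF \<phi>] int[OF \<psi>_cont] by simp
  also have "\<dots> \<le> - e * (\<integral>x. \<psi> x \<partial>\<mu>)" using ratio[OF \<mu>(1)] by (simp add: algebra_simps)
  also have "\<dots> < 0" using e integral_roof_pos[OF \<mu>(1)] by simp
  finally show False by simp
qed

text \<open>
  The inequality \<open>h(\<mu>) + \<integral>\<phi> d\<mu> \<le> s \<integral>\<psi> d\<mu>\<close> for every real \<open>s\<close> above the induced pressure, obtained from
  the entropy bound for the potential \<open>\<phi> - s \<psi>\<close>.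
\<close>

lemma free_energy_le_induced_pressure:
  fixes \<phi> :: "'a \<Rightarrow> real"
  assumes \<phi>: "continuous_on UNIV \<phi>" and \<mu>: "\<mu> \<in> invariant_measures f"
    and s: "induced_pressure f \<psi> \<phi> < ereal s"
  shows "measure_entropy f \<mu> + ereal (\<integral>x. \<phi> x \<partial>\<mu>) \<le> ereal (s * (\<integral>x. \<psi> x \<partial>\<mu>))"
proof -
  define g where "g x = \<phi> x - s * \<psi> x" for x
  have g_cont: "continuous_on UNIV g" unfolding g_def using \<phi> \<psi>_cont by (intro continuous_intros)
  note int = integrable_continuous[OF \<mu>]
  have g_int: "(\<integral>x. g x \<partial>\<mu>) = (\<integral>x. \<phi> x \<partial>\<mu>) - s * (\<integral>x. \<psi> x \<partial>\<mu>)"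
    unfolding g_def using int[OF \<phi>] int[OF \<psi>_cont] by simp
  have bound: "entropy_wrt_partition f \<mu> \<xi> + ereal (\<integral>x. g x \<partial>\<mu>) \<le> ereal \<eta>"
    if \<xi>: "\<xi> \<in> finite_measurable_partitions \<mu>" and \<eta>: "0 < \<eta>" for \<xi> \<eta>
  proof (rule entropy_plus_integral_le_spanning[OF cpt f_cont g_cont \<mu> \<xi>])
    fix \<delta>0 :: real assume \<delta>0: "0 < \<delta>0"
    define \<omega> where "\<omega> = \<eta> / 2 / (\<bar>s\<bar> + 1)"
    have \<omega>: "0 < \<omega>" unfolding \<omega>_def using \<eta> by simp
    have s\<omega>: "\<bar>s\<bar> * \<omega> \<le> \<eta> / 2"
    proof -
      have "\<omega> * (\<bar>s\<bar> + 1) = \<eta> / 2"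
        using \<omega>_def abs_add_one_gt_zero[of s] by (subst (asm) nonzero_eq_divide_eq) auto
      moreover have "\<bar>s\<bar> * \<omega> \<le> \<omega> * (\<bar>s\<bar> + 1)" using \<omega> by (simp add: algebra_simps)
      ultimately show ?thesis by simp
    qed
    obtain \<delta>1 where \<delta>1: "0 < \<delta>1" "\<And>x y. dist x y \<le> \<delta>1 \<Longrightarrow> dist (\<psi> x) (\<psi> y) \<le> \<omega>"
      using compact_uniform_modulus[OF cpt \<psi>_cont \<omega>] by blast
    define \<delta> where "\<delta> = min \<delta>0 \<delta>1"
    have \<delta>: "0 < \<delta>" "\<delta> \<le> \<delta>0" "\<And>x y. dist x y \<le> \<delta> \<Longrightarrow> dist (\<psi> x) (\<psi> y) \<le> \<omega>"
      unfolding \<delta>_def using \<delta>0 \<delta>1 by auto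
    have "induced_pressure_at f \<psi> \<phi> \<delta> < ereal s"
      using induced_pressure_at_le[OF \<delta>(1)] s by (rule le_less_trans)
    then obtain T0 where T0: "\<And>T. T0 \<le> T \<Longrightarrow> induced_Q f \<psi> \<phi> T \<delta> < ennreal (exp (s * T))"
      using induced_pressure_at_lessD[of f \<psi> \<phi> \<delta> s] by (auto simp: eventually_at_top_linorder)
    have ev_growth: "\<forall>\<^sub>F n in sequentially. ((real n + 1) * M / m + 1) * exp (\<bar>s\<bar> * M) \<le> exp (real n * \<eta> / 2)"
    proof -
      have "\<forall>\<^sub>F n in sequentially. ((real n + 1) * c + 1) * d \<le> exp (real n * \<eta> / 2)" if "0 < c" "0 < d" for c d :: real
        using that \<eta> by real_asymp
      from this[of "M / m" "exp (\<bar>s\<bar> * M)"] show ?thesis using M_pos m_pos by simp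
    qed
    have "\<forall>\<^sub>F n in sequentially. \<exists>E. spanning_set f n \<delta> UNIV E \<and>
      (\<forall>D. finite D \<longrightarrow> D \<subseteq> E \<longrightarrow> (\<Sum>y\<in>D. exp (birkhoff_sum f g n y)) \<le> exp (real n * \<eta>))"
      using ev_growth eventually_gt_at_top[of 0] eventually_ge_at_top[of "nat \<lceil>T0 / m\<rceil>"]
    proof eventually_elim
      case (elim n)
      have n: "0 < n" by fact
      \<comment> \<open>Levels \<open>T = k * m\<close> with \<open>k \<in> \<K>\<close> suffice at time \<open>n\<close>, since consecutive Birkhoff sums of \<open>\<psi>\<close> differ by at least \<open>m\<close>.\<close>
      define \<K> where "\<K> = {n..nat \<lfloor>(real n + 1) * M / m\<rfloor>}"
      have card_\<K>: "real (card \<K>) \<le> (real n + 1) * M / m + 1"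
      proof -
        have "0 \<le> (real n + 1) * M / m" using M_pos m_pos by simp
        then have "real (nat \<lfloor>(real n + 1) * M / m\<rfloor>) \<le> (real n + 1) * M / m" by simp
        moreover have "card \<K> \<le> nat \<lfloor>(real n + 1) * M / m\<rfloor> + 1" unfolding \<K>_def by simp
        ultimately show ?thesis by linarith
      qed
      define good where "good k F \<longleftrightarrow> (\<forall>n\<in>level_times f \<psi> (real k * m). spanning_set f n \<delta> (level_set f \<psi> (real k * m) n) (F n)) \<and>
        (\<Sum>\<^sub>\<infinity>n\<in>level_times f \<psi> (real k * m). \<Sum>\<^sub>\<infinity>x\<in>F n. ennreal (exp (birkhoff_sum f \<phi> n x))) < ennreal (exp (s * (real k * m)))" for k F
      have "\<exists>F. good k F" if k: "k \<in> \<K>" for k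
      proof -
        have "T0 / m \<le> real n" using elim(3) by linarith
        also have "\<dots> \<le> real k" using k by (simp add: \<K>_def)
        finally have "T0 \<le> real k * m" using m_pos by (simp add: field_simps)
        note Q = T0[OF this]
        show ?thesis unfolding good_def by (rule induced_Q_lessD[OF Q])
      qed
      then obtain F where F': "\<And>k. k \<in> \<K> \<Longrightarrow> good k (F k)" by metis
      have F: "\<And>k n. k \<in> \<K> \<Longrightarrow> n \<in> level_times f \<psi> (real k * m) \<Longrightarrow>
          spanning_set f n \<delta> (level_set f \<psi> (real k * m) n) (F k n)"
        "\<And>k. k \<in> \<K> \<Longrightarrow> (\<Sum>\<^sub>\<infinity>n\<in>level_times f \<psi> (real k * m). \<Sum>\<^sub>\<infinity>x\<in>F k n. ennreal (exp (birkhoff_sum f \<phi> n x)))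
          < ennreal (exp (s * (real k * m)))"
        using F' by (simp_all add: good_def)
      define E where "E k = {y \<in> F k n. n \<in> level_times f \<psi> (real k * m) \<and>
        (\<exists>x\<in>level_set f \<psi> (real k * m) n. bowen_dist f n y x \<le> \<delta>)}" for k
      have "\<exists>y\<in>\<Union>k\<in>\<K>. E k. bowen_dist f n y x \<le> \<delta>" for x
      proof -
        let ?S = "birkhoff_sum f \<psi> n x"
        define k where "k = nat \<lceil>?S / m\<rceil>"
        have S_lower: "real n * m \<le> ?S" by (rule birkhoff_roof_lower)
        then have "real n \<le> ?S / m" using m_pos by (simp add: field_simps)
        then have k: "?S / m \<le> real k" "real k < ?S / m + 1" "n \<le> k"
          unfolding k_def by linarith+
        have k1: "?S \<le> real k * m" and k2: "real k * m < ?S + m"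
          using k(1,2) m_pos by (simp_all add: field_simps)
        then have lev: "x \<in> level_set f \<psi> (real k * m) n"
          using \<psi>_lower[of "(f ^^ n) x"] by (simp add: level_set_def birkhoff_sum_Suc)
        have "real k * m < birkhoff_sum f \<psi> (Suc n) x" using lev by (simp add: level_set_def)
        also have "\<dots> \<le> (real n + 1) * M" using birkhoff_roof_upper[of "Suc n" x] by (simp add: algebra_simps)
        finally have "real k \<le> (real n + 1) * M / m" using m_pos by (simp add: field_simps)
        then have "k \<in> \<K>" unfolding \<K>_def using k(3) by (simp add: le_nat_floor)
        moreover have lt: "n \<in> level_times f \<psi> (real k * m)" using level_timesI[OF n lev] .
        ultimately obtain y where "y \<in> F k n" "bowen_dist f n y x \<le> \<delta>"
          using F(1)[of k n] lev unfolding spanning_set_def by blast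
        then have "y \<in> E k" "bowen_dist f n y x \<le> \<delta>" unfolding E_def using lt lev by blast+
        then show ?thesis using \<open>k \<in> \<K>\<close> by blast
      qed
      then have "spanning_set f n \<delta> UNIV (\<Union>k\<in>\<K>. E k)" by (simp add: spanning_set_def)
      moreover have "(\<Sum>y\<in>D. exp (birkhoff_sum f g n y)) \<le> exp (real n * \<eta>)"
        if D: "finite D" "D \<subseteq> (\<Union>k\<in>\<K>. E k)" for D
      proof -
        define c where "c = exp (\<bar>s\<bar> * (real n * \<omega> + M))"
        have part: "(\<Sum>y\<in>D \<inter> E k. exp (birkhoff_sum f g n y)) \<le> c" if k: "k \<in> \<K>" for k
        proof (cases "n \<in> level_times f \<psi> (real k * m)")
          case False
          then have "E k = {}" by (auto simp: E_def)
          then show ?thesis by (simp add: c_def)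
        next
          case lt: True
          define T where "T = real k * m"
          have "(\<Sum>y\<in>D \<inter> E k. exp (birkhoff_sum f g n y)) \<le> (\<Sum>y\<in>D \<inter> E k. exp (birkhoff_sum f \<phi> n y) * (exp (- s * T) * c))"
          proof (rule sum_mono)
            fix y assume "y \<in> D \<inter> E k"
            then obtain x where "x \<in> level_set f \<psi> T n" "bowen_dist f n y x \<le> \<delta>"
              by (auto simp: E_def T_def)
            then have near: "\<bar>birkhoff_sum f \<psi> n y - T\<bar> \<le> real n * \<omega> + M"
              using lt by (intro birkhoff_roof_near_level[OF \<delta>(3)]) (simp_all add: T_def)
            have "- s * birkhoff_sum f \<psi> n y = - s * T - s * (birkhoff_sum f \<psi> n y - T)"
              by (simp add: algebra_simps)
            also have "\<dots> \<le> - s * T + \<bar>s\<bar> * \<bar>birkhoff_sum f \<psi> n y - T\<bar>"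
              using abs_ge_minus_self[of "s * (birkhoff_sum f \<psi> n y - T)"] by (simp add: abs_mult)
            also have "\<dots> \<le> - s * T + \<bar>s\<bar> * (real n * \<omega> + M)"
              using near by (intro add_left_mono mult_left_mono) auto
            finally show "exp (birkhoff_sum f g n y) \<le> exp (birkhoff_sum f \<phi> n y) * (exp (- s * T) * c)"
              unfolding c_def g_def birkhoff_sum_diff exp_add[symmetric] exp_le_cancel_iff by linarith
          qed
          also have "\<dots> = (\<Sum>y\<in>D \<inter> E k. exp (birkhoff_sum f \<phi> n y)) * (exp (- s * T) * c)"
            by (rule sum_distrib_right[symmetric])
          also have "\<dots> \<le> exp (s * T) * (exp (- s * T) * c)"
          proof (rule mult_right_mono)
            have "ennreal (\<Sum>y\<in>D \<inter> E k. exp (birkhoff_sum f \<phi> n y)) = (\<Sum>y\<in>D \<inter> E k. ennreal (exp (birkhoff_sum f \<phi> n y)))"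
              by (rule sum_ennreal[symmetric]) simp
            also have "\<dots> \<le> (\<Sum>\<^sub>\<infinity>x\<in>F k n. ennreal (exp (birkhoff_sum f \<phi> n x)))"
              using D(1) by (intro sum_le_infsum_ennreal) (auto simp: E_def)
            also have "\<dots> \<le> (\<Sum>\<^sub>\<infinity>n\<in>level_times f \<psi> T. \<Sum>\<^sub>\<infinity>x\<in>F k n. ennreal (exp (birkhoff_sum f \<phi> n x)))"
              using sum_le_infsum_ennreal[of "{n}" "level_times f \<psi> T" "\<lambda>n. \<Sum>\<^sub>\<infinity>x\<in>F k n. ennreal (exp (birkhoff_sum f \<phi> n x))"] lt
              by (simp add: T_def)
            also have "\<dots> < ennreal (exp (s * T))" unfolding T_def by (rule F(2)[OF k])
            finally show "(\<Sum>y\<in>D \<inter> E k. exp (birkhoff_sum f \<phi> n y)) \<le> exp (s * T)"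
              by (simp add: ennreal_less_iff sum_nonneg less_imp_le)
          qed (simp add: c_def)
          also have "\<dots> = c" by (simp add: exp_minus)
          finally show ?thesis .
        qed
        have "D = (\<Union>k\<in>\<K>. D \<inter> E k)" using D(2) by blast
        then have "(\<Sum>y\<in>D. exp (birkhoff_sum f g n y)) = (\<Sum>y\<in>(\<Union>k\<in>\<K>. D \<inter> E k). exp (birkhoff_sum f g n y))" by simp
        also have "\<dots> \<le> (\<Sum>k\<in>\<K>. \<Sum>y\<in>D \<inter> E k. exp (birkhoff_sum f g n y))"
          using D(1) by (intro sum_UN_le) (auto simp: \<K>_def)
        also have "\<dots> \<le> real (card \<K>) * c" using sum_mono[OF part] by simp
        also have "\<dots> \<le> ((real n + 1) * M / m + 1) * c"
          using card_\<K> by (intro mult_right_mono) (auto simp: c_def)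
        also have "\<dots> = (((real n + 1) * M / m + 1) * exp (\<bar>s\<bar> * M)) * exp (\<bar>s\<bar> * (real n * \<omega>))"
          unfolding c_def distrib_left exp_add by simp
        also have "\<dots> \<le> exp (real n * \<eta> / 2) * exp (real n * \<eta> / 2)"
        proof (rule mult_mono[OF elim(1)])
          have "\<bar>s\<bar> * (real n * \<omega>) \<le> real n * \<eta> / 2"
            using mult_left_mono[OF s\<omega>, of "real n"] by (simp add: algebra_simps)
          then show "exp (\<bar>s\<bar> * (real n * \<omega>)) \<le> exp (real n * \<eta> / 2)" by simp
        qed auto
        also have "\<dots> = exp (real n * \<eta>)" unfolding exp_add[symmetric] by simp
        finally show ?thesis .
      qed
      ultimately show ?case by (intro exI[of _ "\<Union>k\<in>\<K>. E k"] conjI allI impI)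
    qed
    then show "\<exists>\<delta>>0. \<delta> \<le> \<delta>0 \<and> (\<forall>\<^sub>F n in sequentially. \<exists>E. spanning_set f n \<delta> UNIV E \<and>
      (\<forall>D. finite D \<longrightarrow> D \<subseteq> E \<longrightarrow> (\<Sum>y\<in>D. exp (birkhoff_sum f g n y)) \<le> exp (real n * \<eta>)))"
      using \<delta>(1,2) by (intro exI[of _ \<delta>] conjI)
  qed
  have "entropy_wrt_partition f \<mu> \<xi> \<le> ereal (- (\<integral>x. g x \<partial>\<mu>))"
    if \<xi>: "\<xi> \<in> finite_measurable_partitions \<mu>" for \<xi>
  proof (rule ereal_le_epsilon2)
    fix \<eta> :: real assume "0 < \<eta>"
    from bound[OF \<xi> this] show "entropy_wrt_partition f \<mu> \<xi> \<le> ereal (- (\<integral>x. g x \<partial>\<mu>)) + ereal \<eta>"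
      by (cases "entropy_wrt_partition f \<mu> \<xi>") auto
  qed
  then have "measure_entropy f \<mu> \<le> ereal (- (\<integral>x. g x \<partial>\<mu>))"
    unfolding measure_entropy_def by (rule SUP_least)
  then show ?thesis unfolding g_int by (cases "measure_entropy f \<mu>") auto
qed


lemma free_energy_quotient_le_induced_pressure:
  fixes \<phi> :: "'a \<Rightarrow> real"
  assumes \<phi>: "continuous_on UNIV \<phi>" and \<mu>: "\<mu> \<in> invariant_measures f"
  shows "(measure_entropy f \<mu> + ereal (\<integral>x. \<phi> x \<partial>\<mu>)) / ereal (\<integral>x. \<psi> x \<partial>\<mu>) \<le> induced_pressure f \<psi> \<phi>"
proof (rule ccontr)
  assume "\<not> ?thesis"
  then obtain s where s: "induced_pressure f \<psi> \<phi> < ereal s"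
    "ereal s < (measure_entropy f \<mu> + ereal (\<integral>x. \<phi> x \<partial>\<mu>)) / ereal (\<integral>x. \<psi> x \<partial>\<mu>)"
    using ereal_dense2 by (meson not_le)
  have pos: "0 < (\<integral>x. \<psi> x \<partial>\<mu>)" by (rule integral_roof_pos[OF \<mu>])
  have "measure_entropy f \<mu> + ereal (\<integral>x. \<phi> x \<partial>\<mu>) \<le> ereal (s * (\<integral>x. \<psi> x \<partial>\<mu>))"
    by (rule free_energy_le_induced_pressure[OF \<phi> \<mu> s(1)])
  then obtain h where h: "measure_entropy f \<mu> = ereal h" "h + (\<integral>x. \<phi> x \<partial>\<mu>) \<le> s * (\<integral>x. \<psi> x \<partial>\<mu>)"
    using measure_entropy_nonneg[OF \<mu>] by (cases "measure_entropy f \<mu>") auto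
  then show False using s(2) pos by (simp add: pos_less_divide_eq)
qed

lemma measure_entropy_finite:
  assumes "topological_entropy f < \<infinity>" and \<mu>: "\<mu> \<in> invariant_measures f"
  shows "measure_entropy f \<mu> = ereal (real_of_ereal (measure_entropy f \<mu>))"
    and "0 \<le> real_of_ereal (measure_entropy f \<mu>)"
proof -
  have c: "continuous_on UNIV (\<lambda>x::'a. 0::real)" by simp
  have "induced_pressure f \<psi> (\<lambda>x. 0) < \<infinity>"
    by (rule induced_pressure_less_top[OF assms(1) c])
  then obtain s where "induced_pressure f \<psi> (\<lambda>x. 0) < ereal s"
    using less_PInf_Ex_of_nat by auto
  from free_energy_le_induced_pressure[OF c \<mu> this] measure_entropy_nonneg[OF \<mu>]
  show "measure_entropy f \<mu> = ereal (real_of_ereal (measure_entropy f \<mu>))"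
    and "0 \<le> real_of_ereal (measure_entropy f \<mu>)"
    by (cases "measure_entropy f \<mu>"; simp)+
qed

end

section \<open>Equilibrium states of scaled potentials\<close>

theorem theorem3p3:
  fixes f :: "'a::metric_space \<Rightarrow> 'a" and \<phi> \<psi> :: "'a \<Rightarrow> real" and \<F> :: "'a measure set"
  assumes "compact (UNIV :: 'a set)" and "continuous_on UNIV f"
    and "topological_entropy f < \<infinity>"
    and "continuous_on UNIV \<phi>" and "continuous_on UNIV \<psi>" and "\<forall>x. \<psi> x > 0"
    and "\<F> \<noteq> {}" and "\<F> \<subseteq> invariant_measures f"
  shows "(\<forall>\<beta>::real. \<beta> \<ge> 1 \<longrightarrow> \<F> = equilibrium_states f \<psi> (\<lambda>x. \<beta> * \<phi> x)) \<longleftrightarrow>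
    (\<F> = equilibrium_states f \<psi> \<phi> \<and>
     (\<forall>\<mu>\<in>\<F>. ereal ((\<integral>x. \<phi> x \<partial>\<mu>) / (\<integral>x. \<psi> x \<partial>\<mu>)) =
        (SUP \<nu>\<in>invariant_measures f. ereal ((\<integral>x. \<phi> x \<partial>\<nu>) / (\<integral>x. \<psi> x \<partial>\<nu>)))))"
proof -
  have "\<exists>x. \<forall>y. \<psi> x \<le> \<psi> y"
    using continuous_attains_inf[of "UNIV :: 'a set" \<psi>] assms(1,5) by auto
  then obtain x0 where x0: "\<And>y. \<psi> x0 \<le> \<psi> y" by blast
  obtain M where M: "0 < M" "\<And>x. \<bar>\<psi> x\<bar> \<le> M" using compact_bounded_real[OF assms(1,5)] by blast
  interpret roof_system f \<psi> "\<psi> x0" M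
    using assms x0 M by unfold_locales (auto simp: abs_le_iff)
  define \<I> where "\<I> = invariant_measures f"
  define p where "p \<beta> = real_of_ereal (induced_pressure f \<psi> (\<lambda>x. \<beta> * \<phi> x))" for \<beta>
  define \<eta> where "\<eta> \<mu> = real_of_ereal (measure_entropy f \<mu>) / (\<integral>x. \<psi> x \<partial>\<mu>)" for \<mu>
  define \<alpha> where "\<alpha> \<mu> = (\<integral>x. \<phi> x \<partial>\<mu>) / (\<integral>x. \<psi> x \<partial>\<mu>)" for \<mu>
  have \<beta>\<phi>_cont: "continuous_on UNIV (\<lambda>x. \<beta> * \<phi> x)" for \<beta>
    using assms(4) by (intro continuous_intros)
  note roof_pos = integral_roof_pos[folded \<I>_def]
  have entropy: "measure_entropy f \<mu> = ereal (\<eta> \<mu> * (\<integral>x. \<psi> x \<partial>\<mu>))" and \<eta>_nonneg: "0 \<le> \<eta> \<mu>"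
    if \<mu>: "\<mu> \<in> \<I>" for \<mu>
    using measure_entropy_finite[OF assms(3) \<mu>[unfolded \<I>_def]] roof_pos[OF \<mu>] by (auto simp: \<eta>_def)
  have free_energy: "(measure_entropy f \<mu> + ereal (\<integral>x. \<beta> * \<phi> x \<partial>\<mu>)) / ereal (\<integral>x. \<psi> x \<partial>\<mu>) = ereal (\<eta> \<mu> + \<beta> * \<alpha> \<mu>)"
    if \<mu>: "\<mu> \<in> \<I>" for \<mu> \<beta>
    using entropy[OF \<mu>] roof_pos[OF \<mu>] by (simp add: \<alpha>_def add_divide_distrib)
  have upper: "ereal (\<eta> \<mu> + \<beta> * \<alpha> \<mu>) \<le> induced_pressure f \<psi> (\<lambda>x. \<beta> * \<phi> x)" if \<mu>: "\<mu> \<in> \<I>" for \<mu> \<beta>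
    using free_energy_quotient_le_induced_pressure[OF \<beta>\<phi>_cont \<mu>[unfolded \<I>_def]] free_energy[OF \<mu>] by simp
  obtain \<mu>0 where \<mu>0: "\<mu>0 \<in> \<F>" "\<mu>0 \<in> \<I>" using assms(7,8) unfolding \<I>_def by blast
  have P: "induced_pressure f \<psi> (\<lambda>x. \<beta> * \<phi> x) = ereal (p \<beta>)" for \<beta>
    using upper[OF \<mu>0(2), of \<beta>] induced_pressure_less_top[OF assms(3) \<beta>\<phi>_cont, of \<beta>]
    unfolding p_def by (cases "induced_pressure f \<psi> (\<lambda>x. \<beta> * \<phi> x)") auto
  have le_p: "\<eta> \<mu> + \<beta> * \<alpha> \<mu> \<le> p \<beta>" if "\<mu> \<in> \<I>" for \<mu> \<beta>
    using upper[OF that, of \<beta>] P[of \<beta>] by simp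
  have equilibrium: "equilibrium_states f \<psi> (\<lambda>x. \<beta> * \<phi> x) = {\<mu> \<in> \<I>. p \<beta> = \<eta> \<mu> + \<beta> * \<alpha> \<mu>}" for \<beta>
    unfolding equilibrium_states_def \<I>_def[symmetric] P using free_energy by auto
  have equilibrium1: "equilibrium_states f \<psi> \<phi> = {\<mu> \<in> \<I>. p 1 = \<eta> \<mu> + 1 * \<alpha> \<mu>}"
    using equilibrium[of 1] by simp
  have ratio_le: "(\<integral>x. \<phi> x \<partial>\<nu>) \<le> a * (\<integral>x. \<psi> x \<partial>\<nu>)" if "\<nu> \<in> \<I>" "\<alpha> \<nu> \<le> a" for \<nu> a
    using that(2) roof_pos[OF that(1)] by (simp add: \<alpha>_def pos_divide_le_eq)
  show ?thesis
  proof
    assume all: "\<forall>\<beta>::real. \<beta> \<ge> 1 \<longrightarrow> \<F> = equilibrium_states f \<psi> (\<lambda>x. \<beta> * \<phi> x)"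
    have F1: "\<F> = equilibrium_states f \<psi> \<phi>" using all[rule_format, of 1] by simp
    have max: "\<alpha> \<nu> \<le> \<alpha> \<mu>" if \<mu>: "\<mu> \<in> \<F>" and \<nu>: "\<nu> \<in> \<I>" for \<mu> \<nu>
    proof (rule ccontr)
      assume "\<not> \<alpha> \<nu> \<le> \<alpha> \<mu>"
      then have d: "0 < \<alpha> \<nu> - \<alpha> \<mu>" by simp
      \<comment> \<open>For this \<open>\<beta>\<close> the gain \<open>\<beta> * (\<alpha> \<nu> - \<alpha> \<mu>)\<close> exceeds \<open>\<eta> \<mu>\<close>.\<close>
      define \<beta> where "\<beta> = max 1 ((\<eta> \<mu> + 1) / (\<alpha> \<nu> - \<alpha> \<mu>))"
      have "1 \<le> \<beta>" by (simp add: \<beta>_def)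
      then have "\<F> = equilibrium_states f \<psi> (\<lambda>x. \<beta> * \<phi> x)" using all by blast
      then have "\<mu> \<in> equilibrium_states f \<psi> (\<lambda>x. \<beta> * \<phi> x)" using \<mu> by simp
      then have "p \<beta> = \<eta> \<mu> + \<beta> * \<alpha> \<mu>" using equilibrium by blast
      then have "\<beta> * (\<alpha> \<nu> - \<alpha> \<mu>) \<le> \<eta> \<mu>"
        using le_p[OF \<nu>, of \<beta>] \<eta>_nonneg[OF \<nu>] by (simp add: algebra_simps)
      moreover have "(\<eta> \<mu> + 1) / (\<alpha> \<nu> - \<alpha> \<mu>) * (\<alpha> \<nu> - \<alpha> \<mu>) \<le> \<beta> * (\<alpha> \<nu> - \<alpha> \<mu>)"
        using d by (intro mult_right_mono) (auto simp: \<beta>_def)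
      ultimately show False using d by simp
    qed
    have "ereal (\<alpha> \<mu>) = (SUP \<nu>\<in>\<I>. ereal (\<alpha> \<nu>))" if "\<mu> \<in> \<F>" for \<mu>
    proof (rule antisym)
      show "ereal (\<alpha> \<mu>) \<le> (SUP \<nu>\<in>\<I>. ereal (\<alpha> \<nu>))"
        using that assms(8) by (intro SUP_upper) (auto simp: \<I>_def)
      show "(SUP \<nu>\<in>\<I>. ereal (\<alpha> \<nu>)) \<le> ereal (\<alpha> \<mu>)"
        using max[OF that] by (intro SUP_least) simp
    qed
    then show "\<F> = equilibrium_states f \<psi> \<phi> \<and>
     (\<forall>\<mu>\<in>\<F>. ereal ((\<integral>x. \<phi> x \<partial>\<mu>) / (\<integral>x. \<psi> x \<partial>\<mu>)) =
        (SUP \<nu>\<in>invariant_measures f. ereal ((\<integral>x. \<phi> x \<partial>\<nu>) / (\<integral>x. \<psi> x \<partial>\<nu>))))"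
      using F1 by (simp add: \<alpha>_def \<I>_def)
  next
    assume "\<F> = equilibrium_states f \<psi> \<phi> \<and>
     (\<forall>\<mu>\<in>\<F>. ereal ((\<integral>x. \<phi> x \<partial>\<mu>) / (\<integral>x. \<psi> x \<partial>\<mu>)) =
        (SUP \<nu>\<in>invariant_measures f. ereal ((\<integral>x. \<phi> x \<partial>\<nu>) / (\<integral>x. \<psi> x \<partial>\<nu>))))"
    then have F1: "\<F> = equilibrium_states f \<psi> \<phi>"
      and sup: "\<And>\<mu>. \<mu> \<in> \<F> \<Longrightarrow> ereal (\<alpha> \<mu>) = (SUP \<nu>\<in>\<I>. ereal (\<alpha> \<nu>))"
      by (auto simp: \<alpha>_def \<I>_def)
    define a where "a = \<alpha> \<mu>0"
    have a_eq: "\<alpha> \<mu> = a" if "\<mu> \<in> \<F>" for \<mu>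
      using sup[OF that] sup[OF \<mu>0(1)] unfolding a_def by (metis ereal.inject)
    have a_max: "\<alpha> \<nu> \<le> a" if "\<nu> \<in> \<I>" for \<nu>
    proof -
      have "ereal (\<alpha> \<nu>) \<le> (SUP \<nu>\<in>\<I>. ereal (\<alpha> \<nu>))" using that by (rule SUP_upper)
      then show ?thesis unfolding sup[OF \<mu>0(1), symmetric] a_def by simp
    qed
    have p1: "p 1 = \<eta> \<mu> + \<alpha> \<mu>" if "\<mu> \<in> \<F>" for \<mu>
      using that F1 equilibrium1 by simp
    \<comment> \<open>The pressure is affine in \<open>\<beta>\<close>, with slope the maximal ratio.\<close>
    have p_eq: "p \<beta> = p 1 + (\<beta> - 1) * a" if \<beta>: "1 \<le> \<beta>" for \<beta>
    proof (rule antisym)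
      define \<theta> where "\<theta> x = (\<beta> - 1) * \<phi> x" for x
      have \<theta>_cont: "continuous_on UNIV \<theta>" unfolding \<theta>_def by (rule \<beta>\<phi>_cont)
      have "(\<integral>x. \<theta> x \<partial>\<nu>) \<le> (\<beta> - 1) * a * (\<integral>x. \<psi> x \<partial>\<nu>)" if "\<nu> \<in> invariant_measures f" for \<nu>
      proof -
        have "\<nu> \<in> \<I>" using that by (simp add: \<I>_def)
        then have "(\<beta> - 1) * (\<integral>x. \<phi> x \<partial>\<nu>) \<le> (\<beta> - 1) * (a * (\<integral>x. \<psi> x \<partial>\<nu>))"
          using \<beta> a_max by (intro mult_left_mono ratio_le) auto
        then show ?thesis by (simp add: \<theta>_def)
      qed
      note growth = birkhoff_growth_le[OF \<theta>_cont this]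
      have eq: "(\<lambda>x. \<phi> x + \<theta> x) = (\<lambda>x. \<beta> * \<phi> x)" by (auto simp: \<theta>_def algebra_simps)
      have "p \<beta> \<le> p 1 + (\<beta> - 1) * a + e" if "0 < e" for e
      proof -
        have "induced_pressure f \<psi> \<phi> < ereal (p 1 + e)" using P[of 1] that by simp
        from induced_pressure_add_le[OF growth this] show ?thesis unfolding eq P by simp
      qed
      then show "p \<beta> \<le> p 1 + (\<beta> - 1) * a" by (rule field_le_epsilon)
      show "p 1 + (\<beta> - 1) * a \<le> p \<beta>"
        using le_p[OF \<mu>0(2), of \<beta>] p1[OF \<mu>0(1)] by (simp add: a_def algebra_simps)
    qed
    show "\<forall>\<beta>::real. \<beta> \<ge> 1 \<longrightarrow> \<F> = equilibrium_states f \<psi> (\<lambda>x. \<beta> * \<phi> x)"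
    proof (intro allI impI set_eqI iffI)
      fix \<beta> :: real and \<mu>
      assume \<beta>: "1 \<le> \<beta>" and \<mu>: "\<mu> \<in> \<F>"
      then show "\<mu> \<in> equilibrium_states f \<psi> (\<lambda>x. \<beta> * \<phi> x)"
        using p_eq[OF \<beta>] p1[OF \<mu>] a_eq[OF \<mu>] assms(8) unfolding equilibrium
        by (auto simp: \<I>_def algebra_simps)
    next
      fix \<beta> :: real and \<mu>
      assume \<beta>: "1 \<le> \<beta>" and "\<mu> \<in> equilibrium_states f \<psi> (\<lambda>x. \<beta> * \<phi> x)"
      then have \<mu>: "\<mu> \<in> \<I>" and eq: "p \<beta> = \<eta> \<mu> + \<beta> * \<alpha> \<mu>" unfolding equilibrium by auto
      have "(\<beta> - 1) * \<alpha> \<mu> \<le> (\<beta> - 1) * a" using \<beta> a_max[OF \<mu>] by (intro mult_left_mono) auto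
      then have "p 1 \<le> \<eta> \<mu> + \<alpha> \<mu>" using p_eq[OF \<beta>] eq by (simp add: algebra_simps)
      then have "p 1 = \<eta> \<mu> + 1 * \<alpha> \<mu>" using le_p[OF \<mu>, of 1] by simp
      then show "\<mu> \<in> \<F>" unfolding F1 equilibrium1 using \<mu> by blast
    qed
  qed
qed

end
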